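(* Let $R$ be a one-dimensional commutative Noetherian local ring and let $M$ be a non-zero finitely generated two-periodic $R$-module that has rank. Then $M\otimes_R M^*$ has non-zero torsion, i.e. the torsion submodule of $M\otimes_R M^*$ is non-zero.
   Context: $M^*=\operatorname{Hom}_R(M,R)$. For a finitely generated module $M$ over a local ring, $\Omega^i_R M$ denotes the $i$-th syzygy of $M$ in its minimal free resolution. $M$ is two-periodic if $M\cong\Omega^2_R M$. $M$ has rank if there is an integer $r\ge 0$ such that $M\otimes_R Q\cong Q^r$, where $Q$ is the total ring of fractions of $R$ (equivalently, $M_{\mathfrak p}$ is free of rank $r$ over $R_{\mathfrak p}$ for all $\mathfrak p\in\operatorname{Ass}(R)$). The torsion submodule of a module consists of the elements annihilated by some non-zero-divisor of $R$. *)

theory Defs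
  imports "HOL-Algebra.Module" "HOL-Algebra.Ring_Divisibility" "HOL-Library.Extended_Nat"
begin

section \<open>Rings\<close>

locale local_ring = cring +
  assumes unique_maximalideal: "\<exists>!I. maximalideal I R"

definition max_ideal :: "('a, 'r) ring_scheme \<Rightarrow> 'a set" where
  "max_ideal R = (THE I. maximalideal I R)"

text \<open>Supremum of the lengths of chains of prime ideals. The zero ring also gets the value 0;
  it is not a local ring.\<close>

definition krull_dim :: "('a, 'r) ring_scheme \<Rightarrow> enat" where
  "krull_dim R =
     (SUP n \<in> {n. \<exists>P. (\<forall>i\<le>n. primeideal (P i) R) \<and> (\<forall>i<n. P i \<subset> P (Suc i))}. enat n)"

definition nonzerodivisors :: "('a, 'r) ring_scheme \<Rightarrow> 'a set" where
  "nonzerodivisors R =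
     {s \<in> carrier R. \<forall>x \<in> carrier R. s \<otimes>\<^bsub>R\<^esub> x = \<zero>\<^bsub>R\<^esub> \<longrightarrow> x = \<zero>\<^bsub>R\<^esub>}"

subsection \<open>The total ring of fractions\<close>

text \<open>The denominators are non-zero-divisors, so a / s and b / t are equal exactly when
  a t = b s; no further factor is needed.\<close>

definition frac_rel :: "('a, 'r) ring_scheme \<Rightarrow> (('a \<times> 'a) \<times> ('a \<times> 'a)) set" where
  "frac_rel R = {((a, s), (b, t)).
     a \<in> carrier R \<and> s \<in> nonzerodivisors R \<and> b \<in> carrier R \<and> t \<in> nonzerodivisors R \<and>
     a \<otimes>\<^bsub>R\<^esub> t = b \<otimes>\<^bsub>R\<^esub> s}"

definition mk_frac :: "('a, 'r) ring_scheme \<Rightarrow> 'a \<Rightarrow> 'a \<Rightarrow> ('a \<times> 'a) set" where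
  "mk_frac R a s = frac_rel R `` {(a, s)}"

definition total_frac_ring :: "('a, 'r) ring_scheme \<Rightarrow> ('a \<times> 'a) set ring" where
  "total_frac_ring R =
     \<lparr>carrier = (carrier R \<times> nonzerodivisors R) // frac_rel R,
      mult = (\<lambda>X Y. \<Union>x \<in> X. \<Union>y \<in> Y.
                mk_frac R (fst x \<otimes>\<^bsub>R\<^esub> fst y) (snd x \<otimes>\<^bsub>R\<^esub> snd y)),
      one = mk_frac R \<one>\<^bsub>R\<^esub> \<one>\<^bsub>R\<^esub>,
      zero = mk_frac R \<zero>\<^bsub>R\<^esub> \<one>\<^bsub>R\<^esub>,
      add = (\<lambda>X Y. \<Union>x \<in> X. \<Union>y \<in> Y.
               mk_frac R (fst x \<otimes>\<^bsub>R\<^esub> snd y \<oplus>\<^bsub>R\<^esub> fst y \<otimes>\<^bsub>R\<^esub> snd x)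
                      (snd x \<otimes>\<^bsub>R\<^esub> snd y))\<rparr>"

definition to_frac :: "('a, 'r) ring_scheme \<Rightarrow> 'a \<Rightarrow> ('a \<times> 'a) set" where
  "to_frac R a = mk_frac R a \<one>\<^bsub>R\<^esub>"

section \<open>Modules\<close>

text \<open>The record of modules extends that of rings; in the modules below the fields
  \<^const>\<open>mult\<close> and \<^const>\<open>one\<close> have no meaning unless the module is a ring.\<close>

text \<open>Homomorphisms are extensional functions, so that they are equal when they agree on the
  carrier.\<close>

definition mod_hom ::
  "('a, 'r) ring_scheme \<Rightarrow> ('a, 'b, 'm) module_scheme \<Rightarrow> ('a, 'c, 'n) module_scheme
     \<Rightarrow> ('b \<Rightarrow> 'c) set" where
  "mod_hom R M N = {h \<in> carrier M \<rightarrow>\<^sub>E carrier N.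
     (\<forall>x \<in> carrier M. \<forall>y \<in> carrier M. h (x \<oplus>\<^bsub>M\<^esub> y) = h x \<oplus>\<^bsub>N\<^esub> h y) \<and>
     (\<forall>a \<in> carrier R. \<forall>x \<in> carrier M. h (a \<odot>\<^bsub>M\<^esub> x) = a \<odot>\<^bsub>N\<^esub> h x)}"

definition mod_iso ::
  "('a, 'r) ring_scheme \<Rightarrow> ('a, 'b, 'm) module_scheme \<Rightarrow> ('a, 'c, 'n) module_scheme \<Rightarrow> bool" where
  "mod_iso R M N \<longleftrightarrow> (\<exists>h \<in> mod_hom R M N. bij_betw h (carrier M) (carrier N))"

definition submod_span ::
  "('a, 'r) ring_scheme \<Rightarrow> ('a, 'b, 'm) module_scheme \<Rightarrow> 'b set \<Rightarrow> 'b set" where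
  "submod_span R M S = \<Inter>{H. submodule H R M \<and> S \<subseteq> H}"

definition fin_gen :: "('a, 'r) ring_scheme \<Rightarrow> ('a, 'b, 'm) module_scheme \<Rightarrow> bool" where
  "fin_gen R M \<longleftrightarrow> (\<exists>S \<subseteq> carrier M. finite S \<and> submod_span R M S = carrier M)"

definition torsion ::
  "('a, 'r) ring_scheme \<Rightarrow> ('a, 'b, 'm) module_scheme \<Rightarrow> 'b set" where
  "torsion R M = {x \<in> carrier M. \<exists>s \<in> nonzerodivisors R. s \<odot>\<^bsub>M\<^esub> x = \<zero>\<^bsub>M\<^esub>}"

text \<open>A ring \<open>A\<close> as a module along a homomorphism \<open>\<phi>\<close> into \<open>A\<close>.\<close>

definition ring_module :: "('a \<Rightarrow> 'b) \<Rightarrow> ('b, 's) ring_scheme \<Rightarrow> ('a, 'b) module" where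
  "ring_module \<phi> A =
     \<lparr>carrier = carrier A, mult = mult A, one = one A, zero = zero A, add = add A,
      smult = (\<lambda>a x. \<phi> a \<otimes>\<^bsub>A\<^esub> x)\<rparr>"

definition hom_module ::
  "('a, 'r) ring_scheme \<Rightarrow> ('a, 'b, 'm) module_scheme \<Rightarrow> ('a, 'c, 'n) module_scheme
     \<Rightarrow> ('a, 'b \<Rightarrow> 'c) module" where
  "hom_module R M N =
     \<lparr>carrier = mod_hom R M N, mult = undefined, one = undefined,
      zero = (\<lambda>x \<in> carrier M. \<zero>\<^bsub>N\<^esub>),
      add = (\<lambda>f g. \<lambda>x \<in> carrier M. f x \<oplus>\<^bsub>N\<^esub> g x),
      smult = (\<lambda>a f. \<lambda>x \<in> carrier M. a \<odot>\<^bsub>N\<^esub> f x)\<rparr>"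

definition dual ::
  "('a, 'r) ring_scheme \<Rightarrow> ('a, 'b, 'm) module_scheme \<Rightarrow> ('a, 'b \<Rightarrow> 'a) module" where
  "dual R M = hom_module R M (ring_module (\<lambda>a. a) R)"

text \<open>The free module with basis \<open>X\<close>; the free module of rank \<open>n\<close> is the one with basis
  \<open>{..<n}\<close>.\<close>

definition free_module :: "('a, 'r) ring_scheme \<Rightarrow> 'x set \<Rightarrow> ('a, 'x \<Rightarrow> 'a) module" where
  "free_module R X =
     \<lparr>carrier = {f \<in> X \<rightarrow>\<^sub>E carrier R. finite {x \<in> X. f x \<noteq> \<zero>\<^bsub>R\<^esub>}},
      mult = undefined, one = undefined,
      zero = (\<lambda>x \<in> X. \<zero>\<^bsub>R\<^esub>),
      add = (\<lambda>f g. \<lambda>x \<in> X. f x \<oplus>\<^bsub>R\<^esub> g x),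
      smult = (\<lambda>a f. \<lambda>x \<in> X. a \<otimes>\<^bsub>R\<^esub> f x)\<rparr>"

definition free_gen :: "('a, 'r) ring_scheme \<Rightarrow> 'x set \<Rightarrow> 'x \<Rightarrow> ('x \<Rightarrow> 'a)" where
  "free_gen R X x = (\<lambda>y \<in> X. if y = x then \<one>\<^bsub>R\<^esub> else \<zero>\<^bsub>R\<^esub>)"

text \<open>The linear map between free modules that maps the basis element \<open>x\<close> to the basis element
  \<open>g x\<close>.\<close>

definition free_map ::
  "('a, 'r) ring_scheme \<Rightarrow> 'x set \<Rightarrow> 'y set \<Rightarrow> ('x \<Rightarrow> 'y) \<Rightarrow> ('x \<Rightarrow> 'a) \<Rightarrow> ('y \<Rightarrow> 'a)" where
  "free_map R X Y g f =
     (\<lambda>y \<in> Y. finsum R f {x \<in> X. f x \<noteq> \<zero>\<^bsub>R\<^esub> \<and> g x = y})"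

definition quot_module ::
  "('a, 'b, 'm) module_scheme \<Rightarrow> 'b set \<Rightarrow> ('a, 'b set) module" where
  "quot_module M H =
     \<lparr>carrier = a_rcosets\<^bsub>M\<^esub> H, mult = undefined, one = undefined,
      zero = H, add = set_add M,
      smult = (\<lambda>a X. \<Union>x \<in> X. H +>\<^bsub>M\<^esub> (a \<odot>\<^bsub>M\<^esub> x))\<rparr>"

subsection \<open>Tensor products\<close>

definition tensor_rels ::
  "('a, 'r) ring_scheme \<Rightarrow> ('a, 'b, 'm) module_scheme \<Rightarrow> ('a, 'c, 'n) module_scheme
     \<Rightarrow> ('b \<times> 'c \<Rightarrow> 'a) set" where
  "tensor_rels R M N =
    (let X = carrier M \<times> carrier N; F = free_module R X; e = free_gen R X in
       {e (x \<oplus>\<^bsub>M\<^esub> x', y) \<ominus>\<^bsub>F\<^esub> (e (x, y) \<oplus>\<^bsub>F\<^esub> e (x', y)) | x x' y.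
          x \<in> carrier M \<and> x' \<in> carrier M \<and> y \<in> carrier N} \<union>
       {e (x, y \<oplus>\<^bsub>N\<^esub> y') \<ominus>\<^bsub>F\<^esub> (e (x, y) \<oplus>\<^bsub>F\<^esub> e (x, y')) | x y y'.
          x \<in> carrier M \<and> y \<in> carrier N \<and> y' \<in> carrier N} \<union>
       {e (a \<odot>\<^bsub>M\<^esub> x, y) \<ominus>\<^bsub>F\<^esub> (a \<odot>\<^bsub>F\<^esub> e (x, y)) | a x y.
          a \<in> carrier R \<and> x \<in> carrier M \<and> y \<in> carrier N} \<union>
       {e (x, a \<odot>\<^bsub>N\<^esub> y) \<ominus>\<^bsub>F\<^esub> (a \<odot>\<^bsub>F\<^esub> e (x, y)) | a x y.
          a \<in> carrier R \<and> x \<in> carrier M \<and> y \<in> carrier N})"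

definition tensor_ker ::
  "('a, 'r) ring_scheme \<Rightarrow> ('a, 'b, 'm) module_scheme \<Rightarrow> ('a, 'c, 'n) module_scheme
     \<Rightarrow> ('b \<times> 'c \<Rightarrow> 'a) set" where
  "tensor_ker R M N =
     submod_span R (free_module R (carrier M \<times> carrier N)) (tensor_rels R M N)"

definition tensor_module ::
  "('a, 'r) ring_scheme \<Rightarrow> ('a, 'b, 'm) module_scheme \<Rightarrow> ('a, 'c, 'n) module_scheme
     \<Rightarrow> ('a, ('b \<times> 'c \<Rightarrow> 'a) set) module" where
  "tensor_module R M N =
     quot_module (free_module R (carrier M \<times> carrier N)) (tensor_ker R M N)"

text \<open>The endomorphism of the tensor product of \<open>M\<close> and \<open>N\<close> that is induced by an endomorphism
  \<open>h\<close> of \<open>N\<close> and the identity of \<open>M\<close>.\<close>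

definition tensor_map_right ::
  "('a, 'r) ring_scheme \<Rightarrow> ('a, 'b, 'm) module_scheme \<Rightarrow> ('a, 'c, 'n) module_scheme
     \<Rightarrow> ('c \<Rightarrow> 'c) \<Rightarrow> ('b \<times> 'c \<Rightarrow> 'a) set \<Rightarrow> ('b \<times> 'c \<Rightarrow> 'a) set" where
  "tensor_map_right R M N h T =
    (let X = carrier M \<times> carrier N in
       \<Union>f \<in> T. tensor_ker R M N +>\<^bsub>free_module R X\<^esub> free_map R X X (\<lambda>(x, y). (x, h y)) f)"

text \<open>The tensor product of \<open>M\<close> with a ring \<open>A\<close> over \<open>R\<close>, as an \<open>A\<close>-module; \<open>A\<close> acts on the
  second factor.\<close>

definition base_change ::
  "('a, 'r) ring_scheme \<Rightarrow> ('a, 'b, 'm) module_scheme \<Rightarrow> ('a \<Rightarrow> 'c) \<Rightarrow> ('c, 's) ring_scheme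
     \<Rightarrow> ('c, ('b \<times> 'c \<Rightarrow> 'a) set) module" where
  "base_change R M \<phi> A =
    (let N = ring_module \<phi> A; T = tensor_module R M N in
     \<lparr>carrier = carrier T, mult = undefined, one = undefined, zero = zero T, add = add T,
      smult = (\<lambda>q. tensor_map_right R M N (\<lambda>y. q \<otimes>\<^bsub>A\<^esub> y))\<rparr>)"

definition has_rank :: "('a, 'r) ring_scheme \<Rightarrow> ('a, 'b, 'm) module_scheme \<Rightarrow> bool" where
  "has_rank R M \<longleftrightarrow>
    (let Q = total_frac_ring R in
     \<exists>r::nat. mod_iso Q (base_change R M (to_frac R) Q) (free_module Q {..<r}))"

subsection \<open>Minimal free resolutions and syzygies\<close>

definition ideal_smult ::
  "('a, 'r) ring_scheme \<Rightarrow> ('a, 'b, 'm) module_scheme \<Rightarrow> 'a set \<Rightarrow> 'b set" where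
  "ideal_smult R M I = submod_span R M {a \<odot>\<^bsub>M\<^esub> x | a x. a \<in> I \<and> x \<in> carrier M}"

text \<open>A resolution with the free module of rank \<open>b i\<close> in degree \<open>i\<close>, the differential
  \<open>d i\<close> from degree \<open>i + 1\<close> to degree \<open>i\<close>, and the augmentation \<open>p\<close>.\<close>

definition min_free_resolution ::
  "('a, 'r) ring_scheme \<Rightarrow> ('a, 'b, 'm) module_scheme \<Rightarrow> (nat \<Rightarrow> nat)
     \<Rightarrow> (nat \<Rightarrow> (nat \<Rightarrow> 'a) \<Rightarrow> (nat \<Rightarrow> 'a)) \<Rightarrow> ((nat \<Rightarrow> 'a) \<Rightarrow> 'b) \<Rightarrow> bool" where
  "min_free_resolution R M b d p \<longleftrightarrow>
    (let F = (\<lambda>i. free_module R {..<b i}) in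
     p \<in> mod_hom R (F 0) M \<and>
     (\<forall>i. d i \<in> mod_hom R (F (Suc i)) (F i)) \<and>
     p ` carrier (F 0) = carrier M \<and>
     d 0 ` carrier (F 1) = a_kernel (F 0) M p \<and>
     (\<forall>i. d (Suc i) ` carrier (F (Suc (Suc i))) = a_kernel (F (Suc i)) (F i) (d i)) \<and>
     (\<forall>i. d i ` carrier (F (Suc i)) \<subseteq> ideal_smult R (F i) (max_ideal R)))"

text \<open>\<open>N\<close> is an \<open>i\<close>-th syzygy of \<open>M\<close>: for \<open>i = Suc j\<close> this is the image of \<open>d j\<close>, a
  submodule of the free module in degree \<open>j\<close>. Minimal free resolutions, and hence syzygies, are
  unique only up to isomorphism.\<close>

definition is_syzygy ::
  "('a, 'r) ring_scheme \<Rightarrow> ('a, 'b, 'm) module_scheme \<Rightarrow> nat \<Rightarrow> ('a, 'c, 'n) module_scheme \<Rightarrow> bool"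
where
  "is_syzygy R M i N \<longleftrightarrow>
    (case i of
       0 \<Rightarrow> mod_iso R N M
     | Suc j \<Rightarrow> \<exists>b d p. min_free_resolution R M b d p \<and>
         mod_iso R N
           ((free_module R {..<b j})\<lparr>carrier := d j ` carrier (free_module R {..<b (Suc j)})\<rparr>))"

definition two_periodic :: "('a, 'r) ring_scheme \<Rightarrow> ('a, 'b, 'm) module_scheme \<Rightarrow> bool" where
  "two_periodic R M \<longleftrightarrow> is_syzygy R M 2 M"

end

(* If the torsion-free module M (x) M* were torsion-free, then every homomorphism from M to
   N = ker p, for a minimal presentation F1 --d--> F0 --p--> M, would lift to F1. Since M has rank,
   M is isomorphic up to a non-zero-divisor s to a free module R^r. Let j embed M into F1 as the
   kernel of d. The sequence Hom(M,F1) -> Hom(M,F0) -> Hom(M,F1) -> Hom(M,F0) of the maps induced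
   by d, j p and d acts on the quotients by the homomorphisms that factor through R^r. These
   quotients have the same finite length: rank F1 = rank F0 (or s is a unit), and R/sR has finite
   length because R has dimension one. The lifting property gives exactness at one spot, hence by
   counting lengths at the other one. Applied to j this shows that p splits, so ker p is a direct
   summand of F0 inside m F0; by Nakayama's lemma d = 0, whence F1 = 0 and M = 0. *)

theory Submission
  imports Defs
begin

section \<open>Lengths\<close>

text \<open>The lifting property rests on reading Hom(M, F0) as F0 \<otimes> M*, so that p induces a
  map to M \<otimes> M*. If p f = 0, then s f is a sum of rank-one maps with values in the image of
  f; each of them goes to some p(v) \<otimes> h = 0, so f goes to a torsion element. Once this
  element is zero, right exactness of the tensor product places f in the image of Hom(M, F1). The
  Hom modules themselves need not have finite length, so nothing can be counted on them. The
  homomorphisms through R^r are divided out for two reasons. Up to s every homomorphism is one of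
  them, so what remains has finite length. And they come from maps out of a free module, which lift
  whenever their values permit it, so corrections by them destroy neither exactness nor the
  splitting. The ranks of F0 and F1 are compared through the lengths of F0/sF0 and F1/sF1, both of
  which are built from M/sM and N/sN; this replaces a localization by one more count of
  lengths.\<close>

definition strict_chain :: "'x set set \<Rightarrow> nat \<Rightarrow> (nat \<Rightarrow> 'x set) \<Rightarrow> bool" where
  "strict_chain \<S> n C \<longleftrightarrow> (\<forall>i\<le>n. C i \<in> \<S>) \<and> (\<forall>i<n. C i \<subset> C (Suc i))"

definition chain_length :: "'x set set \<Rightarrow> enat" where
  "chain_length \<S> = (SUP n \<in> {n. \<exists>C. strict_chain \<S> n C}. enat n)"

lemma chain_length_ge: "strict_chain \<S> n C \<Longrightarrow> enat n \<le> chain_length \<S>"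
  unfolding chain_length_def by (rule SUP_upper) auto

lemma chain_length_le: "(\<And>n C. strict_chain \<S> n C \<Longrightarrow> enat n \<le> l) \<Longrightarrow> chain_length \<S> \<le> l"
  unfolding chain_length_def by (rule SUP_least) auto

lemma strict_chain_downward: "strict_chain \<S> n C \<Longrightarrow> m \<le> n \<Longrightarrow> strict_chain \<S> m C"
  unfolding strict_chain_def by auto

text \<open>Strict chains can be truncated, so every finite lower bound of the supremum is realised
  by a chain of exactly that length. Nonemptiness of \<open>\<S>\<close> matters for n = 0 only: the
  supremum over no chains at all is also 0.\<close>

lemma chain_length_geD:
  assumes "enat n \<le> chain_length \<S>" "\<S> \<noteq> {}"
  obtains C where "strict_chain \<S> n C"
proof (cases n)
  case 0
  obtain S where "S \<in> \<S>" using assms by auto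
  then have "strict_chain \<S> 0 (\<lambda>_. S)" unfolding strict_chain_def by auto
  then show ?thesis using that 0 by auto
next
  case (Suc m)
  have "\<exists>k>m. \<exists>C. strict_chain \<S> k C"
  proof (rule ccontr)
    assume "\<not> ?thesis"
    then have "chain_length \<S> \<le> enat m"
      by (intro chain_length_le) (metis enat_ord_simps(1) not_le)
    then show False using assms(1) Suc by (metis Suc_n_not_le_n enat_ord_simps(1) order_trans)
  qed
  then show ?thesis using that Suc strict_chain_downward by (metis Suc_leI)
qed

lemma chain_length_mono_map:
  assumes "\<And>C. C \<in> \<S> \<Longrightarrow> f C \<in> \<T>" and "\<And>C D. C \<in> \<S> \<Longrightarrow> D \<in> \<S> \<Longrightarrow> C \<subset> D \<Longrightarrow> f C \<subset> f D"
  shows "chain_length \<S> \<le> chain_length \<T>"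
proof (rule chain_length_le)
  fix n C assume "strict_chain \<S> n C"
  then have "strict_chain \<T> n (\<lambda>i. f (C i))"
    using assms unfolding strict_chain_def by (auto simp: Suc_leI less_imp_le)
  then show "enat n \<le> chain_length \<T>" by (rule chain_length_ge)
qed

text \<open>Deleting repetitions turns a weakly increasing sequence into a strict chain.\<close>

lemma weak_chain:
  assumes "\<forall>i\<le>n. A i \<in> \<S>" and "\<forall>i<n. A i \<subseteq> A (Suc i)"
  shows "\<exists>C. strict_chain \<S> (card {i. i < n \<and> A i \<noteq> A (Suc i)}) C \<and>
    C (card {i. i < n \<and> A i \<noteq> A (Suc i)}) = A n"
  using assms
proof (induction n)
  case 0
  then show ?case by (intro exI[of _ A]) (auto simp: strict_chain_def)
next
  case (Suc n)
  let ?c = "card {i. i < n \<and> A i \<noteq> A (Suc i)}"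
  obtain C where C: "strict_chain \<S> ?c C" "C ?c = A n" using Suc by auto
  show ?case
  proof (cases "A n = A (Suc n)")
    case True
    then have "{i. i < Suc n \<and> A i \<noteq> A (Suc i)} = {i. i < n \<and> A i \<noteq> A (Suc i)}"
      by (auto simp: less_Suc_eq)
    then show ?thesis using C True by auto
  next
    case False
    then have "{i. i < Suc n \<and> A i \<noteq> A (Suc i)} = insert n {i. i < n \<and> A i \<noteq> A (Suc i)}"
      by (auto simp: less_Suc_eq)
    then have c: "card {i. i < Suc n \<and> A i \<noteq> A (Suc i)} = Suc ?c" by simp
    have "A n \<subset> A (Suc n)" using False Suc.prems by blast
    then have "strict_chain \<S> (Suc ?c) (C(Suc ?c := A (Suc n)))"
      using C Suc.prems(1) unfolding strict_chain_def by (auto simp: le_Suc_eq less_Suc_eq)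
    then show ?thesis unfolding c by (intro exI[of _ "C(Suc ?c := A (Suc n))"] conjI) (assumption | simp)+
  qed
qed

lemma card_changes_le:
  assumes "\<forall>i\<le>n. A i \<in> \<S>" and "\<forall>i<n. A i \<subseteq> A (Suc i)"
  shows "enat (card {i. i < n \<and> A i \<noteq> A (Suc i)}) \<le> chain_length \<S>"
  using weak_chain[OF assms] chain_length_ge by blast

text \<open>Suprema in \<open>enat\<close> are compared through their finite lower bounds. For
  \<open>c = enat k\<close> an infinite summand would have \<open>Suc k\<close> as a lower bound, so
  both summands are finite and serve as their own bounds.\<close>

lemma enat_add_leI:
  assumes "\<And>m n. enat m \<le> a \<Longrightarrow> enat n \<le> b \<Longrightarrow> enat (m + n) \<le> c"
  shows "a + b \<le> c"
proof (cases c)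
  case (enat k)
  have "\<exists>m. a = enat m"
  proof (cases a)
    case infinity
    then show ?thesis using assms[of "Suc k" 0] enat by (auto simp: zero_enat_def[symmetric])
  qed auto
  moreover have "\<exists>m. b = enat m"
  proof (cases b)
    case infinity
    then show ?thesis using assms[of 0 "Suc k"] enat by (auto simp: zero_enat_def[symmetric])
  qed auto
  ultimately obtain m n where "a = enat m" "b = enat n" by blast
  then show ?thesis using assms[of m n] by simp
qed simp

section \<open>Submodules: sums, intersections and the modular law\<close>

context module
begin

lemma
  assumes "submodule H R M"
  shows submodule_subset: "H \<subseteq> carrier M"
    and submodule_mem: "x \<in> H \<Longrightarrow> x \<in> carrier M"
    and submodule_zero: "\<zero>\<^bsub>M\<^esub> \<in> H"
    and submodule_add: "x \<in> H \<Longrightarrow> y \<in> H \<Longrightarrow> x \<oplus>\<^bsub>M\<^esub> y \<in> H"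
    and submodule_minus: "x \<in> H \<Longrightarrow> y \<in> H \<Longrightarrow> x \<ominus>\<^bsub>M\<^esub> y \<in> H"
    and submodule_smult: "a \<in> carrier R \<Longrightarrow> x \<in> H \<Longrightarrow> a \<odot>\<^bsub>M\<^esub> x \<in> H"
proof -
  note E = submoduleE[OF assms]
  show "H \<subseteq> carrier M" "x \<in> H \<Longrightarrow> x \<in> carrier M" using E(1) by auto
  show "\<zero>\<^bsub>M\<^esub> \<in> H" using subgroup.one_closed[OF submodule.axioms(1)[OF assms]] by simp
  show "x \<in> H \<Longrightarrow> y \<in> H \<Longrightarrow> x \<oplus>\<^bsub>M\<^esub> y \<in> H" by (rule E(5))
  show "x \<in> H \<Longrightarrow> y \<in> H \<Longrightarrow> x \<ominus>\<^bsub>M\<^esub> y \<in> H" unfolding a_minus_def by (intro E)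
  show "a \<in> carrier R \<Longrightarrow> x \<in> H \<Longrightarrow> a \<odot>\<^bsub>M\<^esub> x \<in> H" by (rule E(4))
qed

lemma submodule_add_cancel:
  assumes "submodule H R M" "x \<oplus>\<^bsub>M\<^esub> y \<in> H" "y \<in> H" "x \<in> carrier M"
  shows "x \<in> H"
proof -
  have "x = (x \<oplus>\<^bsub>M\<^esub> y) \<ominus>\<^bsub>M\<^esub> y"
    using assms(4) submodule_mem[OF assms(1,3)] by (simp add: M.minus_eq M.a_assoc M.r_neg)
  then show ?thesis using submodule_minus[OF assms(1-3)] by simp
qed

lemma submoduleI':
  assumes "H \<subseteq> carrier M" "\<zero>\<^bsub>M\<^esub> \<in> H"
    and "\<And>x y. x \<in> H \<Longrightarrow> y \<in> H \<Longrightarrow> x \<oplus>\<^bsub>M\<^esub> y \<in> H"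
    and "\<And>a x. a \<in> carrier R \<Longrightarrow> x \<in> H \<Longrightarrow> a \<odot>\<^bsub>M\<^esub> x \<in> H"
  shows "submodule H R M"
proof (rule submoduleI[OF assms(1,2) _ assms(3,4)])
  fix x assume x: "x \<in> H"
  have "\<ominus>\<^bsub>M\<^esub> x = (\<ominus> \<one>) \<odot>\<^bsub>M\<^esub> x" using x assms(1) by (subst smult_l_minus) auto
  then show "\<ominus>\<^bsub>M\<^esub> x \<in> H" using assms(4)[OF _ x] by simp
qed

lemma submodule_singleton_zero: "submodule {\<zero>\<^bsub>M\<^esub>} R M"
  by (rule submoduleI') auto

lemma minus_eq_zero_iff:
  assumes "x \<in> carrier M" "y \<in> carrier M"
  shows "x \<ominus>\<^bsub>M\<^esub> y = \<zero>\<^bsub>M\<^esub> \<longleftrightarrow> x = y"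
proof
  assume "x \<ominus>\<^bsub>M\<^esub> y = \<zero>\<^bsub>M\<^esub>"
  moreover have "x = (x \<ominus>\<^bsub>M\<^esub> y) \<oplus>\<^bsub>M\<^esub> y" using assms by (simp add: a_minus_def M.a_assoc M.l_neg)
  ultimately show "x = y" using assms by simp
qed (use assms in \<open>simp add: a_minus_def M.r_neg\<close>)

lemma submodule_finsum:
  assumes H: "submodule H R M" and "finite I" "\<And>i. i \<in> I \<Longrightarrow> f i \<in> H"
  shows "(\<Oplus>\<^bsub>M\<^esub>i\<in>I. f i) \<in> H"
  using assms(2,3)
proof (induction I)
  case empty
  then show ?case using submodule_zero[OF H] by simp
next
  case (insert i I)
  then show ?case using submodule_add[OF H] submodule_mem[OF H] by (subst M.finsum_insert) auto
qed

lemma submodule_Int: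
  assumes "submodule H R M" "submodule K R M"
  shows "submodule (H \<inter> K) R M"
  using submodule_mem[OF assms(1)] submodule_zero[OF assms(1)] submodule_zero[OF assms(2)]
  by (intro submoduleI') (simp_all add: submodule_add[OF assms(1)] submodule_add[OF assms(2)]
      submodule_smult[OF assms(1)] submodule_smult[OF assms(2)] subset_iff)

lemma mem_set_add: "x \<in> H <+>\<^bsub>M\<^esub> K \<longleftrightarrow> (\<exists>h\<in>H. \<exists>k\<in>K. x = h \<oplus>\<^bsub>M\<^esub> k)"
  by (auto simp: set_add_def')

lemma submodule_set_add:
  assumes H: "submodule H R M" and K: "submodule K R M"
  shows "submodule (H <+>\<^bsub>M\<^esub> K) R M"
proof (rule submoduleI')
  note c = submodule_mem[OF H] submodule_mem[OF K]
  show "H <+>\<^bsub>M\<^esub> K \<subseteq> carrier M" using c by (auto simp: mem_set_add)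
  show "\<zero>\<^bsub>M\<^esub> \<in> H <+>\<^bsub>M\<^esub> K"
    using submodule_zero[OF H] submodule_zero[OF K] by (force simp: mem_set_add)
  show "x \<oplus>\<^bsub>M\<^esub> y \<in> H <+>\<^bsub>M\<^esub> K" if "x \<in> H <+>\<^bsub>M\<^esub> K" "y \<in> H <+>\<^bsub>M\<^esub> K" for x y
  proof -
    obtain h k h' k' where "h \<in> H" "k \<in> K" "h' \<in> H" "k' \<in> K" "x = h \<oplus>\<^bsub>M\<^esub> k" "y = h' \<oplus>\<^bsub>M\<^esub> k'"
      using \<open>x \<in> _\<close> \<open>y \<in> _\<close> by (auto simp: mem_set_add)
    moreover from this have "x \<oplus>\<^bsub>M\<^esub> y = (h \<oplus>\<^bsub>M\<^esub> h') \<oplus>\<^bsub>M\<^esub> (k \<oplus>\<^bsub>M\<^esub> k')"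
      using c by (simp add: M.add.m_ac)
    ultimately show ?thesis
      using submodule_add[OF H] submodule_add[OF K] unfolding mem_set_add by metis
  qed
  show "a \<odot>\<^bsub>M\<^esub> x \<in> H <+>\<^bsub>M\<^esub> K" if "a \<in> carrier R" "x \<in> H <+>\<^bsub>M\<^esub> K" for a x
  proof -
    obtain h k where "h \<in> H" "k \<in> K" "x = h \<oplus>\<^bsub>M\<^esub> k" using \<open>x \<in> _\<close> by (auto simp: mem_set_add)
    moreover from this have "a \<odot>\<^bsub>M\<^esub> x = a \<odot>\<^bsub>M\<^esub> h \<oplus>\<^bsub>M\<^esub> a \<odot>\<^bsub>M\<^esub> k"
      using c \<open>a \<in> _\<close> by (simp add: smult_r_distr)
    ultimately show ?thesis
      using submodule_smult[OF H \<open>a \<in> _\<close>] submodule_smult[OF K \<open>a \<in> _\<close>] unfolding mem_set_add by metis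
  qed
qed

lemma set_add_upper:
  assumes "submodule H R M" "submodule K R M"
  shows "H \<subseteq> H <+>\<^bsub>M\<^esub> K" "K \<subseteq> H <+>\<^bsub>M\<^esub> K"
proof -
  show "H \<subseteq> H <+>\<^bsub>M\<^esub> K"
  proof
    fix h assume "h \<in> H"
    moreover have "h = h \<oplus>\<^bsub>M\<^esub> \<zero>\<^bsub>M\<^esub>" using submodule_mem[OF assms(1) \<open>h \<in> H\<close>] by simp
    ultimately show "h \<in> H <+>\<^bsub>M\<^esub> K"
      using submodule_zero[OF assms(2)] unfolding mem_set_add by blast
  qed
  show "K \<subseteq> H <+>\<^bsub>M\<^esub> K"
  proof
    fix k assume "k \<in> K"
    moreover have "k = \<zero>\<^bsub>M\<^esub> \<oplus>\<^bsub>M\<^esub> k" using submodule_mem[OF assms(2) \<open>k \<in> K\<close>] by simp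
    ultimately show "k \<in> H <+>\<^bsub>M\<^esub> K"
      using submodule_zero[OF assms(1)] unfolding mem_set_add by blast
  qed
qed

lemma set_add_least:
  assumes "submodule L R M" "H \<subseteq> L" "K \<subseteq> L"
  shows "H <+>\<^bsub>M\<^esub> K \<subseteq> L"
  using assms(2,3) by (auto simp: mem_set_add intro!: submodule_add[OF assms(1)])

lemma set_add_mono: "H \<subseteq> H' \<Longrightarrow> K \<subseteq> K' \<Longrightarrow> H <+>\<^bsub>M\<^esub> K \<subseteq> H' <+>\<^bsub>M\<^esub> K'"
  unfolding subset_iff mem_set_add by blast

text \<open>An element of \<open>D\<close> is c + h with c in \<open>C\<close> and h in
  \<open>H\<close>; then h lies in D \<inter> H = C \<inter> H, hence in \<open>C\<close>. In
  \<open>mlen_add\<close> this ensures that no strict step of a chain disappears both in the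
  intersections and in the sums with \<open>H\<close>.\<close>

lemma submodule_modular:
  assumes C: "submodule C R M" and D: "submodule D R M" and H: "submodule H R M"
    and "C \<subseteq> D" "C \<inter> H = D \<inter> H" "C <+>\<^bsub>M\<^esub> H = D <+>\<^bsub>M\<^esub> H"
  shows "C = D"
proof
  show "D \<subseteq> C"
  proof
    fix x assume x: "x \<in> D"
    then have "x \<in> C <+>\<^bsub>M\<^esub> H" using set_add_upper(1)[OF D H] assms(6) by auto
    then obtain c h where ch: "c \<in> C" "h \<in> H" "x = c \<oplus>\<^bsub>M\<^esub> h" by (auto simp: mem_set_add)
    then have "h \<oplus>\<^bsub>M\<^esub> c \<in> D" using x submodule_mem[OF C] submodule_mem[OF H] by (simp add: M.a_comm)
    then have "h \<in> D" by (rule submodule_add_cancel[OF D]) (use ch assms(4) submodule_mem[OF H] in auto)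
    then have "h \<in> C" using ch assms(5) by auto
    then show "x \<in> C" using ch submodule_add[OF C] by auto
  qed
qed fact

end

text \<open>The length of the quotient H/K, read off from the submodules between \<open>K\<close>
  and \<open>H\<close>. Staying inside one ambient module avoids forming quotients and transporting
  chains to them.\<close>

definition mlen ::
  "('a, 'r) ring_scheme \<Rightarrow> ('a, 'b, 'm) module_scheme \<Rightarrow> 'b set \<Rightarrow> 'b set \<Rightarrow> enat" where
  "mlen R M K H = chain_length {C. submodule C R M \<and> K \<subseteq> C \<and> C \<subseteq> H}"

text \<open>The inclusion at the joint may be an equality, so \<open>B 0\<close> is left out and the
  chain passes from \<open>A m\<close> straight to \<open>B 1\<close>. No length is lost: m steps of
  \<open>A\<close> and n steps of \<open>B\<close> remain.\<close>

lemma strict_chain_append: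
  assumes "strict_chain \<S> m A" "strict_chain \<T> n B" "A m \<subseteq> B 0" "\<S> \<subseteq> \<U>" "\<T> \<subseteq> \<U>"
  shows "strict_chain \<U> (m + n) (\<lambda>i. if i \<le> m then A i else B (i - m))"
  unfolding strict_chain_def
proof (intro conjI allI impI)
  fix i assume "i \<le> m + n"
  then show "(if i \<le> m then A i else B (i - m)) \<in> \<U>" using assms unfolding strict_chain_def by auto
next
  fix i assume i: "i < m + n"
  consider "i < m" | "i = m" | "i > m" by linarith
  then show "(if i \<le> m then A i else B (i - m)) \<subset> (if Suc i \<le> m then A (Suc i) else B (Suc i - m))"
  proof cases
    case 2
    then have "B 0 \<subset> B (Suc 0)" using assms(2) i unfolding strict_chain_def by auto
    then show ?thesis using 2 assms(3) by auto
  next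
    case 3
    then have "B (i - m) \<subset> B (Suc (i - m))" using assms(2) i unfolding strict_chain_def by auto
    then show ?thesis using 3 by (auto simp: Suc_diff_le)
  qed (use assms(1) in \<open>auto simp: strict_chain_def\<close>)
qed

context module
begin

lemma mlen_refl: "mlen R M K K = 0"
proof -
  have "mlen R M K K \<le> enat 0"
    unfolding mlen_def
  proof (rule chain_length_le)
    fix n C assume C: "strict_chain {C. submodule C R M \<and> K \<subseteq> C \<and> C \<subseteq> K} n C"
    have "n = 0"
    proof (rule ccontr)
      assume "n \<noteq> 0"
      then have "C 0 \<subset> C (Suc 0)" "0 \<le> n" "Suc 0 \<le> n"
        using C unfolding strict_chain_def by auto
      moreover have "C i = K" if "i \<le> n" for i using C that unfolding strict_chain_def by auto
      ultimately show False by simp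
    qed
    then show "enat n \<le> enat 0" by simp
  qed
  then show ?thesis by (simp add: zero_enat_def[symmetric])
qed

lemma mlen_mono:
  assumes "K' \<subseteq> K" "H \<subseteq> H'"
  shows "mlen R M K H \<le> mlen R M K' H'"
  unfolding mlen_def by (rule chain_length_mono_map[where f = "\<lambda>C. C"]) (use assms in auto)

text \<open>A chain between \<open>K\<close> and \<open>L\<close> is split by \<open>H\<close> into
  its intersections with \<open>H\<close> and its sums with \<open>H\<close>. Both sequences
  increase only weakly, but by \<open>submodule_modular\<close> every strict step survives in at
  least one of them. Conversely, a chain below \<open>H\<close> and one above it concatenate. The
  equation holds in \<open>enat\<close>, infinite lengths included.\<close>

lemma mlen_add:
  assumes K: "submodule K R M" and H: "submodule H R M" and L: "submodule L R M"
    and KH: "K \<subseteq> H" and HL: "H \<subseteq> L"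
  shows "mlen R M K L = mlen R M K H + mlen R M H L"
proof (rule antisym)
  show "mlen R M K L \<le> mlen R M K H + mlen R M H L"
    unfolding mlen_def[of _ _ K L]
  proof (rule chain_length_le)
    fix n C assume C: "strict_chain {C. submodule C R M \<and> K \<subseteq> C \<and> C \<subseteq> L} n C"
    let ?A = "\<lambda>i. C i \<inter> H" and ?B = "\<lambda>i. C i <+>\<^bsub>M\<^esub> H"
    let ?a = "{i. i < n \<and> ?A i \<noteq> ?A (Suc i)}" and ?b = "{i. i < n \<and> ?B i \<noteq> ?B (Suc i)}"
    have sub: "submodule (C i) R M" "K \<subseteq> C i" "C i \<subseteq> L" if "i \<le> n" for i
      using C that unfolding strict_chain_def by auto
    have less: "C i \<subset> C (Suc i)" if "i < n" for i using C that unfolding strict_chain_def by auto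
    have a: "enat (card ?a) \<le> mlen R M K H"
      unfolding mlen_def
    proof (rule card_changes_le; intro allI impI)
      show "C i \<inter> H \<in> {C. submodule C R M \<and> K \<subseteq> C \<and> C \<subseteq> H}" if "i \<le> n" for i
        using sub[OF that] KH submodule_Int[OF _ H] by auto
    qed (use less in auto)
    have b: "enat (card ?b) \<le> mlen R M H L"
      unfolding mlen_def
    proof (rule card_changes_le; intro allI impI)
      show "C i <+>\<^bsub>M\<^esub> H \<in> {C. submodule C R M \<and> H \<subseteq> C \<and> C \<subseteq> L}" if "i \<le> n" for i
        using submodule_set_add[OF _ H] set_add_upper(2)[OF _ H] set_add_least[OF L _ HL] sub[OF that]
        by auto
    qed (use less set_add_mono in blast)
    have "n \<le> card ?a + card ?b"
    proof -
      have "i \<in> ?a \<union> ?b" if "i < n" for i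
      proof (rule ccontr)
        assume "i \<notin> ?a \<union> ?b"
        then have "?A i = ?A (Suc i)" "?B i = ?B (Suc i)" using that by simp_all
        moreover have "submodule (C i) R M" "submodule (C (Suc i)) R M" using sub(1) that by simp_all
        ultimately have "C i = C (Suc i)"
          using submodule_modular[OF _ _ H] less[OF that] by (meson psubset_imp_subset)
        then show False using less[OF that] by simp
      qed
      then have "{..<n} \<subseteq> ?a \<union> ?b" by blast
      then have "card {..<n} \<le> card (?a \<union> ?b)" by (intro card_mono) auto
      then show ?thesis using card_Un_le[of ?a ?b] by simp
    qed
    then have "enat n \<le> enat (card ?a) + enat (card ?b)" by simp
    also have "\<dots> \<le> mlen R M K H + mlen R M H L" by (rule add_mono[OF a b])
    finally show "enat n \<le> mlen R M K H + mlen R M H L" .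
  qed
  show "mlen R M K H + mlen R M H L \<le> mlen R M K L"
  proof (rule enat_add_leI)
    fix m n assume "enat m \<le> mlen R M K H" "enat n \<le> mlen R M H L"
    let ?S = "\<lambda>K H. {C. submodule C R M \<and> K \<subseteq> C \<and> C \<subseteq> H}"
    have "?S K H \<noteq> {}" "?S H L \<noteq> {}" using K H KH HL by blast+
    obtain A where A: "strict_chain (?S K H) m A"
      using chain_length_geD[OF \<open>enat m \<le> _\<close>[unfolded mlen_def] \<open>?S K H \<noteq> {}\<close>] .
    obtain B where B: "strict_chain (?S H L) n B"
      using chain_length_geD[OF \<open>enat n \<le> _\<close>[unfolded mlen_def] \<open>?S H L \<noteq> {}\<close>] .
    have "A m \<subseteq> H" "H \<subseteq> B 0" using A B unfolding strict_chain_def by blast+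
    then have "A m \<subseteq> B 0" by simp
    moreover have "?S K H \<subseteq> ?S K L" "?S H L \<subseteq> ?S K L" using KH HL by blast+
    ultimately show "enat (m + n) \<le> mlen R M K L"
      unfolding mlen_def by (intro chain_length_ge[OF strict_chain_append[OF A B]])
  qed
qed

lemma mlen_eq_0D:
  assumes "mlen R M K H = 0" "submodule K R M" "submodule H R M" "K \<subseteq> H"
  shows "K = H"
proof (rule ccontr)
  assume "K \<noteq> H"
  then have "strict_chain {C. submodule C R M \<and> K \<subseteq> C \<and> C \<subseteq> H} 1 (\<lambda>i. if i = 0 then K else H)"
    using assms unfolding strict_chain_def by auto
  from chain_length_ge[OF this] show False using assms(1) unfolding mlen_def
    by (simp add: zero_enat_def)
qed

end

section \<open>Linear maps\<close>

text \<open>The linearity condition of \<open>mod_hom\<close> without extensionality. Composites,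
  sums and lambda terms are then linear maps as they stand, and only members of Hom modules have to
  be cut down by \<open>restrict\<close>.\<close>

definition linmap ::
  "('a, 'r) ring_scheme \<Rightarrow> ('a, 'b, 'm) module_scheme \<Rightarrow> ('a, 'c, 'n) module_scheme
     \<Rightarrow> ('b \<Rightarrow> 'c) \<Rightarrow> bool" where
  "linmap R M N h \<longleftrightarrow> h \<in> carrier M \<rightarrow> carrier N \<and>
     (\<forall>x \<in> carrier M. \<forall>y \<in> carrier M. h (x \<oplus>\<^bsub>M\<^esub> y) = h x \<oplus>\<^bsub>N\<^esub> h y) \<and>
     (\<forall>a \<in> carrier R. \<forall>x \<in> carrier M. h (a \<odot>\<^bsub>M\<^esub> x) = a \<odot>\<^bsub>N\<^esub> h x)"

lemma mod_hom_iff: "h \<in> mod_hom R M N \<longleftrightarrow> linmap R M N h \<and> h \<in> extensional (carrier M)"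
  unfolding mod_hom_def linmap_def by (auto simp: PiE_def)

lemma linmap_restrict:
  assumes "module R M" "linmap R M N h"
  shows "(\<lambda>x\<in>carrier M. h x) \<in> mod_hom R M N"
proof -
  interpret module R M by fact
  show ?thesis using assms(2) unfolding mod_hom_iff linmap_def by auto
qed

lemma
  assumes "linmap R M N h"
  shows linmap_closed: "x \<in> carrier M \<Longrightarrow> h x \<in> carrier N"
    and linmap_add: "x \<in> carrier M \<Longrightarrow> y \<in> carrier M \<Longrightarrow> h (x \<oplus>\<^bsub>M\<^esub> y) = h x \<oplus>\<^bsub>N\<^esub> h y"
    and linmap_smult: "a \<in> carrier R \<Longrightarrow> x \<in> carrier M \<Longrightarrow> h (a \<odot>\<^bsub>M\<^esub> x) = a \<odot>\<^bsub>N\<^esub> h x"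
  using assms unfolding linmap_def by auto

lemma linmap_comp: "linmap R M N f \<Longrightarrow> linmap R N L g \<Longrightarrow> linmap R M L (\<lambda>x. g (f x))"
  unfolding linmap_def by (simp add: Pi_iff)

lemma (in module) linmap_self_smult: "s \<in> carrier R \<Longrightarrow> linmap R M M (\<lambda>x. s \<odot>\<^bsub>M\<^esub> x)"
  unfolding linmap_def by (auto simp: smult_r_distr smult_assoc1[symmetric] R.m_comm)

locale two_modules = A: module R A + B: module R B
  for R (structure) and A (structure) and B (structure)
begin

lemma linmap_zero: "linmap R A B h \<Longrightarrow> h \<zero>\<^bsub>A\<^esub> = \<zero>\<^bsub>B\<^esub>"
  using linmap_smult[of R A B h "\<zero>" "\<zero>\<^bsub>A\<^esub>"] linmap_closed[of R A B h "\<zero>\<^bsub>A\<^esub>"] by simp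

lemma linmap_a_inv: "linmap R A B h \<Longrightarrow> x \<in> carrier A \<Longrightarrow> h (\<ominus>\<^bsub>A\<^esub> x) = \<ominus>\<^bsub>B\<^esub> h x"
  using linmap_smult[of R A B h "\<ominus> \<one>" x] linmap_closed[of R A B h x]
  by (simp add: A.smult_l_minus B.smult_l_minus)

lemma linmap_minus:
  "linmap R A B h \<Longrightarrow> x \<in> carrier A \<Longrightarrow> y \<in> carrier A \<Longrightarrow> h (x \<ominus>\<^bsub>A\<^esub> y) = h x \<ominus>\<^bsub>B\<^esub> h y"
  by (simp add: a_minus_def linmap_add linmap_a_inv)

lemma linmap_finsum:
  assumes "linmap R A B h" "finite I" "f \<in> I \<rightarrow> carrier A"
  shows "h (\<Oplus>\<^bsub>A\<^esub>i\<in>I. f i) = (\<Oplus>\<^bsub>B\<^esub>i\<in>I. h (f i))"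
  using assms(2,3)
proof (induction I)
  case empty
  then show ?case by (simp add: linmap_zero[OF assms(1)])
next
  case (insert i I)
  then show ?case
    using linmap_closed[OF assms(1)] by (simp add: linmap_add[OF assms(1)] Pi_iff)
qed

lemma submodule_image:
  assumes h: "linmap R A B h" and H: "submodule H R A"
  shows "submodule (h ` H) R B"
proof (rule B.submoduleI')
  note c = A.submodule_mem[OF H]
  show "h ` H \<subseteq> carrier B" using linmap_closed[OF h] c by auto
  show "\<zero>\<^bsub>B\<^esub> \<in> h ` H" using linmap_zero[OF h] A.submodule_zero[OF H] by force
  show "x \<oplus>\<^bsub>B\<^esub> y \<in> h ` H" if "x \<in> h ` H" "y \<in> h ` H" for x y
    using that A.submodule_add[OF H] linmap_add[OF h, symmetric] c by auto
  show "a \<odot>\<^bsub>B\<^esub> x \<in> h ` H" if "a \<in> carrier R" "x \<in> h ` H" for a x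
    using that A.submodule_smult[OF H] linmap_smult[OF h, symmetric] c by auto
qed

lemma submodule_vimage:
  assumes h: "linmap R A B h" and H: "submodule H R A" and K: "submodule K R B"
  shows "submodule {x \<in> H. h x \<in> K} R A"
proof (rule A.submoduleI')
  note c = A.submodule_mem[OF H]
  show "{x \<in> H. h x \<in> K} \<subseteq> carrier A" using c by auto
  show "\<zero>\<^bsub>A\<^esub> \<in> {x \<in> H. h x \<in> K}"
    using linmap_zero[OF h] A.submodule_zero[OF H] B.submodule_zero[OF K] by simp
  show "x \<oplus>\<^bsub>A\<^esub> y \<in> {x \<in> H. h x \<in> K}" if "x \<in> {x \<in> H. h x \<in> K}" "y \<in> {x \<in> H. h x \<in> K}" for x y
    using that by (simp add: A.submodule_add[OF H] B.submodule_add[OF K] linmap_add[OF h] c)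
  show "a \<odot>\<^bsub>A\<^esub> x \<in> {x \<in> H. h x \<in> K}" if "a \<in> carrier R" "x \<in> {x \<in> H. h x \<in> K}" for a x
    using that by (simp add: A.submodule_smult[OF H] B.submodule_smult[OF K] linmap_smult[OF h] c)
qed

text \<open>The correspondence between the submodules of a quotient and of its image; for the identity
  map this is the second isomorphism theorem.\<close>

lemma mlen_vimage:
  assumes h: "linmap R A B h" and H: "submodule H R A" and K: "submodule K R B"
  shows "mlen R A {x \<in> H. h x \<in> K} H = mlen R B K (h ` H <+>\<^bsub>B\<^esub> K)"
proof (rule antisym)
  note c = A.submodule_mem[OF H]
  let ?S = "{C. submodule C R A \<and> {x \<in> H. h x \<in> K} \<subseteq> C \<and> C \<subseteq> H}"
  let ?T = "{C. submodule C R B \<and> K \<subseteq> C \<and> C \<subseteq> h ` H <+>\<^bsub>B\<^esub> K}"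
  \<comment> \<open>The assignments sending C to h(C) + K and D to its preimage in \<open>H\<close>
    are mutually inverse; \<open>restr\<close> and \<open>extend\<close> say so and make both
    preserve strict inclusions.\<close>
  have restr: "{x \<in> H. h x \<in> h ` C <+>\<^bsub>B\<^esub> K} = C" if C: "C \<in> ?S" for C
  proof (intro equalityI subsetI)
    have sC: "submodule C R A" using C by auto
    fix x assume "x \<in> {x \<in> H. h x \<in> h ` C <+>\<^bsub>B\<^esub> K}"
    then obtain y k where x: "x \<in> H" "h x = h y \<oplus>\<^bsub>B\<^esub> k" "y \<in> C" "k \<in> K"
      by (auto simp: B.mem_set_add)
    have y: "y \<in> H" using x C by auto
    have car: "h x \<in> carrier B" "h y \<in> carrier B" "k \<in> carrier B"
      using x y c linmap_closed[OF h] B.submodule_mem[OF K] by auto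
    have "h (x \<ominus>\<^bsub>A\<^esub> y) = k"
      using x car c y by (simp add: linmap_minus[OF h] B.minus_eq B.a_comm[of "h y"] B.a_assoc B.r_neg)
    then have "x \<ominus>\<^bsub>A\<^esub> y \<in> C" using x y C A.submodule_minus[OF H] by auto
    then have "(x \<ominus>\<^bsub>A\<^esub> y) \<oplus>\<^bsub>A\<^esub> y \<in> C" using x A.submodule_add[OF sC] by auto
    then show "x \<in> C" using x y c by (simp add: A.minus_eq A.a_assoc A.l_neg)
  next
    fix x assume x: "x \<in> C"
    then have "x \<in> H" using C by auto
    moreover have "h x \<in> h ` C <+>\<^bsub>B\<^esub> K"
      using B.set_add_upper(1)[OF submodule_image[OF h] K] C x by auto
    ultimately show "x \<in> {x \<in> H. h x \<in> h ` C <+>\<^bsub>B\<^esub> K}" by simp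
  qed
  have extend: "h ` {x \<in> H. h x \<in> D} <+>\<^bsub>B\<^esub> K = D" if D: "D \<in> ?T" for D
  proof (intro equalityI subsetI)
    have sD: "submodule D R B" using D by auto
    fix y assume "y \<in> h ` {x \<in> H. h x \<in> D} <+>\<^bsub>B\<^esub> K"
    then show "y \<in> D" using D B.submodule_add[OF sD] by (auto simp: B.mem_set_add)
  next
    have sD: "submodule D R B" using D by auto
    fix y assume y: "y \<in> D"
    then have "y \<in> h ` H <+>\<^bsub>B\<^esub> K" using D by auto
    then obtain x k where x: "x \<in> H" "k \<in> K" "y = h x \<oplus>\<^bsub>B\<^esub> k" by (auto simp: B.mem_set_add)
    then have "h x \<in> D"
      using y D c linmap_closed[OF h] by (intro B.submodule_add_cancel[OF sD, of "h x" k]) auto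
    then show "y \<in> h ` {x \<in> H. h x \<in> D} <+>\<^bsub>B\<^esub> K" using x by (auto simp: B.mem_set_add)
  qed
  show "mlen R A {x \<in> H. h x \<in> K} H \<le> mlen R B K (h ` H <+>\<^bsub>B\<^esub> K)"
    unfolding mlen_def
  proof (rule chain_length_mono_map)
    fix C assume C: "C \<in> ?S"
    then have "submodule (h ` C) R B" using submodule_image[OF h] by auto
    moreover have "h ` C <+>\<^bsub>B\<^esub> K \<subseteq> h ` H <+>\<^bsub>B\<^esub> K" using C by (intro B.set_add_mono) auto
    ultimately show "h ` C <+>\<^bsub>B\<^esub> K \<in> ?T"
      using B.set_add_upper(2)[OF _ K] B.submodule_set_add[OF _ K] by simp
  next
    fix C D assume CD: "C \<in> ?S" "D \<in> ?S" "C \<subset> D"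
    then have "h ` C <+>\<^bsub>B\<^esub> K \<subseteq> h ` D <+>\<^bsub>B\<^esub> K" by (intro B.set_add_mono) auto
    moreover have "h ` C <+>\<^bsub>B\<^esub> K \<noteq> h ` D <+>\<^bsub>B\<^esub> K"
    proof
      assume eq: "h ` C <+>\<^bsub>B\<^esub> K = h ` D <+>\<^bsub>B\<^esub> K"
      show False using restr[OF CD(1), unfolded eq] restr[OF CD(2)] CD(3) by simp
    qed
    ultimately show "h ` C <+>\<^bsub>B\<^esub> K \<subset> h ` D <+>\<^bsub>B\<^esub> K" by (rule psubsetI)
  qed
  show "mlen R B K (h ` H <+>\<^bsub>B\<^esub> K) \<le> mlen R A {x \<in> H. h x \<in> K} H"
    unfolding mlen_def
  proof (rule chain_length_mono_map)
    fix D assume D: "D \<in> ?T"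
    then show "{x \<in> H. h x \<in> D} \<in> ?S" using submodule_vimage[OF h H] by auto
  next
    fix C D assume CD: "C \<in> ?T" "D \<in> ?T" "C \<subset> D"
    then have "{x \<in> H. h x \<in> C} \<subseteq> {x \<in> H. h x \<in> D}" by auto
    moreover have "{x \<in> H. h x \<in> C} \<noteq> {x \<in> H. h x \<in> D}"
    proof
      assume eq: "{x \<in> H. h x \<in> C} = {x \<in> H. h x \<in> D}"
      show False using extend[OF CD(1), unfolded eq] extend[OF CD(2)] CD(3) by simp
    qed
    ultimately show "{x \<in> H. h x \<in> C} \<subset> {x \<in> H. h x \<in> D}" by (rule psubsetI)
  qed
qed

end

section \<open>Free modules, modules of homomorphisms and quotients\<close>

lemma abelian_groupI':
  assumes "\<And>x y. x \<in> carrier G \<Longrightarrow> y \<in> carrier G \<Longrightarrow> x \<oplus>\<^bsub>G\<^esub> y \<in> carrier G"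
    and "\<zero>\<^bsub>G\<^esub> \<in> carrier G"
    and "\<And>x y z. x \<in> carrier G \<Longrightarrow> y \<in> carrier G \<Longrightarrow> z \<in> carrier G \<Longrightarrow>
      (x \<oplus>\<^bsub>G\<^esub> y) \<oplus>\<^bsub>G\<^esub> z = x \<oplus>\<^bsub>G\<^esub> (y \<oplus>\<^bsub>G\<^esub> z)"
    and "\<And>x y. x \<in> carrier G \<Longrightarrow> y \<in> carrier G \<Longrightarrow> x \<oplus>\<^bsub>G\<^esub> y = y \<oplus>\<^bsub>G\<^esub> x"
    and "\<And>x. x \<in> carrier G \<Longrightarrow> \<zero>\<^bsub>G\<^esub> \<oplus>\<^bsub>G\<^esub> x = x"
    and "\<And>x. x \<in> carrier G \<Longrightarrow> n x \<in> carrier G \<and> n x \<oplus>\<^bsub>G\<^esub> x = \<zero>\<^bsub>G\<^esub>"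
  shows "abelian_group G"
  using assms by (intro abelian_groupI) blast+

lemma ring_module_simps [simp]:
  "carrier (ring_module \<phi> A) = carrier A" "\<zero>\<^bsub>ring_module \<phi> A\<^esub> = \<zero>\<^bsub>A\<^esub>"
  "x \<oplus>\<^bsub>ring_module \<phi> A\<^esub> y = x \<oplus>\<^bsub>A\<^esub> y" "a \<odot>\<^bsub>ring_module \<phi> A\<^esub> x = \<phi> a \<otimes>\<^bsub>A\<^esub> x"
  by (simp_all add: ring_module_def)

lemma ring_module_module:
  assumes "cring R" "cring A" "\<phi> \<in> ring_hom R A"
  shows "module R (ring_module \<phi> A)"
proof -
  interpret R: cring R by fact
  interpret A: cring A by fact
  note h = ring_hom_closed[OF assms(3)] ring_hom_add[OF assms(3)] ring_hom_mult[OF assms(3)]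
    ring_hom_one[OF assms(3)]
  have "abelian_group (ring_module \<phi> A)"
    by (rule abelian_groupI'[where n = "\<lambda>x. \<ominus>\<^bsub>A\<^esub> x"]) (simp_all add: A.add.m_ac A.l_neg A.r_neg)
  then show ?thesis
    by (rule moduleI[OF assms(1)]) (simp_all add: h A.l_distr A.r_distr A.m_assoc)
qed

lemma hom_module_simps [simp]:
  "carrier (hom_module R M N) = mod_hom R M N"
  "\<zero>\<^bsub>hom_module R M N\<^esub> = (\<lambda>x\<in>carrier M. \<zero>\<^bsub>N\<^esub>)"
  "f \<oplus>\<^bsub>hom_module R M N\<^esub> g = (\<lambda>x\<in>carrier M. f x \<oplus>\<^bsub>N\<^esub> g x)"
  "a \<odot>\<^bsub>hom_module R M N\<^esub> f = (\<lambda>x\<in>carrier M. a \<odot>\<^bsub>N\<^esub> f x)"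
  by (simp_all add: hom_module_def)

context two_modules
begin

lemma linmap_0: "linmap R A B (\<lambda>x. \<zero>\<^bsub>B\<^esub>)"
  unfolding linmap_def by simp

lemma linmap_plus: "linmap R A B f \<Longrightarrow> linmap R A B g \<Longrightarrow> linmap R A B (\<lambda>x. f x \<oplus>\<^bsub>B\<^esub> g x)"
  unfolding linmap_def by (auto simp: Pi_iff B.add.m_ac B.smult_r_distr)

lemma linmap_scale: "a \<in> carrier R \<Longrightarrow> linmap R A B f \<Longrightarrow> linmap R A B (\<lambda>x. a \<odot>\<^bsub>B\<^esub> f x)"
  unfolding linmap_def
  by (auto simp: Pi_iff B.smult_r_distr B.smult_assoc1[symmetric] A.R.m_comm)

lemma linmap_diff: "linmap R A B f \<Longrightarrow> linmap R A B g \<Longrightarrow> linmap R A B (\<lambda>x. f x \<ominus>\<^bsub>B\<^esub> g x)"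
  using linmap_plus[OF _ linmap_scale[of "\<ominus> \<one>" g], of f] linmap_closed[of R A B g]
  unfolding linmap_def by (simp add: a_minus_def B.smult_l_minus Pi_iff)

lemma mod_hom_eqI:
  "f \<in> mod_hom R A B \<Longrightarrow> g \<in> mod_hom R A B \<Longrightarrow> (\<And>x. x \<in> carrier A \<Longrightarrow> f x = g x) \<Longrightarrow> f = g"
  unfolding mod_hom_iff by (auto intro: extensionalityI)

lemma linmap_finsum_maps:
  assumes "finite I" and "\<And>i. i \<in> I \<Longrightarrow> linmap R A B (g i)"
  shows "linmap R A B (\<lambda>x. \<Oplus>\<^bsub>B\<^esub>i\<in>I. g i x)"
  using assms
proof (induction I)
  case empty
  then show ?case by (simp add: linmap_0)
next
  case (insert i I)
  have l: "linmap R A B (\<lambda>x. g i x \<oplus>\<^bsub>B\<^esub> (\<Oplus>\<^bsub>B\<^esub>i\<in>I. g i x))"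
    using insert by (intro linmap_plus) auto
  have "(\<Oplus>\<^bsub>B\<^esub>k\<in>insert i I. g k x) = g i x \<oplus>\<^bsub>B\<^esub> (\<Oplus>\<^bsub>B\<^esub>i\<in>I. g i x)" if "x \<in> carrier A" for x
    using insert.hyps linmap_closed[OF insert.prems that] by (intro B.M.finsum_insert) auto
  then show ?case using l unfolding linmap_def by (auto simp: Pi_iff)
qed

lemma hom_module_module: "module R (hom_module R A B)"
proof -
  note r = linmap_restrict[OF A.module_axioms]
  have l: "linmap R A B f" if "f \<in> mod_hom R A B" for f using that by (simp add: mod_hom_iff)
  have c: "f x \<in> carrier B" if "f \<in> mod_hom R A B" "x \<in> carrier A" for f x
    using linmap_closed[OF l[OF that(1)] that(2)] .
  have e: "f = (\<lambda>x\<in>carrier A. f x)" if "f \<in> mod_hom R A B" for f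
    using that by (simp add: mod_hom_iff extensional_restrict)
  have ag: "abelian_group (hom_module R A B)"
  proof (rule abelian_groupI'[where n = "\<lambda>f. \<lambda>x\<in>carrier A. (\<ominus> \<one>) \<odot>\<^bsub>B\<^esub> f x"], goal_cases)
    case (1 f g)
    then show ?case using r[OF linmap_plus[OF l l]] by simp
  next
    case 2
    then show ?case using r[OF linmap_0] by simp
  next
    case (5 f)
    then have f: "f \<in> mod_hom R A B" by simp
    show ?case by (subst (2) e[OF f]) (auto intro!: restrict_ext simp: c[OF f])
  next
    case (6 f)
    then show ?case using r[OF linmap_scale[OF _ l], of "\<ominus> \<one>"]
      by (auto intro!: restrict_ext simp: c B.smult_l_minus B.l_neg)
  qed (auto intro!: restrict_ext simp: c B.add.m_ac)
  show ?thesis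
  proof (rule moduleI[OF A.R.is_cring ag], goal_cases)
    case (1 a f)
    then show ?case using r[OF linmap_scale[OF _ l]] by simp
  next
    case (5 f)
    then have f: "f \<in> mod_hom R A B" by simp
    show ?case by (subst (2) e[OF f]) (auto intro!: restrict_ext simp: c[OF f])
  qed (auto intro!: restrict_ext
      simp: c B.smult_l_distr B.smult_r_distr B.smult_assoc1)
qed

end

lemma linmap_restrict_comp:
  assumes "module R A" and g: "linmap R B C g"
  shows "linmap R (hom_module R A B) (hom_module R A C) (\<lambda>f. \<lambda>x\<in>carrier A. g (f x))"
  unfolding linmap_def
proof (intro conjI ballI funcsetI)
  interpret A: module R A by fact
  fix f assume "f \<in> carrier (hom_module R A B)"
  then have f: "linmap R A B f" by (simp add: mod_hom_iff)
  show "(\<lambda>x\<in>carrier A. g (f x)) \<in> carrier (hom_module R A C)"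
    using linmap_restrict[OF assms(1) linmap_comp[OF f g]] by simp
  show "(\<lambda>x\<in>carrier A. g ((f \<oplus>\<^bsub>hom_module R A B\<^esub> f') x))
      = (\<lambda>x\<in>carrier A. g (f x)) \<oplus>\<^bsub>hom_module R A C\<^esub> (\<lambda>x\<in>carrier A. g (f' x))"
    if "f' \<in> carrier (hom_module R A B)" for f'
  proof -
    have f': "linmap R A B f'" using that by (simp add: mod_hom_iff)
    show ?thesis
      by (auto intro!: restrict_ext simp: linmap_add[OF g] linmap_closed[OF f] linmap_closed[OF f'])
  qed
  show "(\<lambda>x\<in>carrier A. g ((a \<odot>\<^bsub>hom_module R A B\<^esub> f) x))
      = a \<odot>\<^bsub>hom_module R A C\<^esub> (\<lambda>x\<in>carrier A. g (f x))" if "a \<in> carrier R" for a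
    using that by (auto intro!: restrict_ext simp: linmap_smult[OF g] linmap_closed[OF f])
qed

lemma linmap_eval: "x \<in> carrier A \<Longrightarrow> linmap R (hom_module R A B) B (\<lambda>f. f x)"
  unfolding linmap_def by (auto simp: mod_hom_def)

lemma free_gen_apply: "k \<in> X \<Longrightarrow> free_gen R X i k = (if k = i then \<one>\<^bsub>R\<^esub> else \<zero>\<^bsub>R\<^esub>)"
  by (simp add: free_gen_def)

lemma free_module_simps [simp]:
  "carrier (free_module R X) = {f \<in> X \<rightarrow>\<^sub>E carrier R. finite {x \<in> X. f x \<noteq> \<zero>\<^bsub>R\<^esub>}}"
  "\<zero>\<^bsub>free_module R X\<^esub> = (\<lambda>x\<in>X. \<zero>\<^bsub>R\<^esub>)"
  "f \<oplus>\<^bsub>free_module R X\<^esub> g = (\<lambda>x\<in>X. f x \<oplus>\<^bsub>R\<^esub> g x)"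
  "a \<odot>\<^bsub>free_module R X\<^esub> f = (\<lambda>x\<in>X. a \<otimes>\<^bsub>R\<^esub> f x)"
  by (simp_all add: free_module_def)

context cring
begin

lemma free_module_module: "module R (free_module R X)"
proof -
  let ?F = "free_module R X"
  have c: "f x \<in> carrier R" if "f \<in> carrier ?F" "x \<in> X" for f x using that by auto
  have e: "f = (\<lambda>x\<in>X. f x)" if "f \<in> carrier ?F" for f using that by (auto simp: PiE_def extensional_restrict)
  have add: "f \<oplus>\<^bsub>?F\<^esub> g \<in> carrier ?F" if "f \<in> carrier ?F" "g \<in> carrier ?F" for f g
  proof -
    have "{x \<in> X. f x \<oplus> g x \<noteq> \<zero>} \<subseteq> {x \<in> X. f x \<noteq> \<zero>} \<union> {x \<in> X. g x \<noteq> \<zero>}" by auto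
    moreover have "finite \<dots>" using that by simp
    ultimately have "finite {x \<in> X. f x \<oplus> g x \<noteq> \<zero>}" by (rule finite_subset)
    then show ?thesis using c that by (auto cong: conj_cong)
  qed
  have smult: "a \<odot>\<^bsub>?F\<^esub> f \<in> carrier ?F" if "a \<in> carrier R" "f \<in> carrier ?F" for a f
  proof -
    have "{x \<in> X. a \<otimes> f x \<noteq> \<zero>} \<subseteq> {x \<in> X. f x \<noteq> \<zero>}" using that by auto
    moreover have "finite \<dots>" using that by simp
    ultimately have "finite {x \<in> X. a \<otimes> f x \<noteq> \<zero>}" by (rule finite_subset)
    then show ?thesis using c that by (auto cong: conj_cong)
  qed
  have ag: "abelian_group ?F"
  proof (rule abelian_groupI'[where n = "\<lambda>f. (\<ominus> \<one>) \<odot>\<^bsub>?F\<^esub> f"], goal_cases)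
    case (1 f g)
    then show ?case by (rule add)
  next
    case 2
    then show ?case by (auto cong: conj_cong)
  next
    case (3 f g h)
    then show ?case by (auto intro!: restrict_ext simp: a_assoc Pi_iff PiE_iff)
  next
    case (4 f g)
    then show ?case by (auto intro!: restrict_ext simp: a_comm PiE_iff)
  next
    case (5 f)
    show ?case by (subst (2) e[OF 5]) (auto intro!: restrict_ext simp: c[OF 5])
  next
    case (6 f)
    have "(\<ominus> \<one>) \<odot>\<^bsub>?F\<^esub> f \<oplus>\<^bsub>?F\<^esub> f = \<zero>\<^bsub>?F\<^esub>"
      using c[OF 6] by (auto intro!: restrict_ext simp: l_minus l_neg)
    then show ?case using smult[OF _ 6, of "\<ominus> \<one>"] by simp
  qed
  show ?thesis
  proof (rule moduleI[OF is_cring ag], goal_cases)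
    case (1 a f)
    then show ?case by (rule smult)
  next
    case (2 a b f)
    then show ?case by (auto intro!: restrict_ext simp: l_distr PiE_iff)
  next
    case (3 a f g)
    then show ?case by (auto intro!: restrict_ext simp: r_distr PiE_iff)
  next
    case (4 a b f)
    then show ?case by (auto intro!: restrict_ext simp: m_assoc PiE_iff)
  next
    case (5 f)
    show ?case by (subst (2) e[OF 5]) (auto intro!: restrict_ext simp: c[OF 5])
  qed
qed

lemma free_module_closed: "f \<in> carrier (free_module R X) \<Longrightarrow> x \<in> X \<Longrightarrow> f x \<in> carrier R"
  by auto

lemma free_module_eqI:
  "f \<in> carrier (free_module R X) \<Longrightarrow> g \<in> carrier (free_module R X) \<Longrightarrow>
    (\<And>x. x \<in> X \<Longrightarrow> f x = g x) \<Longrightarrow> f = g"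
  by (auto intro: PiE_ext)

lemma free_module_restrict:
  "finite X \<Longrightarrow> (\<And>x. x \<in> X \<Longrightarrow> f x \<in> carrier R) \<Longrightarrow> (\<lambda>x\<in>X. f x) \<in> carrier (free_module R X)"
  by auto

lemma free_gen_closed: "free_gen R X x \<in> carrier (free_module R X)"
proof -
  have "finite {y \<in> X. (if y = x then \<one> else \<zero>) \<noteq> \<zero>}" by (rule finite_subset[of _ "{x}"]) auto
  then show ?thesis unfolding free_gen_def by (auto cong: conj_cong)
qed

lemma free_module_induct [consumes 1, case_names zero step]:
  assumes f: "f \<in> carrier (free_module R X)"
    and zero: "P \<zero>\<^bsub>free_module R X\<^esub>"
    and step: "\<And>f a x. f \<in> carrier (free_module R X) \<Longrightarrow> P f \<Longrightarrow> a \<in> carrier R \<Longrightarrow> x \<in> X \<Longrightarrow>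
      P (f \<oplus>\<^bsub>free_module R X\<^esub> a \<odot>\<^bsub>free_module R X\<^esub> free_gen R X x)"
  shows "P f"
proof -
  have "finite {x \<in> X. f x \<noteq> \<zero>}" using f by simp
  then show ?thesis using f
  proof (induction "{x \<in> X. f x \<noteq> \<zero>}" arbitrary: f rule: finite_psubset_induct)
    case psubset
    show ?case
    proof (cases "{x \<in> X. f x \<noteq> \<zero>} = {}")
      case True
      then have "f = \<zero>\<^bsub>free_module R X\<^esub>" using psubset.prems by (auto simp: PiE_iff extensional_def)
      then show ?thesis using zero by simp
    next
      case False
      then obtain x where x: "x \<in> X" "f x \<noteq> \<zero>" by auto
      let ?g = "f(x := \<zero>)"
      have sub: "{y \<in> X. ?g y \<noteq> \<zero>} \<subset> {y \<in> X. f y \<noteq> \<zero>}" using x by auto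
      moreover have "finite {y \<in> X. f y \<noteq> \<zero>}" using psubset.prems by simp
      ultimately have fin: "finite {y \<in> X. ?g y \<noteq> \<zero>}" using finite_subset by blast
      have "?g \<in> X \<rightarrow>\<^sub>E carrier R" using psubset.prems x by (auto simp: PiE_iff extensional_def)
      then have g: "?g \<in> carrier (free_module R X)" using fin by simp
      have fx: "f x \<in> carrier R" using psubset.prems x by auto
      have "f = ?g \<oplus>\<^bsub>free_module R X\<^esub> f x \<odot>\<^bsub>free_module R X\<^esub> free_gen R X x"
        using psubset.prems fx x by (auto simp: free_gen_def PiE_iff extensional_def intro!: ext)
      then show ?thesis using step[OF g psubset.hyps(2)[OF sub g] fx x(1)] by simp
    qed
  qed
qed

lemma linmap_coord: "x \<in> X \<Longrightarrow> linmap R (free_module R X) (ring_module (\<lambda>a. a) R) (\<lambda>f. f x)"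
  unfolding linmap_def by auto

lemma linmap_free_eq:
  assumes "module R L" "linmap R (free_module R X) L g" "linmap R (free_module R X) L h"
    and "\<And>x. x \<in> X \<Longrightarrow> g (free_gen R X x) = h (free_gen R X x)"
    and "f \<in> carrier (free_module R X)"
  shows "g f = h f"
proof -
  interpret F: module R "free_module R X" by (rule free_module_module)
  interpret two_modules R "free_module R X" L
    using assms(1) F.module_axioms by (simp add: two_modules_def)
  note [simp del] = free_module_simps
  from assms(5) show ?thesis
  proof (induction rule: free_module_induct)
    case zero
    then show ?case using assms(2,3) by (simp add: linmap_zero)
  next
    case (step f a x)
    then show ?case using free_gen_closed[of X x] assms(4)
      by (simp add: linmap_add[OF assms(2)] linmap_add[OF assms(3)] linmap_smult[OF assms(2)]
          linmap_smult[OF assms(3)])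
  qed
qed

end

text \<open>The linear extension of the assignment \<open>B\<close> on basis elements. The sum runs
  over the support of \<open>f\<close> because \<open>X\<close> may be infinite, as it can be for
  the free module underlying a tensor product.\<close>

definition free_ext ::
  "('a, 'r) ring_scheme \<Rightarrow> ('a, 'c, 'n) module_scheme \<Rightarrow> 'x set \<Rightarrow> ('x \<Rightarrow> 'c) \<Rightarrow> ('x \<Rightarrow> 'a) \<Rightarrow> 'c" where
  "free_ext R L X B f = (\<Oplus>\<^bsub>L\<^esub>x\<in>{x \<in> X. f x \<noteq> \<zero>\<^bsub>R\<^esub>}. f x \<odot>\<^bsub>L\<^esub> B x)"

context module
begin

lemma free_ext_superset:
  assumes f: "f \<in> carrier (free_module R X)" and B: "B \<in> X \<rightarrow> carrier M"
    and S: "finite S" "{x \<in> X. f x \<noteq> \<zero>} \<subseteq> S" "S \<subseteq> X"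
  shows "free_ext R M X B f = (\<Oplus>\<^bsub>M\<^esub>x\<in>S. f x \<odot>\<^bsub>M\<^esub> B x)"
  unfolding free_ext_def
proof (rule M.add.finprod_mono_neutral_cong_left[OF S(1,2)])
  show "f i \<odot>\<^bsub>M\<^esub> B i = \<zero>\<^bsub>M\<^esub>" if "i \<in> S - {x \<in> X. f x \<noteq> \<zero>}" for i
    using that S(3) B by (auto intro!: smult_l_null)
  show "(\<lambda>x. f x \<odot>\<^bsub>M\<^esub> B x) \<in> S \<rightarrow> carrier M" using f S(3) B by auto
qed simp

lemma free_ext_linmap:
  assumes B: "B \<in> X \<rightarrow> carrier M"
  shows "linmap R (free_module R X) M (free_ext R M X B)"
proof -
  interpret F: module R "free_module R X" by (rule R.free_module_module)
  have clo: "(\<lambda>x. f x \<odot>\<^bsub>M\<^esub> B x) \<in> S \<rightarrow> carrier M"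
    if "f \<in> carrier (free_module R X)" "S \<subseteq> X" for f S using that B by auto
  have 1: "free_ext R M X B f \<in> carrier M" if "f \<in> carrier (free_module R X)" for f
    unfolding free_ext_def using clo[OF that] by (intro M.finsum_closed) auto
  have 2: "free_ext R M X B (f \<oplus>\<^bsub>free_module R X\<^esub> g) = free_ext R M X B f \<oplus>\<^bsub>M\<^esub> free_ext R M X B g"
    if fg: "f \<in> carrier (free_module R X)" "g \<in> carrier (free_module R X)" for f g
  proof -
    let ?S = "{x \<in> X. f x \<noteq> \<zero>} \<union> {x \<in> X. g x \<noteq> \<zero>}"
    have S: "finite ?S" "?S \<subseteq> X" using fg by auto
    have "free_ext R M X B (f \<oplus>\<^bsub>free_module R X\<^esub> g)
        = (\<Oplus>\<^bsub>M\<^esub>x\<in>?S. (f \<oplus>\<^bsub>free_module R X\<^esub> g) x \<odot>\<^bsub>M\<^esub> B x)"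
      using S fg by (intro free_ext_superset[OF F.add.m_closed[simplified monoid.simps, OF fg] B]) auto
    also have "\<dots> = (\<Oplus>\<^bsub>M\<^esub>x\<in>?S. f x \<odot>\<^bsub>M\<^esub> B x \<oplus>\<^bsub>M\<^esub> g x \<odot>\<^bsub>M\<^esub> B x)"
      using S fg B by (intro M.finsum_cong') (auto simp: Pi_iff PiE_iff smult_l_distr)
    also have "\<dots> = (\<Oplus>\<^bsub>M\<^esub>x\<in>?S. f x \<odot>\<^bsub>M\<^esub> B x) \<oplus>\<^bsub>M\<^esub> (\<Oplus>\<^bsub>M\<^esub>x\<in>?S. g x \<odot>\<^bsub>M\<^esub> B x)"
      by (rule M.finsum_addf[OF clo[OF fg(1) S(2)] clo[OF fg(2) S(2)]])
    also have "\<dots> = free_ext R M X B f \<oplus>\<^bsub>M\<^esub> free_ext R M X B g"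
      using free_ext_superset[OF fg(1) B S(1) _ S(2)] free_ext_superset[OF fg(2) B S(1) _ S(2)] by simp
    finally show ?thesis .
  qed
  have 3: "free_ext R M X B (a \<odot>\<^bsub>free_module R X\<^esub> f) = a \<odot>\<^bsub>M\<^esub> free_ext R M X B f"
    if f: "a \<in> carrier R" "f \<in> carrier (free_module R X)" for a f
  proof -
    let ?S = "{x \<in> X. f x \<noteq> \<zero>}"
    have S: "finite ?S" "?S \<subseteq> X" using f by auto
    have "free_ext R M X B (a \<odot>\<^bsub>free_module R X\<^esub> f)
        = (\<Oplus>\<^bsub>M\<^esub>x\<in>?S. (a \<odot>\<^bsub>free_module R X\<^esub> f) x \<odot>\<^bsub>M\<^esub> B x)"
      using S f by (intro free_ext_superset[OF F.smult_closed[OF f] B]) auto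
    also have "\<dots> = (\<Oplus>\<^bsub>M\<^esub>x\<in>?S. a \<odot>\<^bsub>M\<^esub> (f x \<odot>\<^bsub>M\<^esub> B x))"
      using S f B by (intro M.finsum_cong') (auto simp: Pi_iff PiE_iff smult_assoc1)
    also have "\<dots> = a \<odot>\<^bsub>M\<^esub> free_ext R M X B f"
      unfolding free_ext_def by (rule finsum_smult_ldistr[OF S(1) f(1) clo[OF f(2) S(2)], symmetric])
    finally show ?thesis .
  qed
  show ?thesis unfolding linmap_def using 1 2 3 by blast
qed

lemma free_ext_gen:
  assumes B: "B \<in> X \<rightarrow> carrier M" and x: "x \<in> X"
  shows "free_ext R M X B (free_gen R X x) = B x"
proof -
  have "free_ext R M X B (free_gen R X x) = (\<Oplus>\<^bsub>M\<^esub>y\<in>{x}. free_gen R X x y \<odot>\<^bsub>M\<^esub> B y)"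
    by (rule free_ext_superset[OF R.free_gen_closed B]) (use x in \<open>auto simp: free_gen_def\<close>)
  also have "\<dots> = B x" using B x by (auto simp: free_gen_def Pi_iff)
  finally show ?thesis .
qed

end

lemma (in module) linmap_free_expand:
  fixes n :: nat
  assumes g: "linmap R (free_module R {..<n}) M g" and v: "v \<in> carrier (free_module R {..<n})"
  shows "g v = (\<Oplus>\<^bsub>M\<^esub>i\<in>{..<n}. v i \<odot>\<^bsub>M\<^esub> g (free_gen R {..<n} i))"
proof -
  let ?B = "\<lambda>i. g (free_gen R {..<n} i)"
  have B: "?B \<in> {..<n} \<rightarrow> carrier M" using linmap_closed[OF g R.free_gen_closed] by auto
  have "g v = free_ext R M {..<n} ?B v"
    by (rule R.linmap_free_eq[OF module_axioms g free_ext_linmap[OF B] _ v])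
      (simp add: free_ext_gen[OF B])
  also have "\<dots> = (\<Oplus>\<^bsub>M\<^esub>i\<in>{..<n}. v i \<odot>\<^bsub>M\<^esub> g (free_gen R {..<n} i))"
    by (rule free_ext_superset[OF v B]) auto
  finally show ?thesis .
qed

text \<open>Projectivity of free modules: preimages are chosen for the basis elements and extended
  linearly. Only the values of \<open>g\<close> have to lie in the image of \<open>q\<close>, so
  \<open>q\<close> itself may fail to be onto.\<close>

lemma (in two_modules) free_lift:
  assumes g: "linmap R (free_module R X) B g" and q: "linmap R A B q"
    and im: "\<And>v. v \<in> carrier (free_module R X) \<Longrightarrow> g v \<in> q ` carrier A"
  obtains g' where "linmap R (free_module R X) A g'"
    "\<And>v. v \<in> carrier (free_module R X) \<Longrightarrow> q (g' v) = g v"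
proof -
  have "\<exists>u. u \<in> carrier A \<and> q u = g (free_gen R X x)" for x
    using im[OF A.R.free_gen_closed, of x] by auto
  then obtain u where u: "\<And>x. u x \<in> carrier A" "\<And>x. q (u x) = g (free_gen R X x)" by metis
  have uc: "u \<in> X \<rightarrow> carrier A" using u by auto
  note l = A.free_ext_linmap[OF uc]
  show ?thesis
  proof (rule that[OF l])
    fix v assume "v \<in> carrier (free_module R X)"
    then show "q (free_ext R A X u v) = g v"
      by (rule A.R.linmap_free_eq[OF B.module_axioms linmap_comp[OF l q] g, rotated])
        (simp add: A.free_ext_gen[OF uc] u)
  qed
qed

section \<open>Tensor products\<close>

lemma quot_module_simps [simp]:
  "carrier (quot_module M H) = a_rcosets\<^bsub>M\<^esub> H" "\<zero>\<^bsub>quot_module M H\<^esub> = H"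
  "X \<oplus>\<^bsub>quot_module M H\<^esub> Y = X <+>\<^bsub>M\<^esub> Y"
  by (simp_all add: quot_module_def)

section \<open>Quotient modules and spans\<close>

context module
begin

lemma submodule_abelian_subgroup: "submodule H R M \<Longrightarrow> abelian_subgroup H M"
  by (rule abelian_subgroupI3[OF additive_subgroup.intro[OF submodule.axioms(1)] M.abelian_group_axioms])

lemma coset_eq_iff:
  assumes H: "submodule H R M" and "x \<in> carrier M" "y \<in> carrier M"
  shows "H +>\<^bsub>M\<^esub> x = H +>\<^bsub>M\<^esub> y \<longleftrightarrow> x \<ominus>\<^bsub>M\<^esub> y \<in> H"
proof -
  interpret H: abelian_subgroup H M using submodule_abelian_subgroup[OF H] .
  have "x \<ominus>\<^bsub>M\<^esub> y \<in> H \<longleftrightarrow> x \<in> H +>\<^bsub>M\<^esub> y"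
    using H.a_rcos_module[OF assms(3,2)] by (simp add: a_minus_def)
  then show ?thesis
    using H.a_repr_independence'[OF _ assms(3), of x] H.a_repr_independenceD[OF assms(2), of y] by auto
qed

lemma coset_eq_self_iff:
  assumes "submodule H R M" "x \<in> carrier M"
  shows "H +>\<^bsub>M\<^esub> x = H \<longleftrightarrow> x \<in> H"
  using M.a_coset_join1[of H x] M.a_coset_join2[of x H] assms submodule.axioms(1)[OF assms(1)]
    submodule_subset[OF assms(1)]
  by auto

lemma quot_module_smult:
  assumes H: "submodule H R M" and a: "a \<in> carrier R" and x: "x \<in> carrier M"
  shows "a \<odot>\<^bsub>quot_module M H\<^esub> (H +>\<^bsub>M\<^esub> x) = H +>\<^bsub>M\<^esub> (a \<odot>\<^bsub>M\<^esub> x)"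
proof -
  interpret H: abelian_subgroup H M using submodule_abelian_subgroup[OF H] .
  have "H +>\<^bsub>M\<^esub> (a \<odot>\<^bsub>M\<^esub> y) = H +>\<^bsub>M\<^esub> (a \<odot>\<^bsub>M\<^esub> x)" if y: "y \<in> H +>\<^bsub>M\<^esub> x" for y
  proof -
    have yc: "y \<in> carrier M" using y x H.a_elemrcos_carrier by blast
    have "y \<ominus>\<^bsub>M\<^esub> x \<in> H"
      using y x yc H.a_repr_independence' coset_eq_iff[OF H] by metis
    then have "a \<odot>\<^bsub>M\<^esub> (y \<ominus>\<^bsub>M\<^esub> x) \<in> H" by (rule submodule_smult[OF H a])
    then show ?thesis
      using a x yc by (simp add: coset_eq_iff[OF H] a_minus_def smult_r_distr smult_r_minus)
  qed
  moreover have "H +>\<^bsub>M\<^esub> x \<noteq> {}" using H.a_rcos_self[OF x] by blast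
  ultimately have "(\<Union>y\<in>H +>\<^bsub>M\<^esub> x. H +>\<^bsub>M\<^esub> (a \<odot>\<^bsub>M\<^esub> y)) = H +>\<^bsub>M\<^esub> (a \<odot>\<^bsub>M\<^esub> x)"
    by (intro SUP_eq_const)
  then show ?thesis by (simp add: quot_module_def)
qed

lemma quot_module_module:
  assumes H: "submodule H R M"
  shows "module R (quot_module M H)" and "linmap R M (quot_module M H) (\<lambda>x. H +>\<^bsub>M\<^esub> x)"
proof -
  interpret H: abelian_subgroup H M using submodule_abelian_subgroup[OF H] .
  let ?Q = "quot_module M H"
  have car: "\<exists>x\<in>carrier M. X = H +>\<^bsub>M\<^esub> x" if "X \<in> carrier ?Q" for X
    using that by (auto simp: A_RCOSETS_def')
  have add: "(H +>\<^bsub>M\<^esub> x) \<oplus>\<^bsub>?Q\<^esub> (H +>\<^bsub>M\<^esub> y) = H +>\<^bsub>M\<^esub> (x \<oplus>\<^bsub>M\<^esub> y)"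
    if "x \<in> carrier M" "y \<in> carrier M" for x y using that H.a_rcos_sum by simp
  have clo: "H +>\<^bsub>M\<^esub> x \<in> carrier ?Q" if "x \<in> carrier M" for x
    using that M.a_rcosetsI[of H x] H.a_subset by simp
  have z: "\<zero>\<^bsub>?Q\<^esub> = H +>\<^bsub>M\<^esub> \<zero>\<^bsub>M\<^esub>" using H.a_subset by simp
  note smult = quot_module_smult[OF H]
  note [simp del] = quot_module_simps
  have ag: "abelian_group ?Q"
  proof (rule abelian_groupI'[where n = "\<lambda>X. (\<ominus> \<one>) \<odot>\<^bsub>?Q\<^esub> X"], goal_cases)
    case (1 X Y)
    then show ?case by (auto dest!: car simp: add intro!: clo)
  next
    case 2
    show ?case unfolding z by (rule clo) simp
  next
    case (3 X Y Z)
    then show ?case by (auto dest!: car simp: add M.a_assoc)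
  next
    case (4 X Y)
    then show ?case by (auto dest!: car simp: add M.a_comm)
  next
    case (5 X)
    then show ?case unfolding z by (auto dest!: car simp: add simp del: M.a_coset_add_zero)
  next
    case (6 X)
    then show ?case unfolding z
      by (auto dest!: car simp: add smult smult_l_minus M.l_neg clo simp del: M.a_coset_add_zero)
  qed
  show "module R ?Q"
  proof (rule moduleI[OF R.is_cring ag], goal_cases)
    case (1 a X)
    then show ?case by (auto dest!: car simp: smult intro!: clo)
  qed (auto dest!: car simp: smult add smult_l_distr smult_r_distr smult_assoc1)
  show "linmap R M ?Q (\<lambda>x. H +>\<^bsub>M\<^esub> x)"
    unfolding linmap_def using clo by (simp add: add smult)
qed

lemma submod_span_submodule:
  assumes "S \<subseteq> carrier M"
  shows "submodule (submod_span R M S) R M"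
proof (rule submoduleI')
  show "submod_span R M S \<subseteq> carrier M"
    unfolding submod_span_def using carrier_is_submodule assms by auto
  show "\<zero>\<^bsub>M\<^esub> \<in> submod_span R M S"
    unfolding submod_span_def using submodule_zero by auto
  show "x \<oplus>\<^bsub>M\<^esub> y \<in> submod_span R M S" if "x \<in> submod_span R M S" "y \<in> submod_span R M S" for x y
    using that unfolding submod_span_def using submodule_add by auto
  show "a \<odot>\<^bsub>M\<^esub> x \<in> submod_span R M S" if "a \<in> carrier R" "x \<in> submod_span R M S" for a x
    using that unfolding submod_span_def using submodule_smult by auto
qed

end

lemma submod_span_superset: "S \<subseteq> submod_span R M S"
  unfolding submod_span_def by auto

lemma submod_span_least: "submodule H R M \<Longrightarrow> S \<subseteq> H \<Longrightarrow> submod_span R M S \<subseteq> H"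
  unfolding submod_span_def by auto

section \<open>Elementary tensors and the universal property of the tensor product\<close>

definition tens ::
  "('a, 'r) ring_scheme \<Rightarrow> ('a, 'b, 'm) module_scheme \<Rightarrow> ('a, 'c, 'n) module_scheme
     \<Rightarrow> 'b \<Rightarrow> 'c \<Rightarrow> ('b \<times> 'c \<Rightarrow> 'a) set" where
  "tens R M N x y = tensor_ker R M N +>\<^bsub>free_module R (carrier M \<times> carrier N)\<^esub>
     free_gen R (carrier M \<times> carrier N) (x, y)"

context two_modules
begin

abbreviation (input) X where "X \<equiv> carrier A \<times> carrier B"
abbreviation (input) F where "F \<equiv> free_module R X"
abbreviation (input) T where "T \<equiv> tensor_module R A B"
abbreviation (input) e where "e \<equiv> free_gen R X"

lemma free_module_X: "module R F" by (rule A.R.free_module_module)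

lemma tensor_rels_cases:
  assumes "f \<in> tensor_rels R A B"
  obtains (left_add) x x' y where "x \<in> carrier A" "x' \<in> carrier A" "y \<in> carrier B"
      "f = e (x \<oplus>\<^bsub>A\<^esub> x', y) \<ominus>\<^bsub>F\<^esub> (e (x, y) \<oplus>\<^bsub>F\<^esub> e (x', y))"
  | (right_add) x y y' where "x \<in> carrier A" "y \<in> carrier B" "y' \<in> carrier B"
      "f = e (x, y \<oplus>\<^bsub>B\<^esub> y') \<ominus>\<^bsub>F\<^esub> (e (x, y) \<oplus>\<^bsub>F\<^esub> e (x, y'))"
  | (left_smult) a x y where "a \<in> carrier R" "x \<in> carrier A" "y \<in> carrier B"
      "f = e (a \<odot>\<^bsub>A\<^esub> x, y) \<ominus>\<^bsub>F\<^esub> (a \<odot>\<^bsub>F\<^esub> e (x, y))"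
  | (right_smult) a x y where "a \<in> carrier R" "x \<in> carrier A" "y \<in> carrier B"
      "f = e (x, a \<odot>\<^bsub>B\<^esub> y) \<ominus>\<^bsub>F\<^esub> (a \<odot>\<^bsub>F\<^esub> e (x, y))"
  using assms unfolding tensor_rels_def Let_def
  apply (elim UnE CollectE exE conjE)
  subgoal by (rule left_add)
  subgoal by (rule right_add)
  subgoal by (rule left_smult)
  subgoal by (rule right_smult)
  done

lemma
  assumes "x \<in> carrier A" "y \<in> carrier B"
  shows tensor_rels_left_add: "x' \<in> carrier A \<Longrightarrow>
      e (x \<oplus>\<^bsub>A\<^esub> x', y) \<ominus>\<^bsub>F\<^esub> (e (x, y) \<oplus>\<^bsub>F\<^esub> e (x', y)) \<in> tensor_rels R A B"
    and tensor_rels_right_add: "y' \<in> carrier B \<Longrightarrow>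
      e (x, y \<oplus>\<^bsub>B\<^esub> y') \<ominus>\<^bsub>F\<^esub> (e (x, y) \<oplus>\<^bsub>F\<^esub> e (x, y')) \<in> tensor_rels R A B"
    and tensor_rels_left_smult: "a \<in> carrier R \<Longrightarrow>
      e (a \<odot>\<^bsub>A\<^esub> x, y) \<ominus>\<^bsub>F\<^esub> (a \<odot>\<^bsub>F\<^esub> e (x, y)) \<in> tensor_rels R A B"
    and tensor_rels_right_smult: "a \<in> carrier R \<Longrightarrow>
      e (x, a \<odot>\<^bsub>B\<^esub> y) \<ominus>\<^bsub>F\<^esub> (a \<odot>\<^bsub>F\<^esub> e (x, y)) \<in> tensor_rels R A B"
  unfolding tensor_rels_def Let_def
  by (rule UnI1, rule UnI1, rule UnI1, (rule CollectI exI conjI refl assms | assumption)+)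
    (rule UnI1, rule UnI1, rule UnI2, (rule CollectI exI conjI refl assms | assumption)+,
      rule UnI1, rule UnI2, (rule CollectI exI conjI refl assms | assumption)+,
      rule UnI2, (rule CollectI exI conjI refl assms | assumption)+)

lemma tensor_rels_carrier: "tensor_rels R A B \<subseteq> carrier F"
proof
  interpret F: module R F by (rule free_module_X)
  note [simp del] = free_module_simps
  note g = A.R.free_gen_closed
  fix f assume "f \<in> tensor_rels R A B"
  then show "f \<in> carrier F"
    by (cases rule: tensor_rels_cases) (simp_all add: g F.smult_closed)
qed

lemma tensor_ker_submodule: "submodule (tensor_ker R A B) R F"
proof -
  interpret F: module R F by (rule free_module_X)
  show ?thesis unfolding tensor_ker_def by (rule F.submod_span_submodule[OF tensor_rels_carrier])
qed

lemma tensor_module_module: "module R T"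
  and tensor_proj_linmap: "linmap R F T (\<lambda>f. tensor_ker R A B +>\<^bsub>F\<^esub> f)"
proof -
  interpret F: module R F by (rule free_module_X)
  show "module R T" "linmap R F T (\<lambda>f. tensor_ker R A B +>\<^bsub>F\<^esub> f)"
    unfolding tensor_module_def by (rule F.quot_module_module[OF tensor_ker_submodule])+
qed

lemma tensor_proj_eq_zero_iff:
  assumes "f \<in> carrier F"
  shows "tensor_ker R A B +>\<^bsub>F\<^esub> f = \<zero>\<^bsub>T\<^esub> \<longleftrightarrow> f \<in> tensor_ker R A B"
  using module.coset_eq_self_iff[OF free_module_X tensor_ker_submodule assms]
  by (simp add: tensor_module_def)

lemma tensor_proj_eqI:
  assumes "f \<in> carrier F" "g \<in> carrier F" "f \<ominus>\<^bsub>F\<^esub> g \<in> tensor_ker R A B"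
  shows "tensor_ker R A B +>\<^bsub>F\<^esub> f = tensor_ker R A B +>\<^bsub>F\<^esub> g"
  using module.coset_eq_iff[OF free_module_X tensor_ker_submodule] assms by blast

lemma tensor_carrierE:
  assumes "\<omega> \<in> carrier T"
  obtains f where "f \<in> carrier F" "\<omega> = tensor_ker R A B +>\<^bsub>F\<^esub> f"
  using assms unfolding tensor_module_def by (auto simp: A_RCOSETS_def')

lemma tens_closed: "tens R A B x y \<in> carrier T"
  unfolding tens_def by (rule linmap_closed[OF tensor_proj_linmap A.R.free_gen_closed])

lemma tensor_rel_proj:
  assumes "f \<ominus>\<^bsub>F\<^esub> g \<in> tensor_rels R A B" "f \<in> carrier F" "g \<in> carrier F"
  shows "tensor_ker R A B +>\<^bsub>F\<^esub> f = tensor_ker R A B +>\<^bsub>F\<^esub> g"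
proof (rule tensor_proj_eqI[OF assms(2,3)])
  show "f \<ominus>\<^bsub>F\<^esub> g \<in> tensor_ker R A B"
    unfolding tensor_ker_def by (rule subsetD[OF submod_span_superset assms(1)])
qed

lemma
  assumes "x \<in> carrier A" "y \<in> carrier B"
  shows tens_add_left: "x' \<in> carrier A \<Longrightarrow>
      tens R A B (x \<oplus>\<^bsub>A\<^esub> x') y = tens R A B x y \<oplus>\<^bsub>T\<^esub> tens R A B x' y"
    and tens_add_right: "y' \<in> carrier B \<Longrightarrow>
      tens R A B x (y \<oplus>\<^bsub>B\<^esub> y') = tens R A B x y \<oplus>\<^bsub>T\<^esub> tens R A B x y'"
    and tens_smult_left: "a \<in> carrier R \<Longrightarrow>
      tens R A B (a \<odot>\<^bsub>A\<^esub> x) y = a \<odot>\<^bsub>T\<^esub> tens R A B x y"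
    and tens_smult_right: "a \<in> carrier R \<Longrightarrow>
      tens R A B x (a \<odot>\<^bsub>B\<^esub> y) = a \<odot>\<^bsub>T\<^esub> tens R A B x y"
proof -
  interpret F: module R F by (rule free_module_X)
  note g = A.R.free_gen_closed
  note p = linmap_add[OF tensor_proj_linmap, symmetric] linmap_smult[OF tensor_proj_linmap, symmetric]
  note [simp del] = free_module_simps
  show "tens R A B (x \<oplus>\<^bsub>A\<^esub> x') y = tens R A B x y \<oplus>\<^bsub>T\<^esub> tens R A B x' y"
    if "x' \<in> carrier A"
    unfolding tens_def p(1)[OF g g]
    by (rule tensor_rel_proj[OF tensor_rels_left_add[OF assms that]]) (simp_all add: g)
  show "tens R A B x (y \<oplus>\<^bsub>B\<^esub> y') = tens R A B x y \<oplus>\<^bsub>T\<^esub> tens R A B x y'"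
    if "y' \<in> carrier B"
    unfolding tens_def p(1)[OF g g]
    by (rule tensor_rel_proj[OF tensor_rels_right_add[OF assms that]]) (simp_all add: g)
  show "tens R A B (a \<odot>\<^bsub>A\<^esub> x) y = a \<odot>\<^bsub>T\<^esub> tens R A B x y" if "a \<in> carrier R"
    unfolding tens_def p(2)[OF that g]
    by (rule tensor_rel_proj[OF tensor_rels_left_smult[OF assms that]]) (simp_all add: g F.smult_closed that)
  show "tens R A B x (a \<odot>\<^bsub>B\<^esub> y) = a \<odot>\<^bsub>T\<^esub> tens R A B x y" if "a \<in> carrier R"
    unfolding tens_def p(2)[OF that g]
    by (rule tensor_rel_proj[OF tensor_rels_right_smult[OF assms that]]) (simp_all add: g F.smult_closed that)
qed

lemma tens_linmap_left: "y \<in> carrier B \<Longrightarrow> linmap R A T (\<lambda>x. tens R A B x y)"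
  unfolding linmap_def by (simp add: tens_closed tens_add_left tens_smult_left)

lemma tens_linmap_right: "x \<in> carrier A \<Longrightarrow> linmap R B T (\<lambda>y. tens R A B x y)"
  unfolding linmap_def by (simp add: tens_closed tens_add_right tens_smult_right)

text \<open>Bilinearity modulo a submodule is enough, so no quotient of the target has to be formed.\<close>

lemma tensor_universal:
  assumes L: "module R L" and K: "submodule K R L"
    and \<beta>: "\<And>x y. x \<in> carrier A \<Longrightarrow> y \<in> carrier B \<Longrightarrow> \<beta> x y \<in> carrier L"
    and "\<And>x x' y. x \<in> carrier A \<Longrightarrow> x' \<in> carrier A \<Longrightarrow> y \<in> carrier B \<Longrightarrow>
      \<beta> (x \<oplus>\<^bsub>A\<^esub> x') y \<ominus>\<^bsub>L\<^esub> (\<beta> x y \<oplus>\<^bsub>L\<^esub> \<beta> x' y) \<in> K"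
    and "\<And>x y y'. x \<in> carrier A \<Longrightarrow> y \<in> carrier B \<Longrightarrow> y' \<in> carrier B \<Longrightarrow>
      \<beta> x (y \<oplus>\<^bsub>B\<^esub> y') \<ominus>\<^bsub>L\<^esub> (\<beta> x y \<oplus>\<^bsub>L\<^esub> \<beta> x y') \<in> K"
    and "\<And>a x y. a \<in> carrier R \<Longrightarrow> x \<in> carrier A \<Longrightarrow> y \<in> carrier B \<Longrightarrow>
      \<beta> (a \<odot>\<^bsub>A\<^esub> x) y \<ominus>\<^bsub>L\<^esub> a \<odot>\<^bsub>L\<^esub> \<beta> x y \<in> K"
    and "\<And>a x y. a \<in> carrier R \<Longrightarrow> x \<in> carrier A \<Longrightarrow> y \<in> carrier B \<Longrightarrow>
      \<beta> x (a \<odot>\<^bsub>B\<^esub> y) \<ominus>\<^bsub>L\<^esub> a \<odot>\<^bsub>L\<^esub> \<beta> x y \<in> K"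
    and f: "f \<in> tensor_ker R A B"
  shows "free_ext R L X (\<lambda>(x, y). \<beta> x y) f \<in> K"
proof -
  interpret F: module R F by (rule free_module_X)
  interpret L: module R L by fact
  interpret FL: two_modules R F L using F.module_axioms L by (simp add: two_modules_def)
  let ?\<Phi> = "free_ext R L X (\<lambda>(x, y). \<beta> x y)"
  have c: "(\<lambda>(x, y). \<beta> x y) \<in> X \<rightarrow> carrier L" using \<beta> by auto
  note l = L.free_ext_linmap[OF c]
  note g = A.R.free_gen_closed
  have gen: "?\<Phi> (e (x, y)) = \<beta> x y" if "x \<in> carrier A" "y \<in> carrier B" for x y
    using L.free_ext_gen[OF c, of "(x, y)"] that by simp
  note [simp del] = free_module_simps
  have "tensor_ker R A B \<subseteq> {f \<in> carrier F. ?\<Phi> f \<in> K}"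
    unfolding tensor_ker_def
  proof (rule submod_span_least[OF FL.submodule_vimage[OF l F.carrier_is_submodule K]], rule subsetI)
    fix f assume f: "f \<in> tensor_rels R A B"
    then have "f \<in> carrier F" using tensor_rels_carrier by auto
    moreover have "?\<Phi> f \<in> K"
      using f
    proof (cases rule: tensor_rels_cases)
      case (left_add x x' y)
      then show ?thesis using assms(4)
        by (simp add: g gen FL.linmap_minus[OF l] linmap_add[OF l])
    next
      case (right_add x y y')
      then show ?thesis using assms(5)
        by (simp add: g gen FL.linmap_minus[OF l] linmap_add[OF l])
    next
      case (left_smult a x y)
      then show ?thesis using assms(6)
        by (simp add: g gen FL.linmap_minus[OF l] linmap_smult[OF l] F.smult_closed)
    next
      case (right_smult a x y)
      then show ?thesis using assms(7)
        by (simp add: g gen FL.linmap_minus[OF l] linmap_smult[OF l] F.smult_closed)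
    qed
    ultimately show "f \<in> {f \<in> carrier F. ?\<Phi> f \<in> K}" by simp
  qed
  then show ?thesis using f by auto
qed

end

text \<open>Each coordinate is a linear form, so it may be taken termwise in the linear extension,
  and the coordinate at y of the basis element at \<open>g x\<close> is 1 exactly on the fibre over
  y. This gives the coordinate formula \<open>free_map\<close> access to the calculus of linear
  maps.\<close>

lemma (in cring) free_map_eq:
  assumes g: "\<And>x. x \<in> X \<Longrightarrow> g x \<in> Y" and f: "f \<in> carrier (free_module R X)"
  shows "free_map R X Y g f = free_ext R (free_module R Y) X (\<lambda>x. free_gen R Y (g x)) f"
proof -
  interpret Y: module R "free_module R Y" by (rule free_module_module)
  have mr: "module R (ring_module (\<lambda>a. a) R)"
    by (rule ring_module_module) (auto simp: ring_hom_def is_cring)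
  interpret YR: two_modules R "free_module R Y" "ring_module (\<lambda>a. a) R"
    using mr Y.module_axioms by (simp add: two_modules_def)
  \<comment> \<open>\<open>finsum\<close> reads only the carrier, the zero and the addition, and
    these agree for \<open>R\<close> and for \<open>R\<close> as a module over itself.\<close>
  have fs: "finsum (ring_module (\<lambda>a. a) R) h S = finsum R h S" for h :: "'x \<Rightarrow> 'a" and S
    by (simp add: finsum_def finprod_def ring_module_def)
  let ?S = "{x \<in> X. f x \<noteq> \<zero>}"
  have S: "finite ?S" using f by simp
  have c: "(\<lambda>x. f x \<odot>\<^bsub>free_module R Y\<^esub> free_gen R Y (g x)) \<in> ?S \<rightarrow> carrier (free_module R Y)"
    using free_module_closed[OF f] free_gen_closed
    by (auto simp del: free_module_simps intro!: Y.smult_closed)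
  have ext: "free_ext R (free_module R Y) X (\<lambda>x. free_gen R Y (g x)) f \<in> carrier (free_module R Y)"
    unfolding free_ext_def by (rule Y.finsum_closed[OF c])
  have "free_ext R (free_module R Y) X (\<lambda>x. free_gen R Y (g x)) f y
      = (\<Oplus>x\<in>{x \<in> X. f x \<noteq> \<zero> \<and> g x = y}. f x)" if y: "y \<in> Y" for y
  proof -
    have "free_ext R (free_module R Y) X (\<lambda>x. free_gen R Y (g x)) f y
      = (\<Oplus>x\<in>?S. (f x \<odot>\<^bsub>free_module R Y\<^esub> free_gen R Y (g x)) y)"
      unfolding free_ext_def using YR.linmap_finsum[OF linmap_coord[OF y] S c] by (simp add: fs)
    also have "\<dots> = (\<Oplus>x\<in>{x \<in> X. f x \<noteq> \<zero> \<and> g x = y}. f x)"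
      using f y by (intro add.finprod_mono_neutral_cong_right[OF S]) (auto simp: free_gen_def PiE_iff)
    finally show ?thesis .
  qed
  then show ?thesis using ext unfolding free_map_def
    by (auto simp: PiE_iff extensional_def intro!: ext)
qed

section \<open>The total ring of fractions\<close>

context cring
begin

lemma nonzerodivisors_closed: "s \<in> nonzerodivisors R \<Longrightarrow> s \<in> carrier R"
  by (simp add: nonzerodivisors_def)

lemma nonzerodivisorsD:
  "s \<in> nonzerodivisors R \<Longrightarrow> x \<in> carrier R \<Longrightarrow> s \<otimes> x = \<zero> \<Longrightarrow> x = \<zero>"
  by (simp add: nonzerodivisors_def)

lemma one_nonzerodivisor: "\<one> \<in> nonzerodivisors R"
  by (simp add: nonzerodivisors_def)

lemma mult_nonzerodivisors:
  assumes s: "s \<in> nonzerodivisors R" and t: "t \<in> nonzerodivisors R"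
  shows "s \<otimes> t \<in> nonzerodivisors R"
proof -
  note c = nonzerodivisors_closed[OF s] nonzerodivisors_closed[OF t]
  have "x = \<zero>" if "x \<in> carrier R" "s \<otimes> t \<otimes> x = \<zero>" for x
  proof -
    have "s \<otimes> (t \<otimes> x) = \<zero>" using that c by (simp add: m_assoc)
    then have "t \<otimes> x = \<zero>" by (rule nonzerodivisorsD[OF s, rotated]) (simp add: that c)
    then show "x = \<zero>" by (rule nonzerodivisorsD[OF t that(1)])
  qed
  then show ?thesis using c unfolding nonzerodivisors_def by blast
qed

lemma nonzerodivisors_cancel:
  assumes "s \<in> nonzerodivisors R" "x \<in> carrier R" "y \<in> carrier R" "s \<otimes> x = s \<otimes> y"
  shows "x = y"
proof -
  have s: "s \<in> carrier R" using assms(1) by (rule nonzerodivisors_closed)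
  have "s \<otimes> (x \<ominus> y) = \<zero>" using assms s by (simp add: a_minus_def r_distr r_minus r_neg)
  then have "x \<ominus> y = \<zero>" using nonzerodivisorsD[OF assms(1)] assms by simp
  then show ?thesis using assms by (simp add: minus_equality r_right_minus_eq)
qed

lemma mk_frac_eq_iff:
  assumes "a \<in> carrier R" "s \<in> nonzerodivisors R" "b \<in> carrier R" "t \<in> nonzerodivisors R"
  shows "mk_frac R a s = mk_frac R b t \<longleftrightarrow> a \<otimes> t = b \<otimes> s"
proof -
  have "equiv (carrier R \<times> nonzerodivisors R) (frac_rel R)"
  proof (rule equivI)
    show "frac_rel R \<subseteq> (carrier R \<times> nonzerodivisors R) \<times> (carrier R \<times> nonzerodivisors R)"
      by (auto simp: frac_rel_def)
    show "refl_on (carrier R \<times> nonzerodivisors R) (frac_rel R)"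
      by (auto simp: refl_on_def frac_rel_def)
    show "sym (frac_rel R)" by (auto simp: sym_def frac_rel_def)
    show "trans (frac_rel R)"
    proof (rule transI, clarify)
      fix a s b t c u assume "((a, s), b, t) \<in> frac_rel R" "((b, t), c, u) \<in> frac_rel R"
      then have c: "a \<in> carrier R" "s \<in> nonzerodivisors R" "b \<in> carrier R" "t \<in> nonzerodivisors R"
          "c \<in> carrier R" "u \<in> nonzerodivisors R"
        and e: "a \<otimes> t = b \<otimes> s" "b \<otimes> u = c \<otimes> t" by (auto simp: frac_rel_def)
      note cc = c nonzerodivisors_closed[OF c(2)] nonzerodivisors_closed[OF c(4)]
        nonzerodivisors_closed[OF c(6)]
      \<comment> \<open>For transitivity both sides are multiplied by the middle denominator
        \<open>t\<close>, which can be cancelled as a non-zero-divisor.\<close>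
      have "t \<otimes> (a \<otimes> u) = (a \<otimes> t) \<otimes> u" using cc by (simp add: m_ac)
      also have "\<dots> = (b \<otimes> u) \<otimes> s" using cc by (simp add: e(1) m_ac)
      also have "\<dots> = t \<otimes> (c \<otimes> s)" using cc by (simp add: e(2) m_ac)
      finally have "t \<otimes> (a \<otimes> u) = t \<otimes> (c \<otimes> s)" .
      then have "a \<otimes> u = c \<otimes> s" by (rule nonzerodivisors_cancel[OF c(4), rotated 2]) (simp_all add: cc)
      then show "((a, s), c, u) \<in> frac_rel R" using c by (simp add: frac_rel_def)
    qed
  qed
  then have "mk_frac R a s = mk_frac R b t \<longleftrightarrow> ((a, s), b, t) \<in> frac_rel R"
    unfolding mk_frac_def using assms by (intro eq_equiv_class_iff) auto
  then show ?thesis using assms by (simp add: frac_rel_def)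
qed

abbreviation (input) Q where "Q \<equiv> total_frac_ring R"

lemma mk_frac_closed:
  "a \<in> carrier R \<Longrightarrow> s \<in> nonzerodivisors R \<Longrightarrow> mk_frac R a s \<in> carrier Q"
  by (auto simp: total_frac_ring_def mk_frac_def intro!: quotientI)

lemma total_frac_ringE:
  assumes "x \<in> carrier Q"
  obtains a s where "a \<in> carrier R" "s \<in> nonzerodivisors R" "x = mk_frac R a s"
  using assms by (auto simp: total_frac_ring_def mk_frac_def elim!: quotientE)

lemma mem_mk_frac:
  assumes "a \<in> carrier R" "s \<in> nonzerodivisors R"
  shows "x \<in> mk_frac R a s \<longleftrightarrow> fst x \<in> carrier R \<and> snd x \<in> nonzerodivisors R \<and>
    a \<otimes> snd x = fst x \<otimes> s"
  using assms by (cases x) (auto simp: mk_frac_def frac_rel_def)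

lemma
  assumes "a \<in> carrier R" "s \<in> nonzerodivisors R" "b \<in> carrier R" "t \<in> nonzerodivisors R"
  shows frac_mult: "mk_frac R a s \<otimes>\<^bsub>Q\<^esub> mk_frac R b t = mk_frac R (a \<otimes> b) (s \<otimes> t)"
    and frac_add: "mk_frac R a s \<oplus>\<^bsub>Q\<^esub> mk_frac R b t = mk_frac R (a \<otimes> t \<oplus> b \<otimes> s) (s \<otimes> t)"
proof -
  note cc = assms assms(2,4)[THEN nonzerodivisors_closed]
  note mem = mem_mk_frac[OF assms(1,2)] mem_mk_frac[OF assms(3,4)]
  have ne: "mk_frac R a s \<noteq> {}" "mk_frac R b t \<noteq> {}"
    using mem[of "(a, s)"] mem[of "(b, t)"] assms by auto
  have "mk_frac R (fst x \<otimes> fst y) (snd x \<otimes> snd y) = mk_frac R (a \<otimes> b) (s \<otimes> t)"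
    if "x \<in> mk_frac R a s" "y \<in> mk_frac R b t" for x y
  proof -
    obtain a' s' b' t' where xy: "x = (a', s')" "y = (b', t')" by (cases x, cases y) auto
    have c: "a' \<in> carrier R" "s' \<in> nonzerodivisors R" "b' \<in> carrier R" "t' \<in> nonzerodivisors R"
      and e: "a \<otimes> s' = a' \<otimes> s" "b \<otimes> t' = b' \<otimes> t" using that mem xy by auto
    note dd = cc c c(2,4)[THEN nonzerodivisors_closed]
    have "(a' \<otimes> b') \<otimes> (s \<otimes> t) = (a' \<otimes> s) \<otimes> (b' \<otimes> t)" using dd by (simp add: m_ac)
    also have "\<dots> = (a \<otimes> s') \<otimes> (b \<otimes> t')" by (simp add: e)
    also have "\<dots> = (a \<otimes> b) \<otimes> (s' \<otimes> t')" using dd by (simp add: m_ac)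
    finally show ?thesis using dd xy by (subst mk_frac_eq_iff) (auto intro: mult_nonzerodivisors)
  qed
  then show "mk_frac R a s \<otimes>\<^bsub>Q\<^esub> mk_frac R b t = mk_frac R (a \<otimes> b) (s \<otimes> t)"
    unfolding total_frac_ring_def using ne by (simp cong: SUP_cong)
  have "mk_frac R (fst x \<otimes> snd y \<oplus> fst y \<otimes> snd x) (snd x \<otimes> snd y)
      = mk_frac R (a \<otimes> t \<oplus> b \<otimes> s) (s \<otimes> t)"
    if "x \<in> mk_frac R a s" "y \<in> mk_frac R b t" for x y
  proof -
    obtain a' s' b' t' where xy: "x = (a', s')" "y = (b', t')" by (cases x, cases y) auto
    have c: "a' \<in> carrier R" "s' \<in> nonzerodivisors R" "b' \<in> carrier R" "t' \<in> nonzerodivisors R"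
      and e: "a \<otimes> s' = a' \<otimes> s" "b \<otimes> t' = b' \<otimes> t" using that mem xy by auto
    note dd = cc c c(2,4)[THEN nonzerodivisors_closed]
    have "(a' \<otimes> t' \<oplus> b' \<otimes> s') \<otimes> (s \<otimes> t) = (a' \<otimes> s) \<otimes> (t' \<otimes> t) \<oplus> (b' \<otimes> t) \<otimes> (s' \<otimes> s)"
      using dd by (simp add: m_ac l_distr r_distr)
    also have "\<dots> = (a \<otimes> s') \<otimes> (t' \<otimes> t) \<oplus> (b \<otimes> t') \<otimes> (s' \<otimes> s)" by (simp add: e)
    also have "\<dots> = (a \<otimes> t \<oplus> b \<otimes> s) \<otimes> (s' \<otimes> t')" using dd by (simp add: m_ac l_distr r_distr)
    finally show ?thesis using dd xy by (subst mk_frac_eq_iff) (auto intro: mult_nonzerodivisors)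
  qed
  then show "mk_frac R a s \<oplus>\<^bsub>Q\<^esub> mk_frac R b t = mk_frac R (a \<otimes> t \<oplus> b \<otimes> s) (s \<otimes> t)"
    unfolding total_frac_ring_def using ne by (simp cong: SUP_cong)
qed

lemma frac_zero: "\<zero>\<^bsub>Q\<^esub> = mk_frac R \<zero> \<one>" and frac_one: "\<one>\<^bsub>Q\<^esub> = mk_frac R \<one> \<one>"
  by (simp_all add: total_frac_ring_def)

lemma total_frac_ring_cring: "cring Q"
proof (rule cringI)
  note simps = frac_mult frac_add frac_zero frac_one mk_frac_closed mult_nonzerodivisors
    one_nonzerodivisor mk_frac_eq_iff nonzerodivisors_closed
  show "abelian_group Q"
  proof (rule abelian_groupI'[where n = "\<lambda>x. mk_frac R (\<ominus> \<one>) \<one> \<otimes>\<^bsub>Q\<^esub> x"], goal_cases)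
    case (1 x y)
    then show ?case by (elim total_frac_ringE) (simp add: simps)
  next
    case 2
    then show ?case by (simp add: simps)
  next
    case (3 x y z)
    then show ?case
      by (elim total_frac_ringE) (simp add: simps l_distr r_distr m_ac a_ac)
  next
    case (4 x y)
    then show ?case by (elim total_frac_ringE) (simp add: simps m_ac a_ac)
  next
    case (5 x)
    then show ?case by (elim total_frac_ringE) (simp add: simps)
  next
    case (6 x)
    then show ?case by (elim total_frac_ringE) (simp add: simps l_minus l_neg)
  qed
  show "comm_monoid Q"
  proof (rule comm_monoidI, goal_cases)
    case (1 x y)
    then show ?case by (elim total_frac_ringE) (simp add: simps)
  next
    case 2
    then show ?case by (simp add: simps)
  next
    case (3 x y z)
    then show ?case by (elim total_frac_ringE) (simp add: simps m_ac)
  next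
    case (4 x)
    then show ?case by (elim total_frac_ringE) (simp add: simps)
  next
    case (5 x y)
    then show ?case by (elim total_frac_ringE) (simp add: simps m_ac)
  qed
  fix x y z assume "x \<in> carrier Q" "y \<in> carrier Q" "z \<in> carrier Q"
  then show "(x \<oplus>\<^bsub>Q\<^esub> y) \<otimes>\<^bsub>Q\<^esub> z = x \<otimes>\<^bsub>Q\<^esub> z \<oplus>\<^bsub>Q\<^esub> y \<otimes>\<^bsub>Q\<^esub> z"
    by (elim total_frac_ringE) (simp add: simps l_distr r_distr m_ac)
qed

lemma to_frac_hom: "to_frac R \<in> ring_hom R Q"
  by (rule ring_hom_memI)
    (simp_all add: to_frac_def frac_mult frac_add frac_one mk_frac_closed one_nonzerodivisor)

lemma to_frac_inj:
  "a \<in> carrier R \<Longrightarrow> b \<in> carrier R \<Longrightarrow> to_frac R a = to_frac R b \<Longrightarrow> a = b"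
  by (simp add: to_frac_def mk_frac_eq_iff one_nonzerodivisor)

lemma to_frac_mult_mk_frac:
  "a \<in> carrier R \<Longrightarrow> s \<in> nonzerodivisors R \<Longrightarrow>
    to_frac R s \<otimes>\<^bsub>Q\<^esub> mk_frac R a s = to_frac R a"
  by (simp add: to_frac_def frac_mult mk_frac_eq_iff one_nonzerodivisor nonzerodivisors_closed m_ac)

lemma common_denominator:
  assumes "finite S" "S \<subseteq> carrier Q"
  obtains s where "s \<in> nonzerodivisors R" "\<And>x. x \<in> S \<Longrightarrow> to_frac R s \<otimes>\<^bsub>Q\<^esub> x \<in> to_frac R ` carrier R"
proof -
  interpret Q: cring Q by (rule total_frac_ring_cring)
  note h = ring_hom_closed[OF to_frac_hom] ring_hom_mult[OF to_frac_hom]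
  have "\<exists>s \<in> nonzerodivisors R. \<forall>x\<in>S. to_frac R s \<otimes>\<^bsub>Q\<^esub> x \<in> to_frac R ` carrier R"
    using assms
  proof (induction S)
    case empty
    then show ?case using one_nonzerodivisor by auto
  next
    case (insert x S)
    then obtain s where s: "s \<in> nonzerodivisors R"
      "\<And>x. x \<in> S \<Longrightarrow> to_frac R s \<otimes>\<^bsub>Q\<^esub> x \<in> to_frac R ` carrier R" by auto
    obtain a t where x: "a \<in> carrier R" "t \<in> nonzerodivisors R" "x = mk_frac R a t"
      using insert.prems total_frac_ringE[of x] by auto
    note c = nonzerodivisors_closed[OF s(1)] nonzerodivisors_closed[OF x(2)]
    have "to_frac R (t \<otimes> s) \<otimes>\<^bsub>Q\<^esub> y \<in> to_frac R ` carrier R" if y: "y \<in> insert x S" for y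
    proof -
      have yc: "y \<in> carrier Q" using y insert.prems by auto
      consider "y = x" | "y \<in> S" using y by auto
      then show ?thesis
      proof cases
        case 1
        have "to_frac R (t \<otimes> s) \<otimes>\<^bsub>Q\<^esub> y = to_frac R s \<otimes>\<^bsub>Q\<^esub> (to_frac R t \<otimes>\<^bsub>Q\<^esub> y)"
          using c yc by (simp add: h Q.m_ac)
        also have "\<dots> = to_frac R (s \<otimes> a)" using c x 1 by (simp add: h to_frac_mult_mk_frac)
        finally show ?thesis using c x by simp
      next
        case 2
        then obtain b where b: "b \<in> carrier R" "to_frac R s \<otimes>\<^bsub>Q\<^esub> y = to_frac R b" using s by auto
        have "to_frac R (t \<otimes> s) \<otimes>\<^bsub>Q\<^esub> y = to_frac R t \<otimes>\<^bsub>Q\<^esub> (to_frac R s \<otimes>\<^bsub>Q\<^esub> y)"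
          using c yc by (simp add: h Q.m_ac)
        also have "\<dots> = to_frac R (t \<otimes> b)" using c b by (simp add: h)
        finally show ?thesis using c b by simp
      qed
    qed
    then show ?case by (intro bexI[of _ "t \<otimes> s"] ballI mult_nonzerodivisors[OF x(2) s(1)])
  qed
  then show ?thesis using that by auto
qed

end

section \<open>Modules with rank\<close>

context two_modules
begin

text \<open>\<open>tensor_map_right\<close> is a union over all representatives of a coset, so the
  content is that their choice does not matter: id \<otimes> h sends relations to relations. This is
  \<open>tensor_universal\<close> with the free module itself as target and
  \<open>tensor_ker\<close> as submodule.\<close>

lemma tensor_map_right_proj:
  assumes h: "linmap R B B h" and f: "f \<in> carrier F"
  shows "tensor_map_right R A B h (tensor_ker R A B +>\<^bsub>F\<^esub> f)
    = tensor_ker R A B +>\<^bsub>F\<^esub> free_map R X X (\<lambda>(x, y). (x, h y)) f"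
proof -
  interpret F: module R F by (rule free_module_X)
  interpret FF: two_modules R F F using F.module_axioms by (simp add: two_modules_def)
  interpret K: abelian_subgroup "tensor_ker R A B" F
    by (rule F.submodule_abelian_subgroup[OF tensor_ker_submodule])
  note hc = linmap_closed[OF h] and g = A.R.free_gen_closed
  let ?\<beta> = "\<lambda>x y. e (x, h y)"
  let ?\<Phi> = "free_ext R F X (\<lambda>(x, y). ?\<beta> x y)"
  have c: "(\<lambda>(x, y). ?\<beta> x y) \<in> X \<rightarrow> carrier F" by (rule Pi_I) (simp add: case_prod_beta' g del: free_module_simps)
  note l = F.free_ext_linmap[OF c]
  have map: "free_map R X X (\<lambda>(x, y). (x, h y)) f = ?\<Phi> f" if "f \<in> carrier F" for f
    using A.R.free_map_eq[OF _ that, of "\<lambda>(x, y). (x, h y)" X] hc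
    by (simp add: case_prod_beta' mem_Times_iff del: free_module_simps)
  have rels: "f \<in> tensor_ker R A B" if "f \<in> tensor_rels R A B" for f
    using that submod_span_superset unfolding tensor_ker_def by (rule subsetD[rotated])
  note [simp del] = free_module_simps
  have ker: "?\<Phi> f \<in> tensor_ker R A B" if "f \<in> tensor_ker R A B" for f
    by (rule tensor_universal[OF F.module_axioms tensor_ker_submodule _ _ _ _ _ that])
      (simp_all add: g linmap_add[OF h] linmap_smult[OF h] hc rels tensor_rels_left_add
        tensor_rels_right_add tensor_rels_left_smult tensor_rels_right_smult)
  have "tensor_ker R A B +>\<^bsub>F\<^esub> free_map R X X (\<lambda>(x, y). (x, h y)) f'
      = tensor_ker R A B +>\<^bsub>F\<^esub> ?\<Phi> f" if f': "f' \<in> tensor_ker R A B +>\<^bsub>F\<^esub> f" for f'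
  proof -
    have f'c: "f' \<in> carrier F" using f' f K.a_elemrcos_carrier by blast
    then have "f' \<ominus>\<^bsub>F\<^esub> f \<in> tensor_ker R A B"
      using K.a_rcos_module[OF f f'c] f' by (simp add: a_minus_def)
    then have "?\<Phi> f' \<ominus>\<^bsub>F\<^esub> ?\<Phi> f \<in> tensor_ker R A B"
      using ker FF.linmap_minus[OF l f'c f] by metis
    then show ?thesis
      unfolding map[OF f'c] by (intro tensor_proj_eqI linmap_closed[OF l] f f'c)
  qed
  moreover have "tensor_ker R A B +>\<^bsub>F\<^esub> f \<noteq> {}" using K.a_rcos_self[OF f] by blast
  ultimately show ?thesis
    unfolding tensor_map_right_def Let_def map[OF f] by (intro SUP_eq_const)
qed

lemma tensor_map_right_tens:
  assumes h: "linmap R B B h" and "x \<in> carrier A" "y \<in> carrier B"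
  shows "tensor_map_right R A B h (tens R A B x y) = tens R A B x (h y)"
proof -
  interpret F: module R F by (rule free_module_X)
  have "free_map R X X (\<lambda>(x, y). (x, h y)) (e (x, y)) = free_ext R F X (\<lambda>(x, y). e (x, h y)) (e (x, y))"
    using A.R.free_map_eq[OF _ A.R.free_gen_closed, of X "\<lambda>(x, y). (x, h y)" X] linmap_closed[OF h]
    by (simp add: case_prod_beta' mem_Times_iff del: free_module_simps)
  also have "\<dots> = e (x, h y)"
    using assms(2,3) F.free_ext_gen[of "\<lambda>(x, y). e (x, h y)" X "(x, y)"]
    by (simp add: Pi_iff A.R.free_gen_closed del: free_module_simps)
  finally show ?thesis
    unfolding tens_def by (simp add: tensor_map_right_proj[OF h] A.R.free_gen_closed del: free_module_simps)
qed

end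

lemma base_change_simps [simp]:
  "carrier (base_change R M \<phi> A) = carrier (tensor_module R M (ring_module \<phi> A))"
  "x \<oplus>\<^bsub>base_change R M \<phi> A\<^esub> y = x \<oplus>\<^bsub>tensor_module R M (ring_module \<phi> A)\<^esub> y"
  "q \<odot>\<^bsub>base_change R M \<phi> A\<^esub> x = tensor_map_right R M (ring_module \<phi> A) (\<lambda>y. q \<otimes>\<^bsub>A\<^esub> y) x"
  by (simp_all add: base_change_def Let_def)

text \<open>Denominators are cleared on both sides of the isomorphism h over the total ring of
  fractions Q. On a finite generating set the vectors h(x \<otimes> 1) have a common denominator s,
  and \<phi> is s times this map. The basis vectors times some t are h(y \<otimes> 1) for elements y
  of \<open>M\<close>, and \<xi> sends the basis to these y. Both composites are then multiplication
  by s t, which is the non-zero-divisor delivered. Enough functionals on \<open>M\<close> make x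
  \<mapsto> h(x \<otimes> 1) injective, so that identities in \<open>M\<close> can be tested
  there.\<close>

lemma has_rankE:
  assumes "module R M" and fg: "fin_gen R M" and "has_rank R M"
    and torsionless: "\<And>x. x \<in> carrier M \<Longrightarrow>
      (\<And>\<mu>. linmap R M (ring_module (\<lambda>a. a) R) \<mu> \<Longrightarrow> \<mu> x = \<zero>\<^bsub>R\<^esub>) \<Longrightarrow> x = \<zero>\<^bsub>M\<^esub>"
  obtains r :: nat and s \<phi> \<xi> where "s \<in> nonzerodivisors R"
    "linmap R M (free_module R {..<r}) \<phi>" "linmap R (free_module R {..<r}) M \<xi>"
    "\<And>x. x \<in> carrier M \<Longrightarrow> \<xi> (\<phi> x) = s \<odot>\<^bsub>M\<^esub> x"
    "\<And>v. v \<in> carrier (free_module R {..<r}) \<Longrightarrow> \<phi> (\<xi> v) = s \<odot>\<^bsub>free_module R {..<r}\<^esub> v"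
proof -
  interpret M: module R M by fact
  let ?Q = "total_frac_ring R" and ?j = "to_frac R"
  interpret Q: cring ?Q by (rule M.R.total_frac_ring_cring)
  let ?N = "ring_module ?j ?Q"
  have "module R ?N" by (rule ring_module_module[OF M.R.is_cring Q.is_cring M.R.to_frac_hom])
  then interpret two_modules R M ?N by (simp add: two_modules_def M.module_axioms)
  let ?T = "tensor_module R M ?N" and ?t = "tens R M ?N"
  note jh = ring_hom_closed[OF M.R.to_frac_hom] ring_hom_mult[OF M.R.to_frac_hom]
    ring_hom_add[OF M.R.to_frac_hom] ring_hom_one[OF M.R.to_frac_hom]
  have j0: "?j \<zero>\<^bsub>R\<^esub> = \<zero>\<^bsub>?Q\<^esub>" by (simp add: to_frac_def M.R.frac_zero)
  note nzc = M.R.nonzerodivisors_closed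
  obtain r :: nat and h where h: "h \<in> mod_hom ?Q (base_change R M ?j ?Q) (free_module ?Q {..<r})"
    and bij: "bij_betw h (carrier ?T) (carrier (free_module ?Q {..<r}))"
    using assms(3) unfolding has_rank_def mod_iso_def Let_def by (auto simp del: free_module_simps)
  interpret T: module R ?T by (rule tensor_module_module)
  let ?V = "free_module ?Q {..<r}"
  have hl: "linmap ?Q (base_change R M ?j ?Q) ?V h" using h by (simp add: mod_hom_iff)
  have hc: "h \<omega> \<in> carrier ?V" if "\<omega> \<in> carrier ?T" for \<omega>
    using linmap_closed[OF hl] that by simp
  have hck: "h \<omega> k \<in> carrier ?Q" if "\<omega> \<in> carrier ?T" "k < r" for \<omega> k
    using Q.free_module_closed[OF hc[OF that(1)]] that(2) by simp
  have hadd: "h (\<omega> \<oplus>\<^bsub>?T\<^esub> \<omega>') k = h \<omega> k \<oplus>\<^bsub>?Q\<^esub> h \<omega>' k"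
    if "\<omega> \<in> carrier ?T" "\<omega>' \<in> carrier ?T" "k < r" for \<omega> \<omega>' k
    using linmap_add[OF hl, of \<omega> \<omega>'] that by simp
  have hsm: "h (?t x q) k = q \<otimes>\<^bsub>?Q\<^esub> h (?t x \<one>\<^bsub>?Q\<^esub>) k"
    if "x \<in> carrier M" "q \<in> carrier ?Q" "k < r" for x q k
  proof -
    have "linmap R ?N ?N (\<lambda>y. q \<otimes>\<^bsub>?Q\<^esub> y)"
      unfolding linmap_def using that jh by (auto simp: Q.r_distr Q.m_ac)
    from tensor_map_right_tens[OF this that(1), of "\<one>\<^bsub>?Q\<^esub>"]
    show ?thesis using linmap_smult[OF hl, of q "?t x \<one>\<^bsub>?Q\<^esub>"] that tens_closed by simp
  qed
  define g where "g x = h (?t x \<one>\<^bsub>?Q\<^esub>)" for x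
  have glin: "linmap R M ?N (\<lambda>x. g x k)" if k: "k < r" for k
    unfolding linmap_def
  proof (intro conjI ballI funcsetI)
    fix x assume x: "x \<in> carrier M"
    show "g x k \<in> carrier ?N" using hck[OF tens_closed k] by (simp add: g_def)
    show "g (x \<oplus>\<^bsub>M\<^esub> y) k = g x k \<oplus>\<^bsub>?N\<^esub> g y k" if y: "y \<in> carrier M" for y
      using x y k hadd[OF tens_closed tens_closed] by (simp add: g_def tens_add_left)
    show "g (a \<odot>\<^bsub>M\<^esub> x) k = a \<odot>\<^bsub>?N\<^esub> g x k" if a: "a \<in> carrier R" for a
    proof -
      have "?t (a \<odot>\<^bsub>M\<^esub> x) \<one>\<^bsub>?Q\<^esub> = ?t x (?j a)"
        using tens_smult_right[OF x, of "\<one>\<^bsub>?Q\<^esub>" a] tens_smult_left[OF x, of "\<one>\<^bsub>?Q\<^esub>" a] a jh by simp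
      then show ?thesis using hsm[OF x, of "?j a" k] k a jh by (simp add: g_def)
    qed
  qed
  note gc = linmap_closed[OF glin, simplified] and gadd = linmap_add[OF glin, simplified]
    and gsm = linmap_smult[OF glin, simplified]
  \<comment> \<open>Up to a denominator t every value of \<open>h\<close> is some
    \<open>g x\<close>: induction over formal sums of pairs, where a pair with second entry q = b/u
    contributes the new denominator \<open>u\<close>.\<close>
  have frac: "\<exists>t\<in>nonzerodivisors R. \<exists>x\<in>carrier M. \<forall>k<r. ?j t \<otimes>\<^bsub>?Q\<^esub> h \<omega> k = g x k"
    if \<omega>: "\<omega> \<in> carrier ?T" for \<omega>
  proof -
    let ?X = "carrier M \<times> carrier ?N"
    let ?F = "free_module R ?X"
    let ?p = "\<lambda>f. tensor_ker R M ?N +>\<^bsub>?F\<^esub> f"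
    note pl = tensor_proj_linmap
    interpret F: module R ?F by (rule M.R.free_module_module)
    interpret FT: two_modules R ?F ?T using F.module_axioms T.module_axioms by (simp add: two_modules_def)
    obtain f where f: "f \<in> carrier ?F" "\<omega> = ?p f" using tensor_carrierE[OF \<omega>] by blast
    note [simp del] = free_module_simps
    from f(1) have "\<exists>t\<in>nonzerodivisors R. \<exists>x\<in>carrier M. \<forall>k<r. ?j t \<otimes>\<^bsub>?Q\<^esub> h (?p f) k = g x k"
    proof (induction rule: M.R.free_module_induct)
      case zero
      have "h (?p \<zero>\<^bsub>?F\<^esub>) k = \<zero>\<^bsub>?Q\<^esub>" "g \<zero>\<^bsub>M\<^esub> k = \<zero>\<^bsub>?Q\<^esub>" if k: "k < r" for k
      proof -
        have "?p \<zero>\<^bsub>?F\<^esub> = \<zero>\<^bsub>?T\<^esub>" by (rule FT.linmap_zero[OF pl])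
        moreover have "h (\<zero>\<^bsub>?T\<^esub> \<oplus>\<^bsub>?T\<^esub> \<zero>\<^bsub>?T\<^esub>) k = h \<zero>\<^bsub>?T\<^esub> k \<oplus>\<^bsub>?Q\<^esub> h \<zero>\<^bsub>?T\<^esub> k"
          by (rule hadd) (simp_all add: k)
        ultimately show "h (?p \<zero>\<^bsub>?F\<^esub>) k = \<zero>\<^bsub>?Q\<^esub>"
          using hck[OF T.M.zero_closed k] by simp
        show "g \<zero>\<^bsub>M\<^esub> k = \<zero>\<^bsub>?Q\<^esub>" using linmap_zero[OF glin[OF k]] by simp
      qed
      then show ?case
        using jh(1)[OF M.R.one_closed]
        by (intro bexI[of _ "\<one>\<^bsub>R\<^esub>"] bexI[of _ "\<zero>\<^bsub>M\<^esub>"]) (simp_all add: M.R.one_nonzerodivisor)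
    next
      case (step f a z)
      then obtain t x where t: "t \<in> nonzerodivisors R" and x: "x \<in> carrier M"
        and tx: "\<And>k. k < r \<Longrightarrow> ?j t \<otimes>\<^bsub>?Q\<^esub> h (?p f) k = g x k" by blast
      obtain x' q where z: "z = (x', q)" "x' \<in> carrier M" "q \<in> carrier ?Q" using step.hyps by auto
      obtain b u where q: "b \<in> carrier R" "u \<in> nonzerodivisors R" "q = mk_frac R b u"
        using M.R.total_frac_ringE[OF z(3)] by blast
      have uq: "?j u \<otimes>\<^bsub>?Q\<^esub> q = ?j b" using q by (simp add: M.R.to_frac_mult_mk_frac)
      note c = nzc[OF t] nzc[OF q(2)] q(1) z(2,3) x step.hyps(1,2)
      let ?x = "u \<odot>\<^bsub>M\<^esub> x \<oplus>\<^bsub>M\<^esub> (t \<otimes>\<^bsub>R\<^esub> b) \<odot>\<^bsub>M\<^esub> (a \<odot>\<^bsub>M\<^esub> x')"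
      have "?j (t \<otimes>\<^bsub>R\<^esub> u) \<otimes>\<^bsub>?Q\<^esub> h (?p (f \<oplus>\<^bsub>?F\<^esub> a \<odot>\<^bsub>?F\<^esub> free_gen R ?X z)) k = g ?x k" if k: "k < r" for k
      proof -
        have "?p (f \<oplus>\<^bsub>?F\<^esub> a \<odot>\<^bsub>?F\<^esub> free_gen R ?X z) = ?p f \<oplus>\<^bsub>?T\<^esub> ?t (a \<odot>\<^bsub>M\<^esub> x') q"
          unfolding linmap_add[OF pl step.hyps(1) F.smult_closed[OF step.hyps(2) M.R.free_gen_closed]]
            linmap_smult[OF pl step.hyps(2) M.R.free_gen_closed]
          using tens_smult_left[of x' q a] c(4,5) step.hyps(2) by (simp add: tens_def z(1))
        moreover have pc: "?p f \<in> carrier ?T" using linmap_closed[OF pl] step.hyps by blast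
        ultimately have "h (?p (f \<oplus>\<^bsub>?F\<^esub> a \<odot>\<^bsub>?F\<^esub> free_gen R ?X z)) k
          = h (?p f) k \<oplus>\<^bsub>?Q\<^esub> q \<otimes>\<^bsub>?Q\<^esub> g (a \<odot>\<^bsub>M\<^esub> x') k"
          using c k hsm[of "a \<odot>\<^bsub>M\<^esub> x'" q k] by (simp add: hadd tens_closed g_def)
        then have "?j (t \<otimes>\<^bsub>R\<^esub> u) \<otimes>\<^bsub>?Q\<^esub> h (?p (f \<oplus>\<^bsub>?F\<^esub> a \<odot>\<^bsub>?F\<^esub> free_gen R ?X z)) k
          = ?j u \<otimes>\<^bsub>?Q\<^esub> (?j t \<otimes>\<^bsub>?Q\<^esub> h (?p f) k)
            \<oplus>\<^bsub>?Q\<^esub> ?j t \<otimes>\<^bsub>?Q\<^esub> (?j u \<otimes>\<^bsub>?Q\<^esub> q) \<otimes>\<^bsub>?Q\<^esub> g (a \<odot>\<^bsub>M\<^esub> x') k"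
          using c k gc[OF k, of "a \<odot>\<^bsub>M\<^esub> x'"] hck[OF pc k]
          by (simp add: jh Q.r_distr Q.m_ac)
        also have "\<dots> = g ?x k" unfolding tx[OF k] uq
          using c k by (simp add: gadd gsm jh)
        finally show ?thesis .
      qed
      moreover have "?x \<in> carrier M" using c by simp
      ultimately show ?case using M.R.mult_nonzerodivisors[OF t q(2)] by blast
    qed
    then show ?thesis using f(2) by simp
  qed
  \<comment> \<open>Let y be the difference of x and x', so y \<otimes> 1 = 0. For a functional
    \<mu> the map (x, q) \<mapsto> \<mu>(x) q is bilinear and therefore kills
    \<open>tensor_ker\<close>; hence \<mu>(y) is zero in Q, and in \<open>R\<close>, which embeds in
    Q.\<close>
  have ginj: "x = x'" if x: "x \<in> carrier M" "x' \<in> carrier M" "\<And>k. k < r \<Longrightarrow> g x k = g x' k" for x x'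
  proof -
    have "h (?t x \<one>\<^bsub>?Q\<^esub>) = h (?t x' \<one>\<^bsub>?Q\<^esub>)"
      using x(3) by (intro Q.free_module_eqI[OF hc hc] tens_closed) (simp add: g_def)
    then have "?t x \<one>\<^bsub>?Q\<^esub> = ?t x' \<one>\<^bsub>?Q\<^esub>"
      using bij tens_closed unfolding bij_betw_def by (metis inj_onD)
    moreover have "two_modules R M ?T" using T.module_axioms M.module_axioms by (simp add: two_modules_def)
    ultimately have "?t (x \<ominus>\<^bsub>M\<^esub> x') \<one>\<^bsub>?Q\<^esub> = \<zero>\<^bsub>?T\<^esub>"
      using two_modules.linmap_minus[OF _ tens_linmap_left, of "\<one>\<^bsub>?Q\<^esub>" x x'] x
      by (simp add: T.M.minus_eq T.M.r_neg tens_closed)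
    then have ker: "free_gen R (carrier M \<times> carrier ?N) (x \<ominus>\<^bsub>M\<^esub> x', \<one>\<^bsub>?Q\<^esub>) \<in> tensor_ker R M ?N"
      unfolding tens_def by (subst (asm) tensor_proj_eq_zero_iff[OF M.R.free_gen_closed])
    have "x \<ominus>\<^bsub>M\<^esub> x' = \<zero>\<^bsub>M\<^esub>"
    proof (rule torsionless)
      fix \<mu> assume \<mu>: "linmap R M (ring_module (\<lambda>a. a) R) \<mu>"
      have \<mu>c: "\<mu> x \<in> carrier R" if "x \<in> carrier M" for x using linmap_closed[OF \<mu> that] by simp
      let ?\<beta> = "\<lambda>x q. ?j (\<mu> x) \<otimes>\<^bsub>?Q\<^esub> q"
      have z: "y \<ominus>\<^bsub>?N\<^esub> y' \<in> {\<zero>\<^bsub>?N\<^esub>}" if "y = y'" "y' \<in> carrier ?N" for y y'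
        using that B.M.r_neg[of y'] by (simp add: a_minus_def)
      have "free_ext R ?N (carrier M \<times> carrier ?N) (\<lambda>(x, q). ?\<beta> x q)
          (free_gen R (carrier M \<times> carrier ?N) (x \<ominus>\<^bsub>M\<^esub> x', \<one>\<^bsub>?Q\<^esub>)) \<in> {\<zero>\<^bsub>?N\<^esub>}"
        by (rule tensor_universal[OF B.module_axioms B.submodule_singleton_zero _ _ _ _ _ ker]; (rule z)?)
          (simp_all add: linmap_add[OF \<mu>] linmap_smult[OF \<mu>] \<mu>c jh Q.l_distr Q.r_distr Q.m_ac)
      moreover have "(\<lambda>(x, q). ?\<beta> x q) \<in> carrier M \<times> carrier ?N \<rightarrow> carrier ?N"
        using \<mu>c jh by auto
      ultimately have "?j (\<mu> (x \<ominus>\<^bsub>M\<^esub> x')) \<otimes>\<^bsub>?Q\<^esub> \<one>\<^bsub>?Q\<^esub> = \<zero>\<^bsub>?Q\<^esub>"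
        using B.free_ext_gen[of "\<lambda>(x, q). ?\<beta> x q" "carrier M \<times> carrier ?N" "(x \<ominus>\<^bsub>M\<^esub> x', \<one>\<^bsub>?Q\<^esub>)"] x by simp
      then have "?j (\<mu> (x \<ominus>\<^bsub>M\<^esub> x')) = ?j \<zero>\<^bsub>R\<^esub>" using x \<mu>c jh by (simp add: j0)
      then show "\<mu> (x \<ominus>\<^bsub>M\<^esub> x') = \<zero>\<^bsub>R\<^esub>" using x \<mu>c by (intro M.R.to_frac_inj) auto
    qed (use x in simp)
    then show "x = x'" using x by (simp add: M.minus_eq_zero_iff)
  qed
  obtain S where S: "S \<subseteq> carrier M" "finite S" "submod_span R M S = carrier M"
    using fg unfolding fin_gen_def by blast
  have "finite ((\<lambda>(x, k). g x k) ` (S \<times> {..<r}))" "(\<lambda>(x, k). g x k) ` (S \<times> {..<r}) \<subseteq> carrier ?Q"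
    using S gc by auto
  then obtain s where s: "s \<in> nonzerodivisors R"
    and sS: "\<And>x k. x \<in> S \<Longrightarrow> k < r \<Longrightarrow> ?j s \<otimes>\<^bsub>?Q\<^esub> g x k \<in> ?j ` carrier R"
    by (rule M.R.common_denominator) auto
  have sc: "s \<in> carrier R" using nzc[OF s] .
  \<comment> \<open>Integrality of s g(x) is inherited by linear combinations, so it passes from the
    generators in \<open>S\<close> to all of \<open>M\<close>.\<close>
  have sub: "submodule {x \<in> carrier M. \<forall>k<r. ?j s \<otimes>\<^bsub>?Q\<^esub> g x k \<in> ?j ` carrier R} R M" (is "submodule ?H R M")
  proof (rule M.submoduleI')
    show "\<zero>\<^bsub>M\<^esub> \<in> ?H"
    proof -
      have "?j s \<otimes>\<^bsub>?Q\<^esub> g \<zero>\<^bsub>M\<^esub> k = ?j \<zero>\<^bsub>R\<^esub>" if "k < r" for k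
        using linmap_zero[OF glin[OF that]] sc jh by (simp add: j0)
      then show ?thesis by auto
    qed
    fix x assume x: "x \<in> ?H"
    show "x \<oplus>\<^bsub>M\<^esub> y \<in> ?H" if y: "y \<in> ?H" for y
    proof -
      have "?j s \<otimes>\<^bsub>?Q\<^esub> g (x \<oplus>\<^bsub>M\<^esub> y) k \<in> ?j ` carrier R" if k: "k < r" for k
      proof -
        have "?j s \<otimes>\<^bsub>?Q\<^esub> g x k \<in> ?j ` carrier R" "?j s \<otimes>\<^bsub>?Q\<^esub> g y k \<in> ?j ` carrier R"
          using x y k by simp_all
        then obtain a b where "a \<in> carrier R" "?j s \<otimes>\<^bsub>?Q\<^esub> g x k = ?j a" "b \<in> carrier R" "?j s \<otimes>\<^bsub>?Q\<^esub> g y k = ?j b"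
          by (elim imageE)
        then have "?j s \<otimes>\<^bsub>?Q\<^esub> g (x \<oplus>\<^bsub>M\<^esub> y) k = ?j (a \<oplus>\<^bsub>R\<^esub> b)"
          using x y k sc by (simp add: gadd jh gc Q.r_distr)
        then show ?thesis using \<open>a \<in> _\<close> \<open>b \<in> _\<close> by simp
      qed
      then show ?thesis using x y by simp
    qed
    show "a \<odot>\<^bsub>M\<^esub> x \<in> ?H" if a: "a \<in> carrier R" for a
    proof -
      have "?j s \<otimes>\<^bsub>?Q\<^esub> g (a \<odot>\<^bsub>M\<^esub> x) k \<in> ?j ` carrier R" if k: "k < r" for k
      proof -
        have "?j s \<otimes>\<^bsub>?Q\<^esub> g x k \<in> ?j ` carrier R" using x k by simp
        then obtain b where b: "b \<in> carrier R" "?j s \<otimes>\<^bsub>?Q\<^esub> g x k = ?j b" by (elim imageE)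
        have "?j s \<otimes>\<^bsub>?Q\<^esub> g (a \<odot>\<^bsub>M\<^esub> x) k = ?j a \<otimes>\<^bsub>?Q\<^esub> (?j s \<otimes>\<^bsub>?Q\<^esub> g x k)"
          using x k sc a by (simp add: gsm jh gc Q.m_ac)
        also have "\<dots> = ?j (a \<otimes>\<^bsub>R\<^esub> b)" using a b by (simp add: jh)
        finally show ?thesis using a b by simp
      qed
      then show ?thesis using x a by simp
    qed
  qed auto
  have "S \<subseteq> ?H" using S(1) sS by blast
  from submod_span_least[OF sub this] have H: "carrier M \<subseteq> ?H" unfolding S(3) .
  have "\<exists>c. c \<in> carrier R \<and> ?j c = ?j s \<otimes>\<^bsub>?Q\<^esub> g x k" if "x \<in> carrier M" "k < r" for x k
  proof -
    have "?j s \<otimes>\<^bsub>?Q\<^esub> g x k \<in> ?j ` carrier R" using subsetD[OF H that(1)] that(2) by simp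
    then show ?thesis by (elim imageE) auto
  qed
  then obtain c where c: "\<And>x k. x \<in> carrier M \<Longrightarrow> k < r \<Longrightarrow> c x k \<in> carrier R"
    and jc: "\<And>x k. x \<in> carrier M \<Longrightarrow> k < r \<Longrightarrow> ?j (c x k) = ?j s \<otimes>\<^bsub>?Q\<^esub> g x k" by metis
  define \<phi> where "\<phi> x = (\<lambda>k\<in>{..<r}. c x k)" for x
  have \<phi>: "linmap R M (free_module R {..<r}) \<phi>"
    unfolding linmap_def
  proof (intro conjI ballI funcsetI)
    fix x assume x: "x \<in> carrier M"
    show "\<phi> x \<in> carrier (free_module R {..<r})"
      unfolding \<phi>_def using c[OF x] by (intro M.R.free_module_restrict) auto
    show "\<phi> (x \<oplus>\<^bsub>M\<^esub> y) = \<phi> x \<oplus>\<^bsub>free_module R {..<r}\<^esub> \<phi> y" if y: "y \<in> carrier M" for y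
    proof -
      have "c (x \<oplus>\<^bsub>M\<^esub> y) k = c x k \<oplus>\<^bsub>R\<^esub> c y k" if k: "k < r" for k
        using x y k c sc by (intro M.R.to_frac_inj) (simp_all add: jc jh gadd gc Q.r_distr)
      then show ?thesis by (auto simp: \<phi>_def)
    qed
    show "\<phi> (a \<odot>\<^bsub>M\<^esub> x) = a \<odot>\<^bsub>free_module R {..<r}\<^esub> \<phi> x" if a: "a \<in> carrier R" for a
    proof -
      have "c (a \<odot>\<^bsub>M\<^esub> x) k = a \<otimes>\<^bsub>R\<^esub> c x k" if k: "k < r" for k
        using x a k c sc by (intro M.R.to_frac_inj) (simp_all add: jc jh gsm gc Q.m_ac)
      then show ?thesis by (auto simp: \<phi>_def)
    qed
  qed
  \<comment> \<open>One denominator t for the first n basis vectors: \<open>frac\<close> is applied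
    to the preimage of the next one under \<open>h\<close>, and the old and the new denominator are
    multiplied.\<close>
  have "\<exists>t\<in>nonzerodivisors R. \<exists>y. \<forall>k<n. y k \<in> carrier M \<and>
      (\<forall>l<r. ?j t \<otimes>\<^bsub>?Q\<^esub> free_gen ?Q {..<r} k l = g (y k) l)" if "n \<le> r" for n
    using that
  proof (induction n)
    case 0
    then show ?case using M.R.one_nonzerodivisor by auto
  next
    case (Suc n)
    have ec: "free_gen ?Q {..<r} k l \<in> carrier ?Q" if "l < r" for k l
      using that by (simp add: free_gen_def)
    obtain t y where t: "t \<in> nonzerodivisors R"
      and y: "\<And>k. k < n \<Longrightarrow> y k \<in> carrier M"
        "\<And>k l. k < n \<Longrightarrow> l < r \<Longrightarrow> ?j t \<otimes>\<^bsub>?Q\<^esub> free_gen ?Q {..<r} k l = g (y k) l"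
      using Suc by (metis Suc_leD)
    have "free_gen ?Q {..<r} n \<in> h ` carrier ?T"
      using bij Q.free_gen_closed unfolding bij_betw_def by metis
    then obtain \<omega> where \<omega>: "\<omega> \<in> carrier ?T" "free_gen ?Q {..<r} n = h \<omega>"
      by (elim imageE)
    obtain u x where u: "u \<in> nonzerodivisors R" and x: "x \<in> carrier M"
      and ux: "\<And>l. l < r \<Longrightarrow> ?j u \<otimes>\<^bsub>?Q\<^esub> free_gen ?Q {..<r} n l = g x l"
      using frac[OF \<omega>(1)] unfolding \<omega>(2)[symmetric] by blast
    note cc = nzc[OF t] nzc[OF u] x
    let ?y = "\<lambda>k. if k = n then t \<odot>\<^bsub>M\<^esub> x else u \<odot>\<^bsub>M\<^esub> y k"
    have step: "?y k \<in> carrier M \<and> (\<forall>l<r. ?j (t \<otimes>\<^bsub>R\<^esub> u) \<otimes>\<^bsub>?Q\<^esub> free_gen ?Q {..<r} k l = g (?y k) l)"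
      if k: "k < Suc n" for k
    proof (cases "k = n")
      case True
      then show ?thesis using cc by (simp add: gsm ux[symmetric] jh ec Q.m_assoc)
    next
      case False
      then have "k < n" using k by simp
      then show ?thesis using cc y(1) False by (simp add: gsm y(2)[symmetric] jh ec Q.m_ac)
    qed
    then show ?case
      by (intro bexI[of _ "t \<otimes>\<^bsub>R\<^esub> u"] exI[of _ ?y] allI impI step M.R.mult_nonzerodivisors[OF t u])
  qed
  from this[OF order_refl] obtain t y where t: "t \<in> nonzerodivisors R"
    and y: "\<And>k. k < r \<Longrightarrow> y k \<in> carrier M"
    and ty: "\<And>k l. k < r \<Longrightarrow> l < r \<Longrightarrow> ?j t \<otimes>\<^bsub>?Q\<^esub> free_gen ?Q {..<r} k l = g (y k) l"
    by blast
  have tc: "t \<in> carrier R" using nzc[OF t] .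
  have yc: "y \<in> {..<r} \<rightarrow> carrier M" using y by auto
  define \<xi> where "\<xi> = free_ext R M {..<r} y"
  have \<xi>: "linmap R (free_module R {..<r}) M \<xi>"
    unfolding \<xi>_def by (rule M.free_ext_linmap[OF yc])
  \<comment> \<open>Over Q the map \<xi> is t times the inverse of \<open>h\<close>; linearity
    reduces this to the basis vectors.\<close>
  have g\<xi>: "g (\<xi> v) l = ?j t \<otimes>\<^bsub>?Q\<^esub> ?j (v l)" if v: "v \<in> carrier (free_module R {..<r})" and l: "l < r" for v l
  proof (rule M.R.linmap_free_eq[OF B.module_axioms linmap_comp[OF \<xi> glin[OF l]] _ _ v])
    show "linmap R (free_module R {..<r}) ?N (\<lambda>v. ?j t \<otimes>\<^bsub>?Q\<^esub> ?j (v l))"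
      unfolding linmap_def using l tc by (auto simp: jh Q.r_distr Q.m_ac PiE_iff)
    show "g (\<xi> (free_gen R {..<r} k)) l = ?j t \<otimes>\<^bsub>?Q\<^esub> ?j (free_gen R {..<r} k l)" if "k \<in> {..<r}" for k
      using that l ty[of k l] M.free_ext_gen[OF yc that]
      by (simp add: \<xi>_def free_gen_def jh j0 split: if_splits)
  qed
  note \<phi>c = linmap_closed[OF \<phi>] and \<xi>c = linmap_closed[OF \<xi>]
  show ?thesis
  proof (rule that[OF M.R.mult_nonzerodivisors[OF s t] \<phi> \<xi>])
    fix x assume x: "x \<in> carrier M"
    show "\<xi> (\<phi> x) = (s \<otimes>\<^bsub>R\<^esub> t) \<odot>\<^bsub>M\<^esub> x"
    proof (rule ginj)
      show "g (\<xi> (\<phi> x)) k = g ((s \<otimes>\<^bsub>R\<^esub> t) \<odot>\<^bsub>M\<^esub> x) k" if k: "k < r" for k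
        using x k sc tc g\<xi>[OF \<phi>c[OF x] k] by (simp add: \<phi>_def jc gsm jh gc Q.m_ac)
    qed (use x sc tc \<phi>c \<xi>c in auto)
  next
    fix v assume v: "v \<in> carrier (free_module R {..<r})"
    have vk: "v k \<in> carrier R" if "k < r" for k using M.R.free_module_closed[OF v] that by simp
    interpret Fr: module R "free_module R {..<r}" by (rule M.R.free_module_module)
    show "\<phi> (\<xi> v) = (s \<otimes>\<^bsub>R\<^esub> t) \<odot>\<^bsub>free_module R {..<r}\<^esub> v"
    proof (rule M.R.free_module_eqI)
      fix k assume "k \<in> {..<r}"
      then have k: "k < r" by simp
      have "c (\<xi> v) k = (s \<otimes>\<^bsub>R\<^esub> t) \<otimes>\<^bsub>R\<^esub> v k"
        using k v sc tc c[OF \<xi>c[OF v] k] vk[OF k] jc[OF \<xi>c[OF v] k] g\<xi>[OF v k]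
        by (intro M.R.to_frac_inj) (simp_all add: jh Q.m_assoc del: free_module_simps)
      then show "\<phi> (\<xi> v) k = ((s \<otimes>\<^bsub>R\<^esub> t) \<odot>\<^bsub>free_module R {..<r}\<^esub> v) k"
        using k by (simp add: \<phi>_def)
    next
      show "\<phi> (\<xi> v) \<in> carrier (free_module R {..<r})" by (rule \<phi>c[OF \<xi>c[OF v]])
      show "(s \<otimes>\<^bsub>R\<^esub> t) \<odot>\<^bsub>free_module R {..<r}\<^esub> v \<in> carrier (free_module R {..<r})"
        by (rule Fr.smult_closed[OF _ v]) (simp add: sc tc)
    qed
  qed
qed

section \<open>Length computations\<close>

text \<open>The quotient is a copy of (B/K)^n. The conditions are imposed one at a time; by
  \<open>surj\<close> the next coordinate still takes every value on the submodule cut out so far,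
  so each condition contributes one B/K. This serves both for free modules and for homomorphisms
  into them.\<close>

lemma (in two_modules) mlen_coords:
  assumes c: "\<And>i. i < n \<Longrightarrow> linmap R A B (c i)" and K: "submodule K R B"
    and surj: "\<And>i y. i < n \<Longrightarrow> y \<in> carrier B \<Longrightarrow>
      \<exists>x\<in>carrier A. c i x = y \<and> (\<forall>k<n. k \<noteq> i \<longrightarrow> c k x = \<zero>\<^bsub>B\<^esub>)"
  shows "submodule {x \<in> carrier A. \<forall>i<n. c i x \<in> K} R A"
    and "mlen R A {x \<in> carrier A. \<forall>i<n. c i x \<in> K} (carrier A) = of_nat n * mlen R B K (carrier B)"
proof -
  let ?G = "\<lambda>m. {x \<in> carrier A. \<forall>i<m. c i x \<in> K}"
  have "submodule (?G m) R A \<and> mlen R A (?G m) (carrier A) = of_nat m * mlen R B K (carrier B)"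
    if "m \<le> n" for m
    using that
  proof (induction m)
    case 0
    then show ?case by (simp add: A.carrier_is_submodule A.mlen_refl)
  next
    case (Suc m)
    then have m: "m < n" and sub: "submodule (?G m) R A"
      and len: "mlen R A (?G m) (carrier A) = of_nat m * mlen R B K (carrier B)" by simp_all
    have G: "?G (Suc m) = {x \<in> ?G m. c m x \<in> K}" by (auto simp: less_Suc_eq)
    have sub': "submodule (?G (Suc m)) R A" unfolding G by (rule submodule_vimage[OF c[OF m] sub K])
    have im: "submodule (c m ` ?G m) R B" by (rule submodule_image[OF c[OF m] sub])
    have "c m ` ?G m = carrier B"
    proof
      show "c m ` ?G m \<subseteq> carrier B" by (rule B.submodule_subset[OF im])
      show "carrier B \<subseteq> c m ` ?G m"
      proof
        fix y assume "y \<in> carrier B"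
        then obtain x where "x \<in> carrier A" "c m x = y" "\<And>k. k < n \<Longrightarrow> k \<noteq> m \<Longrightarrow> c k x = \<zero>\<^bsub>B\<^esub>"
          using surj[OF m] by blast
        moreover from this have "x \<in> ?G m" using m B.submodule_zero[OF K] by simp
        ultimately show "y \<in> c m ` ?G m" by blast
      qed
    qed
    then have "c m ` ?G m <+>\<^bsub>B\<^esub> K = carrier B"
      using B.set_add_upper(1)[OF im K] B.submodule_subset[OF B.submodule_set_add[OF im K]] by auto
    with mlen_vimage[OF c[OF m] sub K] have "mlen R A (?G (Suc m)) (?G m) = mlen R B K (carrier B)"
      by (simp only: G)
    moreover have "?G (Suc m) \<subseteq> ?G m" "?G m \<subseteq> carrier A" by auto
    ultimately have "mlen R A (?G (Suc m)) (carrier A)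
        = mlen R B K (carrier B) + of_nat m * mlen R B K (carrier B)"
      using A.mlen_add[OF sub' sub A.carrier_is_submodule] len by simp
    then show ?case using sub' by (simp add: distrib_right)
  qed
  then show "submodule (?G n) R A"
    "mlen R A (?G n) (carrier A) = of_nat n * mlen R B K (carrier B)" by auto
qed

text \<open>The Herbrand quotient of a two-periodic complex of finite length is trivial: exactness at one
  spot forces exactness at the other one. The complex here consists of the quotients of
  \<open>A\<close> by \<open>A'\<close> and of \<open>B\<close> by \<open>B'\<close>.\<close>

lemma (in two_modules) herbrand:
  assumes D: "linmap R A B D" and E: "linmap R B A E"
    and A': "submodule A' R A" and B': "submodule B' R B"
    and DA: "\<And>x. x \<in> A' \<Longrightarrow> D x \<in> B'" and EB: "\<And>y. y \<in> B' \<Longrightarrow> E y \<in> A'"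
    and DE: "\<And>y. y \<in> carrier B \<Longrightarrow> D (E y) \<in> B'" and ED: "\<And>x. x \<in> carrier A \<Longrightarrow> E (D x) \<in> A'"
    and len: "mlen R A A' (carrier A) = mlen R B B' (carrier B)" "mlen R A A' (carrier A) \<noteq> \<infinity>"
    and exact: "\<And>y. y \<in> carrier B \<Longrightarrow> E y \<in> A' \<Longrightarrow> y \<in> D ` carrier A <+>\<^bsub>B\<^esub> B'"
    and x: "x \<in> carrier A" "D x \<in> B'"
  shows "x \<in> E ` carrier B <+>\<^bsub>A\<^esub> A'"
proof -
  interpret BA: two_modules R B A by (simp add: two_modules_def A.module_axioms B.module_axioms)
  note cA = A.carrier_is_submodule and cB = B.carrier_is_submodule
  let ?Z1 = "{x \<in> carrier A. D x \<in> B'}" and ?Z0 = "{y \<in> carrier B. E y \<in> A'}"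
  let ?I1 = "E ` carrier B <+>\<^bsub>A\<^esub> A'" and ?I0 = "D ` carrier A <+>\<^bsub>B\<^esub> B'"
  have Z1: "submodule ?Z1 R A" by (rule submodule_vimage[OF D cA B'])
  have Z0: "submodule ?Z0 R B" by (rule BA.submodule_vimage[OF E cB A'])
  have imE: "submodule (E ` carrier B) R A" by (rule BA.submodule_image[OF E cB])
  have imD: "submodule (D ` carrier A) R B" by (rule submodule_image[OF D cA])
  have I1: "submodule ?I1 R A" by (rule A.submodule_set_add[OF imE A'])
  have I0: "submodule ?I0 R B" by (rule B.submodule_set_add[OF imD B'])
  note sA' = A.submodule_subset[OF A'] and sB' = B.submodule_subset[OF B']
  have I1Z1: "?I1 \<subseteq> ?Z1"
    by (rule A.set_add_least[OF Z1]) (use DE DA sA' linmap_closed[OF E] in auto)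
  have "?I0 \<subseteq> ?Z0"
    by (rule B.set_add_least[OF Z0]) (use ED EB sB' linmap_closed[OF D] in auto)
  then have Z0_eq: "?Z0 = ?I0" using exact by blast
  \<comment> \<open>In A' \<subseteq> I1 \<subseteq> Z1 \<subseteq> A and B' \<subseteq> I0 = Z0
    \<subseteq> B the map \<open>D\<close> identifies A/Z1 with I0/B', and \<open>E\<close>
    identifies B/Z0 with I1/A'. Two of the three layers of A thus account for the whole length of
    B/B'; finiteness lets them cancel and leaves length 0 for Z1/I1.\<close>
  have "mlen R A A' (carrier A)
      = mlen R A A' ?I1 + (mlen R A ?I1 ?Z1 + mlen R A ?Z1 (carrier A))"
    using A.mlen_add[OF A' I1 cA A.set_add_upper(2)[OF imE A'] A.submodule_subset[OF I1]]
      A.mlen_add[OF I1 Z1 cA I1Z1 A.submodule_subset[OF Z1]] by simp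
  moreover have "mlen R B B' (carrier B) = mlen R B B' ?I0 + mlen R B ?Z0 (carrier B)"
    unfolding Z0_eq by (rule B.mlen_add[OF B' I0 cB B.set_add_upper(2)[OF imD B'] B.submodule_subset[OF I0]])
  moreover have "mlen R A ?Z1 (carrier A) = mlen R B B' ?I0" by (rule mlen_vimage[OF D cA B'])
  moreover have "mlen R B ?Z0 (carrier B) = mlen R A A' ?I1" by (rule BA.mlen_vimage[OF E cB A'])
  ultimately have "mlen R A ?I1 ?Z1 = 0"
    using len by (cases "mlen R A A' ?I1"; cases "mlen R A ?I1 ?Z1"; cases "mlen R B B' ?I0")
      (auto simp: zero_enat_def)
  then have "?I1 = ?Z1" by (rule A.mlen_eq_0D[OF _ I1 Z1 I1Z1])
  then show ?thesis using x by blast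
qed

section \<open>One-dimensional rings\<close>

abbreviation (in cring) (input) self where "self \<equiv> ring_module (\<lambda>a. a) R"

context cring
begin

lemma self_module: "module R self"
  by (rule ring_module_module) (auto simp: ring_hom_def is_cring)

lemma self_linmap_mult: "a \<in> carrier R \<Longrightarrow> linmap R self self (\<lambda>x. a \<otimes> x)"
  unfolding linmap_def by (auto simp: r_distr m_lcomm)

lemma submodule_self_iff: "submodule I R self \<longleftrightarrow> ideal I R"
proof
  interpret S: module R self by (rule self_module)
  assume I: "submodule I R self"
  show "ideal I R"
  proof (rule idealI[OF ring_axioms])
    have "\<ominus>x \<in> I" if "x \<in> I" for x
      using S.submodule_smult[OF I, of "\<ominus> \<one>" x] that S.submodule_mem[OF I] by (simp add: l_minus)
    then show "subgroup I (add_monoid R)"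
      using S.submodule_subset[OF I] S.submodule_zero[OF I] S.submodule_add[OF I]
      by (intro add.subgroupI) (auto simp flip: a_inv_def)
    show "x \<otimes> a \<in> I" "a \<otimes> x \<in> I" if "a \<in> I" "x \<in> carrier R" for a x
      using S.submodule_smult[OF I that(2,1)] S.submodule_mem[OF I that(1)] that by (simp_all add: m_comm)
  qed
next
  interpret S: module R self by (rule self_module)
  assume I: "ideal I R"
  then interpret I: ideal I R .
  show "submodule I R self"
    by (rule S.submoduleI') (use I.a_subset I.I_l_closed in auto)
qed

text \<open>In a Noetherian ring the union of a non-empty chain of ideals is a member of the chain,
  so Zorn's lemma applies to an arbitrary property \<open>P\<close>. The uses are proper ideals,
  ideals avoiding a multiplicative set and ideals of infinite colength.\<close>

lemma noetherian_maximal_ideal: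
  assumes "noetherian_ring R" and "ideal I R" "P I"
  obtains J where "ideal J R" "P J" "I \<subseteq> J" "\<And>L. ideal L R \<Longrightarrow> P L \<Longrightarrow> J \<subseteq> L \<Longrightarrow> L = J"
proof -
  interpret noetherian_ring R by fact
  let ?\<I> = "{J. ideal J R \<and> P J \<and> I \<subseteq> J}"
  have "\<exists>J\<in>?\<I>. \<forall>L\<in>?\<I>. J \<subseteq> L \<longrightarrow> L = J"
  proof (rule subset_Zorn_nonempty)
    show "?\<I> \<noteq> {}" using assms by auto
    fix \<C> assume "\<C> \<noteq> {}" "subset.chain ?\<I> \<C>"
    then have "\<C> \<subseteq> ?\<I>" "subset.chain {I. ideal I R} \<C>" by (auto simp: subset_chain_def)
    then show "\<Union>\<C> \<in> ?\<I>" using ideal_chain_is_trivial[OF \<open>\<C> \<noteq> {}\<close>] by blast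
  qed
  then obtain J where J: "ideal J R" "P J" "I \<subseteq> J"
    and max: "\<And>L. ideal L R \<Longrightarrow> P L \<Longrightarrow> I \<subseteq> L \<Longrightarrow> J \<subseteq> L \<Longrightarrow> L = J" by auto
  show ?thesis by (rule that[OF J]) (use J(3) max in blast)
qed

lemma noetherian_exists_maximalideal:
  assumes "noetherian_ring R" and "ideal I R" "I \<noteq> carrier R"
  obtains J where "maximalideal J R" "I \<subseteq> J"
proof -
  obtain J where J: "ideal J R" "J \<noteq> carrier R" "I \<subseteq> J"
      "\<And>L. ideal L R \<Longrightarrow> L \<noteq> carrier R \<Longrightarrow> J \<subseteq> L \<Longrightarrow> L = J"
    using noetherian_maximal_ideal[OF assms(1,2), of "\<lambda>J. J \<noteq> carrier R"] assms(3) by blast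
  have "maximalideal J R" by (rule maximalidealI) (use J in blast)+
  then show ?thesis using that J(3) by blast
qed

lemma maximalideal_colength:
  assumes "maximalideal I R"
  shows "mlen R self I (carrier R) \<le> 1"
  unfolding mlen_def
proof (rule chain_length_le)
  interpret maximalideal I R by fact
  fix n C assume C: "strict_chain {C. submodule C R self \<and> I \<subseteq> C \<and> C \<subseteq> carrier R} n C"
  have "\<not> 2 \<le> n"
  proof
    assume n: "2 \<le> n"
    then have "I \<subseteq> C 0" "C 0 \<subset> C 1" "C 1 \<subset> C 2" "C 2 \<subseteq> carrier R" "ideal (C 1) R"
      using C n unfolding strict_chain_def by (auto simp: submodule_self_iff numeral_2_eq_2)
    moreover from this have "C 1 = I \<or> C 1 = carrier R" by (intro I_maximal) auto
    ultimately show False by blast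
  qed
  then show "enat n \<le> 1" by (simp add: one_enat_def)
qed

text \<open>Multiplication by \<open>a\<close> induces an isomorphism of R/(I : a) with (aR + I)/I.
  It ties together the two ideals above \<open>I\<close> that decide whether \<open>I\<close> is
  prime.\<close>

lemma ideal_adjoin:
  assumes "ideal I R" "a \<in> carrier R"
  defines "J \<equiv> (\<lambda>x. a \<otimes> x) ` carrier R <+>\<^bsub>self\<^esub> I"
  shows "ideal J R" "I \<subseteq> J" "a \<in> J"
    and "mlen R self {x \<in> carrier R. a \<otimes> x \<in> I} (carrier R) = mlen R self I J"
    and "ideal {x \<in> carrier R. a \<otimes> x \<in> I} R"
proof -
  interpret S: two_modules R self self by (simp add: two_modules_def self_module)
  note cS = S.A.carrier_is_submodule[simplified]
  note l = self_linmap_mult[OF assms(2)]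
  have I: "submodule I R self" using assms(1) by (simp add: submodule_self_iff)
  have im: "submodule ((\<lambda>x. a \<otimes> x) ` carrier R) R self" by (rule S.submodule_image[OF l cS])
  show "ideal J R" unfolding J_def using S.A.submodule_set_add[OF im I] by (simp add: submodule_self_iff)
  show "I \<subseteq> J" unfolding J_def by (rule S.A.set_add_upper(2)[OF im I])
  have "a \<in> (\<lambda>x. a \<otimes> x) ` carrier R" using assms(2) by (intro image_eqI[of _ _ \<one>]) auto
  then show "a \<in> J" unfolding J_def using S.A.set_add_upper(1)[OF im I] by blast
  show "mlen R self {x \<in> carrier R. a \<otimes> x \<in> I} (carrier R) = mlen R self I J"
    unfolding J_def using S.mlen_vimage[OF l cS I] by simp
  show "ideal {x \<in> carrier R. a \<otimes> x \<in> I} R"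
    using S.submodule_vimage[OF l cS I] by (simp add: submodule_self_iff)
qed

lemma pow_nonzerodivisors: "s \<in> nonzerodivisors R \<Longrightarrow> s [^] (n::nat) \<in> nonzerodivisors R"
  by (induction n) (auto simp: one_nonzerodivisor mult_nonzerodivisors)

text \<open>A minimal prime ideal consists of zero-divisors: otherwise the products of the powers of \<open>s\<close>
  with the elements outside \<open>P\<close> form a multiplicative set that does not contain zero.\<close>

lemma primeideal_not_minimal:
  assumes noeth: "noetherian_ring R" and P: "primeideal P R" and s: "s \<in> P" "s \<in> nonzerodivisors R"
  obtains Q where "primeideal Q R" "Q \<subset> P"
proof -
  interpret P: primeideal P R by fact
  have sc: "s \<in> carrier R" using s(2) by (rule nonzerodivisors_closed)
  have oneP: "\<one> \<notin> P" using P.I_notcarr P.one_imp_carrier by blast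
  \<comment> \<open>Avoiding the complement of \<open>P\<close> will put the new prime inside
    \<open>P\<close>, and avoiding \<open>s\<close> will make the inclusion strict, so
    \<open>S\<close> has to contain both.\<close>
  define S where "S = {s [^] (k::nat) \<otimes> u | k u. u \<in> carrier R \<and> u \<notin> P}"
  have S_mult: "x \<otimes> y \<in> S" if xy: "x \<in> S" "y \<in> S" for x y
  proof -
    obtain k u l v where e: "x = s [^] (k::nat) \<otimes> u" "y = s [^] (l::nat) \<otimes> v"
      and uv: "u \<in> carrier R" "u \<notin> P" "v \<in> carrier R" "v \<notin> P"
      using xy unfolding S_def by blast
    have "x \<otimes> y = s [^] (k + l) \<otimes> (u \<otimes> v)" using uv sc by (simp add: e m_ac nat_pow_mult[symmetric])
    moreover have "u \<otimes> v \<notin> P" using P.I_prime uv by blast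
    ultimately show ?thesis unfolding S_def using uv by blast
  qed
  have sS: "s \<in> S" unfolding S_def using sc oneP by (auto intro!: exI[of _ "1::nat"] exI[of _ \<one>])
  have compl: "u \<in> S" if "u \<in> carrier R" "u \<notin> P" for u
    unfolding S_def using that by (auto intro!: exI[of _ "0::nat"] exI[of _ u])
  have "\<zero> \<notin> S"
  proof
    assume "\<zero> \<in> S"
    then obtain k u where "\<zero> = s [^] (k::nat) \<otimes> u" "u \<in> carrier R" "u \<notin> P" unfolding S_def by blast
    then have "u = \<zero>" using nonzerodivisorsD[OF pow_nonzerodivisors[OF s(2)]] by metis
    then show False using \<open>u \<notin> P\<close> P.zero_closed by simp
  qed
  then have "{\<zero>} \<inter> S = {}" by simp
  then obtain Q where Q: "ideal Q R" "Q \<inter> S = {}"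
    and max: "\<And>L. ideal L R \<Longrightarrow> L \<inter> S = {} \<Longrightarrow> Q \<subseteq> L \<Longrightarrow> L = Q"
    by (rule noetherian_maximal_ideal[OF noeth zeroideal]) (rule that)
  interpret Q: ideal Q R by (rule Q)
  have SC: "S \<subseteq> carrier R" unfolding S_def using sc by auto
  have meets: "\<exists>q\<in>Q. \<exists>x\<in>carrier R. a \<otimes> x \<oplus> q \<in> S" if a: "a \<in> carrier R" "a \<notin> Q" for a
  proof -
    let ?J = "(\<lambda>x. a \<otimes> x) ` carrier R <+>\<^bsub>self\<^esub> Q"
    note J = ideal_adjoin(1-3)[OF Q(1) a(1)]
    have "?J \<inter> S \<noteq> {}" using max[OF J(1) _ J(2)] J(3) a(2) by auto
    then show ?thesis by (auto simp: set_add_def')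
  qed
  have "primeideal Q R"
  proof (rule primeidealI[OF Q(1) is_cring])
    have "\<one> \<in> S" using compl[OF _ oneP] by simp
    then show "carrier R \<noteq> Q" using Q(2) by auto
  next
    fix a b assume ab: "a \<in> carrier R" "b \<in> carrier R" "a \<otimes> b \<in> Q"
    show "a \<in> Q \<or> b \<in> Q"
    proof (rule ccontr)
      assume "\<not> (a \<in> Q \<or> b \<in> Q)"
      then obtain q x q' y where q: "q \<in> Q" "x \<in> carrier R" "a \<otimes> x \<oplus> q \<in> S"
        and q': "q' \<in> Q" "y \<in> carrier R" "b \<otimes> y \<oplus> q' \<in> S"
        using meets[OF ab(1)] meets[OF ab(2)] by blast
      note c = ab(1,2) q(2) q'(2) Q.a_Hcarr[OF q(1)] Q.a_Hcarr[OF q'(1)]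
      \<comment> \<open>Both factors lie in \<open>S\<close>, hence so does the product. After
        expansion each term is a multiple of a b, q or q', so the product lies in \<open>Q\<close>
        as well.\<close>
      have "(a \<otimes> x \<oplus> q) \<otimes> (b \<otimes> y \<oplus> q')
        = ((a \<otimes> b) \<otimes> (x \<otimes> y) \<oplus> (a \<otimes> x) \<otimes> q') \<oplus> q \<otimes> (b \<otimes> y \<oplus> q')"
        using c by (simp add: l_distr r_distr m_ac a_ac)
      also have "\<dots> \<in> Q"
        using c by (intro Q.a_closed Q.I_r_closed[OF ab(3)] Q.I_l_closed[OF q'(1)] Q.I_r_closed[OF q(1)]) auto
      finally show False using S_mult[OF q(3) q'(3)] Q(2) by blast
    qed
  qed
  moreover have "Q \<subset> P"
  proof
    show "Q \<subseteq> P" using Q(2) compl Q.a_subset by blast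
    show "Q \<noteq> P" using s(1) sS Q(2) by blast
  qed
  ultimately show ?thesis using that by blast
qed

text \<open>An ideal that is maximal among the ideals of infinite colength is prime.\<close>

lemma finite_colength:
  assumes noeth: "noetherian_ring R" and dim: "krull_dim R = 1" and s: "s \<in> nonzerodivisors R"
  shows "mlen R self ((\<lambda>x. s \<otimes> x) ` carrier R) (carrier R) \<noteq> \<infinity>"
proof
  interpret S: module R self by (rule self_module)
  have sc: "s \<in> carrier R" using s by (rule nonzerodivisors_closed)
  let ?inf = "\<lambda>I. mlen R self I (carrier R) = \<infinity>"
  assume inf: "?inf ((\<lambda>x. s \<otimes> x) ` carrier R)"
  interpret SS: two_modules R self self by (simp add: two_modules_def self_module)
  have "ideal ((\<lambda>x. s \<otimes> x) ` carrier R) R"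
    using SS.submodule_image[OF self_linmap_mult[OF sc] S.carrier_is_submodule]
    by (simp add: submodule_self_iff)
  then obtain I where I: "ideal I R" "?inf I" "(\<lambda>x. s \<otimes> x) ` carrier R \<subseteq> I"
    and max: "\<And>L. ideal L R \<Longrightarrow> ?inf L \<Longrightarrow> I \<subseteq> L \<Longrightarrow> L = I"
    by (rule noetherian_maximal_ideal[where P = ?inf, OF noeth _ inf]) (rule that)
  interpret I: ideal I R by (rule I)
  have "s = s \<otimes> \<one>" using sc by simp
  then have sI: "s \<in> I" using I(3) by blast
  have I_ne: "I \<noteq> carrier R" using I(2) S.mlen_refl[of "carrier R"] by auto
  have prime: "primeideal I R"
  proof (rule primeidealI[OF I(1) is_cring])
    show "carrier R \<noteq> I" using I_ne by simp
    fix a b assume ab: "a \<in> carrier R" "b \<in> carrier R" "a \<otimes> b \<in> I"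
    show "a \<in> I \<or> b \<in> I"
    proof (rule ccontr)
      assume n: "\<not> (a \<in> I \<or> b \<in> I)"
      let ?J = "(\<lambda>x. a \<otimes> x) ` carrier R <+>\<^bsub>self\<^esub> I" and ?K = "{x \<in> carrier R. a \<otimes> x \<in> I}"
      note J = ideal_adjoin[OF I(1) ab(1)]
      interpret J: ideal ?J R by (rule J(1))
      \<comment> \<open>Both ideals are strictly larger than \<open>I\<close>, since a lies in aR +
        I and b in (I : a), so by maximality both have finite colength. But R/I is built from (aR +
        I)/I, which has the length of R/(I : a), and from R/(aR + I).\<close>
      have "\<not> ?inf ?J" using max[OF J(1) _ J(2)] J(3) n by auto
      moreover have "I \<subseteq> ?K" using ab(1) I.a_Hcarr I.I_l_closed by auto
      then have "\<not> ?inf ?K" using max[OF J(5)] ab n by auto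
      moreover have "mlen R self I (carrier R) = mlen R self I ?J + mlen R self ?J (carrier R)"
        using I(1) J(1,2) J.a_subset S.carrier_is_submodule
        by (intro S.mlen_add) (simp_all add: submodule_self_iff)
      ultimately show False using I(2) J(4) by auto
    qed
  qed
  \<comment> \<open>There is a prime strictly below \<open>I\<close> because \<open>I\<close>
    contains the non-zero-divisor \<open>s\<close>, and a maximal ideal strictly above because
    maximal ideals have colength at most 1. Three nested primes contradict dimension one.\<close>
  obtain Q where Q: "primeideal Q R" "Q \<subset> I" by (rule primeideal_not_minimal[OF noeth prime sI s])
  obtain J where J: "maximalideal J R" "I \<subseteq> J"
    by (rule noetherian_exists_maximalideal[OF noeth I(1) I_ne])
  have "I \<noteq> J" using I(2) maximalideal_colength[OF J(1)] by auto
  define C where "C = (\<lambda>i::nat. if i = 0 then Q else if i = 1 then I else J)"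
  have "(\<forall>i\<le>2. primeideal (C i) R) \<and> (\<forall>i<2. C i \<subset> C (Suc i))"
    using Q prime maximalideal_prime[OF J(1)] J(2) \<open>I \<noteq> J\<close>
    by (auto simp: C_def le_Suc_eq less_Suc_eq numeral_2_eq_2)
  then have "enat 2 \<le> krull_dim R"
    unfolding krull_dim_def by (intro SUP_upper) blast
  then show False by (simp add: dim one_enat_def)
qed

end

section \<open>Nakayama's lemma\<close>

text \<open>A non-unit 1 - a would lie in some maximal ideal, hence in the only one, which already
  contains a; it would then contain their sum 1.\<close>

lemma (in local_ring) one_minus_max_ideal_unit:
  assumes "noetherian_ring R" and a: "a \<in> max_ideal R"
  shows "\<one> \<ominus> a \<in> Units R" and "ideal (max_ideal R) R" and "\<one> \<notin> max_ideal R"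
proof -
  have m: "maximalideal (max_ideal R) R"
    unfolding max_ideal_def by (rule theI'[OF unique_maximalideal])
  interpret m: maximalideal "max_ideal R" R by (rule m)
  show id: "ideal (max_ideal R) R" by (rule m.is_ideal)
  show one: "\<one> \<notin> max_ideal R" using m.I_notcarr m.one_imp_carrier by blast
  have ac: "a \<in> carrier R" using a by (rule m.a_Hcarr)
  show "\<one> \<ominus> a \<in> Units R"
  proof (rule ccontr)
    assume u: "\<one> \<ominus> a \<notin> Units R"
    have c: "\<one> \<ominus> a \<in> carrier R" using ac by simp
    have "\<one> \<notin> PIdl (\<one> \<ominus> a)"
      using u c unfolding cgenideal_def Units_def by (auto simp: m_comm)
    then have "PIdl (\<one> \<ominus> a) \<noteq> carrier R" by auto
    then obtain J where J: "maximalideal J R" "PIdl (\<one> \<ominus> a) \<subseteq> J"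
      by (rule noetherian_exists_maximalideal[OF assms(1) cgenideal_ideal[OF c]])
    then have "J = max_ideal R" using unique_maximalideal m by blast
    then have "(\<one> \<ominus> a) \<oplus> a \<in> max_ideal R" using J(2) cgenideal_self[OF c] a by blast
    then show False using one ac by (simp add: a_minus_def a_assoc l_neg)
  qed
qed

text \<open>Elimination in place of a determinant: in the relation for the last element the factor 1
  - c is a unit, so that element is a combination of the others with coefficients in
  \<open>I\<close>. Substituting it leaves the same situation with one element fewer.\<close>

lemma (in module) nakayama:
  fixes n :: nat
  assumes I: "ideal I R" "\<And>a. a \<in> I \<Longrightarrow> \<one> \<ominus> a \<in> Units R"
    and "\<And>i. i < n \<Longrightarrow> v i \<in> carrier M"
    and "\<And>i. i < n \<Longrightarrow> \<exists>c. (\<forall>k<n. c k \<in> I) \<and> v i = (\<Oplus>\<^bsub>M\<^esub>k\<in>{..<n}. c k \<odot>\<^bsub>M\<^esub> v k)"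
    and "i < n"
  shows "v i = \<zero>\<^bsub>M\<^esub>"
  using assms(3-5)
proof (induction n arbitrary: i)
  case 0
  then show ?case by simp
next
  case (Suc n)
  interpret I: ideal I R by (rule I)
  have vc: "v k \<in> carrier M" if "k \<le> n" for k using Suc.prems(1) that by simp
  let ?S = "\<lambda>c. \<Oplus>\<^bsub>M\<^esub>k\<in>{..<n}. c k \<odot>\<^bsub>M\<^esub> v k"
  have Sc: "?S c \<in> carrier M" if "\<And>k. k < n \<Longrightarrow> c k \<in> I" for c
    using that vc I.a_Hcarr by (intro M.finsum_closed) auto
  have split: "(\<Oplus>\<^bsub>M\<^esub>k\<in>{..<Suc n}. c k \<odot>\<^bsub>M\<^esub> v k) = c n \<odot>\<^bsub>M\<^esub> v n \<oplus>\<^bsub>M\<^esub> ?S c"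
    if "\<And>k. k \<le> n \<Longrightarrow> c k \<in> I" for c
    unfolding lessThan_Suc using that vc I.a_Hcarr by (subst M.finsum_insert) auto
  have Sadd: "?S c \<oplus>\<^bsub>M\<^esub> ?S c' = ?S (\<lambda>k. c k \<oplus> c' k)"
    if "\<And>k. k < n \<Longrightarrow> c k \<in> I" "\<And>k. k < n \<Longrightarrow> c' k \<in> I" for c c'
  proof -
    have "?S c \<oplus>\<^bsub>M\<^esub> ?S c' = (\<Oplus>\<^bsub>M\<^esub>k\<in>{..<n}. c k \<odot>\<^bsub>M\<^esub> v k \<oplus>\<^bsub>M\<^esub> c' k \<odot>\<^bsub>M\<^esub> v k)"
      using that vc I.a_Hcarr by (intro M.finsum_addf[symmetric]) auto
    also have "\<dots> = ?S (\<lambda>k. c k \<oplus> c' k)"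
      using that vc I.a_Hcarr by (intro M.finsum_cong') (auto simp: smult_l_distr)
    finally show ?thesis .
  qed
  have Ssmult: "a \<odot>\<^bsub>M\<^esub> ?S c = ?S (\<lambda>k. a \<otimes> c k)"
    if "a \<in> carrier R" "\<And>k. k < n \<Longrightarrow> c k \<in> I" for a c
  proof -
    have "a \<odot>\<^bsub>M\<^esub> ?S c = (\<Oplus>\<^bsub>M\<^esub>k\<in>{..<n}. a \<odot>\<^bsub>M\<^esub> (c k \<odot>\<^bsub>M\<^esub> v k))"
      using that vc I.a_Hcarr by (intro finsum_smult_ldistr) auto
    also have "\<dots> = ?S (\<lambda>k. a \<otimes> c k)"
      using that vc I.a_Hcarr by (intro M.finsum_cong') (auto simp: smult_assoc1)
    finally show ?thesis .
  qed
  obtain c where c: "\<And>k. k \<le> n \<Longrightarrow> c k \<in> I" and "v n = (\<Oplus>\<^bsub>M\<^esub>k\<in>{..<Suc n}. c k \<odot>\<^bsub>M\<^esub> v k)"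
    using Suc.prems(2)[of n] by (auto simp: less_Suc_eq_le)
  then have vn: "v n = c n \<odot>\<^bsub>M\<^esub> v n \<oplus>\<^bsub>M\<^esub> ?S c" by (simp only: split[OF c])
  have cn: "c n \<in> carrier R" using c I.a_Hcarr by simp
  have cI: "c k \<in> I" if "k < n" for k using c that by simp
  have unit: "\<one> \<ominus> c n \<in> Units R" using I(2) c by simp
  define u where "u = inv (\<one> \<ominus> c n)"
  have u: "u \<in> carrier R" "u \<otimes> (\<one> \<ominus> c n) = \<one>" unfolding u_def using unit by simp_all
  have "(\<one> \<ominus> c n) \<odot>\<^bsub>M\<^esub> v n = v n \<ominus>\<^bsub>M\<^esub> c n \<odot>\<^bsub>M\<^esub> v n"
    using cn vc[of n] by (simp add: a_minus_def smult_l_distr smult_l_minus)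
  also have "\<dots> = ?S c"
  proof -
    have "v n \<ominus>\<^bsub>M\<^esub> c n \<odot>\<^bsub>M\<^esub> v n = (c n \<odot>\<^bsub>M\<^esub> v n \<oplus>\<^bsub>M\<^esub> ?S c) \<ominus>\<^bsub>M\<^esub> c n \<odot>\<^bsub>M\<^esub> v n"
      by (simp only: vn[symmetric])
    also have "\<dots> = ?S c"
      using Sc[OF cI] cn vc[of n] by (simp add: a_minus_def M.add.m_ac M.r_neg M.r_neg1 M.r_neg2)
    finally show ?thesis .
  qed
  finally have "u \<odot>\<^bsub>M\<^esub> ((\<one> \<ominus> c n) \<odot>\<^bsub>M\<^esub> v n) = ?S (\<lambda>k. u \<otimes> c k)"
    using Ssmult[OF u(1) cI] by simp
  then have vn': "v n = ?S (\<lambda>k. u \<otimes> c k)"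
    using u cn vc[of n] by (simp add: smult_assoc1[symmetric])
  have zero: "v k = \<zero>\<^bsub>M\<^esub>" if "k < n" for k
  proof (rule Suc.IH[OF _ _ that])
    fix i assume i: "i < n"
    show "v i \<in> carrier M" using vc i by simp
    obtain d where d: "\<And>k. k \<le> n \<Longrightarrow> d k \<in> I" and "v i = (\<Oplus>\<^bsub>M\<^esub>k\<in>{..<Suc n}. d k \<odot>\<^bsub>M\<^esub> v k)"
      using Suc.prems(2)[of i] i by (auto simp: less_Suc_eq_le)
    then have "v i = d n \<odot>\<^bsub>M\<^esub> v n \<oplus>\<^bsub>M\<^esub> ?S d" by (simp only: split[OF d])
    moreover have dn: "d n \<in> carrier R" using d I.a_Hcarr by simp
    moreover have "d n \<odot>\<^bsub>M\<^esub> v n = ?S (\<lambda>k. d n \<otimes> (u \<otimes> c k))"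
      using Ssmult[OF dn, of "\<lambda>k. u \<otimes> c k"] vn' u cI I.I_l_closed by simp
    ultimately have "v i = ?S (\<lambda>k. d n \<otimes> (u \<otimes> c k) \<oplus> d k)"
      using Sadd[of "\<lambda>k. d n \<otimes> (u \<otimes> c k)" d] d u cI I.I_l_closed by simp
    moreover have "\<forall>k<n. d n \<otimes> (u \<otimes> c k) \<oplus> d k \<in> I"
      using d dn u cI I.I_l_closed I.a_closed by simp
    ultimately show "\<exists>c. (\<forall>k<n. c k \<in> I) \<and> v i = ?S c"
      by (intro exI[of _ "\<lambda>k. d n \<otimes> (u \<otimes> c k) \<oplus> d k"] conjI)
  qed
  have "?S (\<lambda>k. u \<otimes> c k) = \<zero>\<^bsub>M\<^esub>"
    using zero u cI I.a_Hcarr by (intro M.add.finprod_one_eqI) auto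
  then show ?case using zero vn' Suc.prems(3) by (cases "i = n") auto
qed

section \<open>Two-periodic modules\<close>

lemma (in cring) free_module_smult_cancel:
  assumes s: "s \<in> nonzerodivisors R"
    and v: "v \<in> carrier (free_module R X)" "w \<in> carrier (free_module R X)"
    and "s \<odot>\<^bsub>free_module R X\<^esub> v = s \<odot>\<^bsub>free_module R X\<^esub> w"
  shows "v = w"
proof (rule free_module_eqI[OF v])
  fix x assume x: "x \<in> X"
  then have "s \<otimes> v x = s \<otimes> w x" using fun_cong[OF assms(4), of x] by simp
  then show "v x = w x"
    by (rule nonzerodivisors_cancel[OF s free_module_closed[OF v(1) x] free_module_closed[OF v(2) x]])
qed

text \<open>\<open>j\<close> is an isomorphism of \<open>M\<close> with its second syzygy, the kernel of \<open>d\<close>.\<close>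

locale periodic_module = module R M for R (structure) and M (structure) +
  fixes b0 b1 :: nat and p d j
  assumes p: "linmap R (free_module R {..<b0}) M p"
    and d: "linmap R (free_module R {..<b1}) (free_module R {..<b0}) d"
    and j: "linmap R M (free_module R {..<b1}) j"
    and p_onto: "p ` carrier (free_module R {..<b0}) = carrier M"
    and j_inj: "inj_on j (carrier M)"
    and exact_p: "\<And>v. v \<in> carrier (free_module R {..<b0}) \<Longrightarrow>
      p v = \<zero>\<^bsub>M\<^esub> \<longleftrightarrow> v \<in> d ` carrier (free_module R {..<b1})"
    and exact_d: "\<And>v. v \<in> carrier (free_module R {..<b1}) \<Longrightarrow>
      d v = \<zero>\<^bsub>free_module R {..<b0}\<^esub> \<longleftrightarrow> v \<in> j ` carrier M"
begin

abbreviation (input) FF :: "nat \<Rightarrow> ('a, nat \<Rightarrow> 'a) module" where "FF n \<equiv> free_module R {..<n}"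
abbreviation (input) self where "self \<equiv> ring_module (\<lambda>a. a) R"

lemma FF_module: "module R (FF n)"
  by (rule R.free_module_module)

lemma FF_two_modules: "two_modules R (FF m) (FF n)" "two_modules R M (FF n)" "two_modules R (FF n) M"
    "two_modules R M M" "two_modules R M self" "two_modules R self self" "two_modules R (FF n) self"
  by (simp_all add: two_modules_def FF_module module_axioms R.self_module)

lemma smult_cancel:
  assumes s: "s \<in> nonzerodivisors R" and x: "x \<in> carrier M" "y \<in> carrier M"
    and e: "s \<odot>\<^bsub>M\<^esub> x = s \<odot>\<^bsub>M\<^esub> y"
  shows "x = y"
proof -
  have sc: "s \<in> carrier R" using R.nonzerodivisors_closed[OF s] .
  have "s \<odot>\<^bsub>FF b1\<^esub> j x = s \<odot>\<^bsub>FF b1\<^esub> j y"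
    using e linmap_smult[OF j sc, symmetric] x by metis
  then have "j x = j y"
    by (rule R.free_module_smult_cancel[OF s linmap_closed[OF j x(1)] linmap_closed[OF j x(2)]])
  then show ?thesis using j_inj x by (simp add: inj_on_def)
qed

text \<open>\<open>j\<close> embeds \<open>M\<close> into a free module, and its coordinates are
  functionals. \<open>has_rankE\<close> asks for exactly this separation property.\<close>

lemma torsionless:
  assumes x: "x \<in> carrier M" and "\<And>\<mu>. linmap R M self \<mu> \<Longrightarrow> \<mu> x = \<zero>"
  shows "x = \<zero>\<^bsub>M\<^esub>"
proof -
  interpret F: module R "FF b1" by (rule FF_module)
  interpret MF: two_modules R M "FF b1" by (rule FF_two_modules)
  have "j x = \<zero>\<^bsub>FF b1\<^esub>"
  proof (rule R.free_module_eqI[OF linmap_closed[OF j x] F.M.zero_closed])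
    fix i assume i: "i \<in> {..<b1}"
    have "j x i = \<zero>" by (rule assms(2)[OF linmap_comp[OF j R.linmap_coord[OF i]]])
    then show "j x i = \<zero>\<^bsub>FF b1\<^esub> i" using i by simp
  qed
  then have "j x = j \<zero>\<^bsub>M\<^esub>" using MF.linmap_zero[OF j] by simp
  then show ?thesis using j_inj x by (simp add: inj_on_def)
qed

subsection \<open>The ranks of the free modules\<close>

lemma FF_colength:
  assumes s: "s \<in> carrier R"
  shows "mlen R (FF n) ((\<lambda>v. s \<odot>\<^bsub>FF n\<^esub> v) ` carrier (FF n)) (carrier (FF n))
    = of_nat n * mlen R self ((\<lambda>x. s \<otimes> x) ` carrier R) (carrier R)"
proof -
  interpret F: module R "FF n" by (rule FF_module)
  interpret FS: two_modules R "FF n" self by (rule FF_two_modules)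
  interpret SS: two_modules R self self by (rule FF_two_modules)
  let ?K = "(\<lambda>x. s \<otimes> x) ` carrier R"
  have K: "submodule ?K R self"
    using SS.submodule_image[OF R.self_linmap_mult[OF s] FS.B.carrier_is_submodule] by simp
  have "(\<lambda>v. s \<odot>\<^bsub>FF n\<^esub> v) ` carrier (FF n) = {v \<in> carrier (FF n). \<forall>i<n. v i \<in> ?K}" (is "?L = ?R")
  proof
    have "s \<odot>\<^bsub>FF n\<^esub> v \<in> ?R" if v: "v \<in> carrier (FF n)" for v
      using F.smult_closed[OF s v] R.free_module_closed[OF v] by (auto simp del: free_module_simps(1))
    then show "?L \<subseteq> ?R" by blast
    show "?R \<subseteq> ?L"
    proof
      fix v assume "v \<in> ?R"
      then have v: "v \<in> carrier (FF n)" and "\<forall>i<n. \<exists>x. x \<in> carrier R \<and> v i = s \<otimes> x" by auto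
      then obtain w where w: "\<And>i. i < n \<Longrightarrow> w i \<in> carrier R" "\<And>i. i < n \<Longrightarrow> v i = s \<otimes> w i" by metis
      have wc: "(\<lambda>i\<in>{..<n}. w i) \<in> carrier (FF n)" using w by (intro R.free_module_restrict) auto
      have "v = s \<odot>\<^bsub>FF n\<^esub> (\<lambda>i\<in>{..<n}. w i)"
        by (rule R.free_module_eqI[OF v F.smult_closed[OF s wc]]) (simp add: w)
      then show "v \<in> ?L" using wc by blast
    qed
  qed
  moreover have "\<exists>v\<in>carrier (FF n). v i = y \<and> (\<forall>k<n. k \<noteq> i \<longrightarrow> v k = \<zero>)"
    if "i < n" "y \<in> carrier R" for i y
    using that by (intro bexI[of _ "\<lambda>k\<in>{..<n}. if k = i then y else \<zero>"] R.free_module_restrict) auto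
  ultimately show ?thesis
    using FS.mlen_coords(2)[of n "\<lambda>i v. v i", OF R.linmap_coord K] by simp
qed

text \<open>Let N be the image of \<open>d\<close>. Since s cancels in N, a submodule of F0, and in
  \<open>M\<close>, the sequences 0 \<rightarrow> M \<rightarrow> F1 \<rightarrow> N \<rightarrow> 0
  and 0 \<rightarrow> N \<rightarrow> F0 \<rightarrow> M \<rightarrow> 0 stay exact modulo s. So
  F1/sF1 and F0/sF0 are both built from M/sM and N/sN. The factor \<open>c\<close> stays on both
  sides because it is 0 when s is a unit.\<close>

lemma rank_balance:
  assumes s: "s \<in> nonzerodivisors R"
  defines "c \<equiv> mlen R self ((\<lambda>x. s \<otimes> x) ` carrier R) (carrier R)"
  shows "of_nat b1 * c = of_nat b0 * c"
proof -
  have sc: "s \<in> carrier R" using R.nonzerodivisors_closed[OF s] .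
  interpret F0: module R "FF b0" by (rule FF_module)
  interpret F1: module R "FF b1" by (rule FF_module)
  interpret F10: two_modules R "FF b1" "FF b0" by (rule FF_two_modules)
  interpret F00: two_modules R "FF b0" "FF b0" by (rule FF_two_modules)
  interpret F11: two_modules R "FF b1" "FF b1" by (rule FF_two_modules)
  interpret MF1: two_modules R M "FF b1" by (rule FF_two_modules)
  interpret F0M: two_modules R "FF b0" M by (rule FF_two_modules)
  interpret MM: two_modules R M M by (rule FF_two_modules)
  note [simp del] = free_module_simps
  let ?s0 = "\<lambda>v. s \<odot>\<^bsub>FF b0\<^esub> v" and ?s1 = "\<lambda>v. s \<odot>\<^bsub>FF b1\<^esub> v" and ?sM = "\<lambda>x. s \<odot>\<^bsub>M\<^esub> x"
  let ?C0 = "carrier (FF b0)" and ?C1 = "carrier (FF b1)" and ?M = "carrier M"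
  let ?N = "d ` ?C1"
  have N: "submodule ?N R (FF b0)" by (rule F10.submodule_image[OF d F1.carrier_is_submodule])
  have jM: "submodule (j ` ?M) R (FF b1)" by (rule MF1.submodule_image[OF j carrier_is_submodule])
  have sN: "submodule (?s0 ` ?N) R (FF b0)"
    by (rule F00.submodule_image[OF F0.linmap_self_smult[OF sc] N])
  have s0: "submodule (?s0 ` ?C0) R (FF b0)"
    by (rule F00.submodule_image[OF F0.linmap_self_smult[OF sc] F0.carrier_is_submodule])
  have s1: "submodule (?s1 ` ?C1) R (FF b1)"
    by (rule F11.submodule_image[OF F1.linmap_self_smult[OF sc] F1.carrier_is_submodule])
  have sM: "submodule (?sM ` ?M) R M"
    by (rule MM.submodule_image[OF linmap_self_smult[OF sc] carrier_is_submodule])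
  have dj: "d (j x) = \<zero>\<^bsub>FF b0\<^esub>" if "x \<in> ?M" for x
    using exact_d[OF linmap_closed[OF j that]] that by blast
  have pd: "p (d v) = \<zero>\<^bsub>M\<^esub>" if "v \<in> ?C1" for v
    using exact_p[OF linmap_closed[OF d that]] that by blast
  have NN: "?N <+>\<^bsub>FF b0\<^esub> ?s0 ` ?N = ?N"
  proof
    have "?s0 ` ?N \<subseteq> ?N" using F0.submodule_smult[OF N sc] by blast
    then show "?N <+>\<^bsub>FF b0\<^esub> ?s0 ` ?N \<subseteq> ?N" by (rule F0.set_add_least[OF N order_refl])
  qed (rule F0.set_add_upper(1)[OF N sN])
  have MsM: "?M <+>\<^bsub>M\<^esub> ?sM ` ?M = ?M"
    using set_add_upper(1)[OF carrier_is_submodule sM] submodule_subset[OF submodule_set_add[OF carrier_is_submodule sM]]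
    by auto
  \<comment> \<open>The four identities express exactness modulo s: 1 and 2 for M \<rightarrow> F1
    \<rightarrow> N, 3 and 4 for N \<rightarrow> F0 \<rightarrow> M. Identities 2 and 4 are
    injectivity on the left; they cancel s in F0 and in \<open>M\<close>, respectively.\<close>
  have 1: "{v \<in> ?C1. d v \<in> ?s0 ` ?N} = j ` ?M <+>\<^bsub>FF b1\<^esub> ?s1 ` ?C1" (is "?L = ?R")
  proof
    show "?L \<subseteq> ?R"
    proof
      fix v assume "v \<in> ?L"
      then obtain w where w: "v \<in> ?C1" "w \<in> ?C1" "d v = ?s0 (d w)" by auto
      have "d (v \<ominus>\<^bsub>FF b1\<^esub> ?s1 w) = \<zero>\<^bsub>FF b0\<^esub>"
        using w sc by (simp add: F10.linmap_minus[OF d] linmap_smult[OF d] linmap_closed[OF d]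
            F0.minus_eq_zero_iff)
      then have "v \<ominus>\<^bsub>FF b1\<^esub> ?s1 w \<in> j ` ?M" using w sc by (subst (asm) exact_d) auto
      moreover have "v = (v \<ominus>\<^bsub>FF b1\<^esub> ?s1 w) \<oplus>\<^bsub>FF b1\<^esub> ?s1 w"
        using w sc by (simp add: a_minus_def F1.M.a_assoc F1.M.l_neg)
      ultimately show "v \<in> ?R" using w(2) unfolding F1.mem_set_add by blast
    qed
    show "?R \<subseteq> ?L"
    proof (rule F1.set_add_least)
      show "submodule ?L R (FF b1)" by (rule F10.submodule_vimage[OF d F1.carrier_is_submodule sN])
      show "j ` ?M \<subseteq> ?L" using linmap_closed[OF j] F0.submodule_zero[OF sN] by (auto simp: dj)
      show "?s1 ` ?C1 \<subseteq> ?L" using sc by (auto simp: linmap_smult[OF d])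
    qed
  qed
  have 2: "{x \<in> ?M. j x \<in> ?s1 ` ?C1} = ?sM ` ?M" (is "?L = ?R")
  proof
    show "?L \<subseteq> ?R"
    proof
      fix x assume "x \<in> ?L"
      then obtain v where v: "x \<in> ?M" "v \<in> ?C1" "j x = ?s1 v" by auto
      have "?s0 (d v) = ?s0 \<zero>\<^bsub>FF b0\<^esub>"
        using dj[OF v(1)] v(2,3) sc by (simp add: linmap_smult[OF d])
      then have "d v = \<zero>\<^bsub>FF b0\<^esub>"
        by (rule R.free_module_smult_cancel[OF s linmap_closed[OF d v(2)] F0.M.zero_closed])
      then obtain y where y: "y \<in> ?M" "v = j y" using exact_d[OF v(2)] by auto
      then have "j x = j (?sM y)" using v sc by (simp add: linmap_smult[OF j])
      then have "x = ?sM y" using j_inj v y sc by (simp add: inj_on_def)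
      then show "x \<in> ?R" using y by blast
    qed
    show "?R \<subseteq> ?L" using sc linmap_closed[OF j] by (auto simp: linmap_smult[OF j])
  qed
  have 3: "{v \<in> ?C0. p v \<in> ?sM ` ?M} = ?N <+>\<^bsub>FF b0\<^esub> ?s0 ` ?C0" (is "?L = ?R")
  proof
    show "?L \<subseteq> ?R"
    proof
      fix v assume "v \<in> ?L"
      then obtain x where x: "v \<in> ?C0" "x \<in> ?M" "p v = ?sM x" by auto
      then obtain w where w: "w \<in> ?C0" "x = p w" using p_onto by blast
      have "p (v \<ominus>\<^bsub>FF b0\<^esub> ?s0 w) = \<zero>\<^bsub>M\<^esub>"
        using x w sc by (simp add: F0M.linmap_minus[OF p] linmap_smult[OF p] linmap_closed[OF p]
            minus_eq_zero_iff)
      then have "v \<ominus>\<^bsub>FF b0\<^esub> ?s0 w \<in> ?N" using x w sc by (subst (asm) exact_p) auto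
      moreover have "v = (v \<ominus>\<^bsub>FF b0\<^esub> ?s0 w) \<oplus>\<^bsub>FF b0\<^esub> ?s0 w"
        using x w sc by (simp add: a_minus_def F0.M.a_assoc F0.M.l_neg)
      ultimately show "v \<in> ?R" using w(1) unfolding F0.mem_set_add by blast
    qed
    show "?R \<subseteq> ?L"
    proof (rule F0.set_add_least)
      show "submodule ?L R (FF b0)" by (rule F0M.submodule_vimage[OF p F0.carrier_is_submodule sM])
      show "?N \<subseteq> ?L" using linmap_closed[OF d] submodule_zero[OF sM] by (auto simp: pd)
      show "?s0 ` ?C0 \<subseteq> ?L" using sc linmap_closed[OF p] by (auto simp: linmap_smult[OF p])
    qed
  qed
  have 4: "{v \<in> ?N. v \<in> ?s0 ` ?C0} = ?s0 ` ?N" (is "?L = ?R")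
  proof
    show "?L \<subseteq> ?R"
    proof
      fix v assume "v \<in> ?L"
      then obtain u w where v: "u \<in> ?C1" "v = d u" "w \<in> ?C0" "v = ?s0 w" by auto
      have "?sM (p w) = p (d u)" using linmap_smult[OF p sc v(3)] v(2,4) by simp
      then have "?sM (p w) = ?sM \<zero>\<^bsub>M\<^esub>" using pd[OF v(1)] sc by simp
      then have "p w = \<zero>\<^bsub>M\<^esub>" by (rule smult_cancel[OF s linmap_closed[OF p v(3)] M.zero_closed])
      then have "w \<in> ?N" using exact_p[OF v(3)] by simp
      then show "v \<in> ?R" using v(4) by blast
    qed
    show "?R \<subseteq> ?L" using F0.submodule_smult[OF N sc] linmap_closed[OF d] by blast
  qed
  have id: "linmap R (FF b0) (FF b0) (\<lambda>v. v)" unfolding linmap_def by simp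
  have "mlen R (FF b1) (?s1 ` ?C1) ?C1
    = mlen R (FF b1) (?s1 ` ?C1) (j ` ?M <+>\<^bsub>FF b1\<^esub> ?s1 ` ?C1) + mlen R (FF b1) (j ` ?M <+>\<^bsub>FF b1\<^esub> ?s1 ` ?C1) ?C1"
    by (rule F1.mlen_add[OF s1 F1.submodule_set_add[OF jM s1] F1.carrier_is_submodule
          F1.set_add_upper(2)[OF jM s1] F1.submodule_subset[OF F1.submodule_set_add[OF jM s1]]])
  also have "\<dots> = mlen R M (?sM ` ?M) ?M + mlen R (FF b0) (?s0 ` ?N) ?N"
    using MF1.mlen_vimage[OF j carrier_is_submodule s1] F10.mlen_vimage[OF d F1.carrier_is_submodule sN]
    unfolding 1 2 NN by simp
  also have "\<dots> = mlen R (FF b0) (?s0 ` ?C0) (?N <+>\<^bsub>FF b0\<^esub> ?s0 ` ?C0) + mlen R (FF b0) (?N <+>\<^bsub>FF b0\<^esub> ?s0 ` ?C0) ?C0"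
    using F0M.mlen_vimage[OF p F0.carrier_is_submodule sM] F00.mlen_vimage[OF id N s0]
    unfolding 3 4 p_onto MsM image_ident by (simp add: add.commute)
  also have "\<dots> = mlen R (FF b0) (?s0 ` ?C0) ?C0"
    by (rule F0.mlen_add[symmetric, OF s0 F0.submodule_set_add[OF N s0] F0.carrier_is_submodule
          F0.set_add_upper(2)[OF N s0] F0.submodule_subset[OF F0.submodule_set_add[OF N s0]]])
  finally show ?thesis unfolding c_def FF_colength[OF sc] .
qed

end

text \<open>The image of h \<otimes> v under the canonical map M* \<otimes> N \<rightarrow> Hom(M,
  N). Homomorphisms into a free module of finite rank are sums of such maps, which stands in for the
  isomorphism of M* \<otimes> F0 with Hom(M, F0).\<close>

definition rank_one ::
  "('a, 'b, 'm) module_scheme \<Rightarrow> ('a, 'c, 'n) module_scheme \<Rightarrow> ('b \<Rightarrow> 'a) \<Rightarrow> 'c \<Rightarrow> 'b \<Rightarrow> 'c" where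
  "rank_one M N h v = (\<lambda>y\<in>carrier M. h y \<odot>\<^bsub>N\<^esub> v)"

lemma (in two_modules) rank_one_closed:
  assumes h: "h \<in> mod_hom R A (ring_module (\<lambda>a. a) R)" and v: "v \<in> carrier B"
  shows "rank_one A B h v \<in> mod_hom R A B"
proof -
  have l: "linmap R A (ring_module (\<lambda>a. a) R) h" using h by (simp add: mod_hom_iff)
  have "linmap R A B (\<lambda>y. h y \<odot>\<^bsub>B\<^esub> v)"
    unfolding linmap_def using linmap_closed[OF l] linmap_add[OF l] linmap_smult[OF l] v
    by (simp add: B.smult_l_distr B.smult_assoc1)
  then show ?thesis unfolding rank_one_def by (rule linmap_restrict[OF A.module_axioms])
qed

lemma (in two_modules) rank_one_linmap:
  shows "h \<in> mod_hom R A (ring_module (\<lambda>a. a) R) \<Longrightarrow>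
      linmap R B (hom_module R A B) (rank_one A B h)"
    and "v \<in> carrier B \<Longrightarrow>
      linmap R (hom_module R A (ring_module (\<lambda>a. a) R)) (hom_module R A B) (\<lambda>h. rank_one A B h v)"
proof -
  have hc: "h y \<in> carrier R" if "h \<in> mod_hom R A (ring_module (\<lambda>a. a) R)" "y \<in> carrier A" for h y
    using that linmap_closed[of R A "ring_module (\<lambda>a. a) R" h y] by (simp add: mod_hom_iff)
  show "linmap R B (hom_module R A B) (rank_one A B h)"
    if h: "h \<in> mod_hom R A (ring_module (\<lambda>a. a) R)"
    unfolding linmap_def
  proof (intro conjI ballI funcsetI)
    show "rank_one A B h v \<in> carrier (hom_module R A B)" if "v \<in> carrier B" for v
      using rank_one_closed[OF h that] by simp
    show "rank_one A B h (v \<oplus>\<^bsub>B\<^esub> w) = rank_one A B h v \<oplus>\<^bsub>hom_module R A B\<^esub> rank_one A B h w"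
      if "v \<in> carrier B" "w \<in> carrier B" for v w
      using that hc[OF h] by (auto simp: rank_one_def B.smult_r_distr intro!: restrict_ext)
    show "rank_one A B h (a \<odot>\<^bsub>B\<^esub> v) = a \<odot>\<^bsub>hom_module R A B\<^esub> rank_one A B h v"
      if "a \<in> carrier R" "v \<in> carrier B" for a v
      using that hc[OF h]
      by (auto simp: rank_one_def B.smult_assoc1[symmetric] A.R.m_comm intro!: restrict_ext)
  qed
  show "linmap R (hom_module R A (ring_module (\<lambda>a. a) R)) (hom_module R A B) (\<lambda>h. rank_one A B h v)"
    if v: "v \<in> carrier B"
    unfolding linmap_def
  proof (intro conjI ballI funcsetI)
    fix h assume "h \<in> carrier (hom_module R A (ring_module (\<lambda>a. a) R))"
    then have h: "h \<in> mod_hom R A (ring_module (\<lambda>a. a) R)" by simp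
    show "rank_one A B h v \<in> carrier (hom_module R A B)" using rank_one_closed[OF h v] by simp
    show "rank_one A B (h \<oplus>\<^bsub>hom_module R A (ring_module (\<lambda>a. a) R)\<^esub> h') v
        = rank_one A B h v \<oplus>\<^bsub>hom_module R A B\<^esub> rank_one A B h' v"
      if "h' \<in> carrier (hom_module R A (ring_module (\<lambda>a. a) R))" for h'
      using that v hc[OF h] hc[of h'] by (auto simp: rank_one_def B.smult_l_distr intro!: restrict_ext)
    show "rank_one A B (a \<odot>\<^bsub>hom_module R A (ring_module (\<lambda>a. a) R)\<^esub> h) v
        = a \<odot>\<^bsub>hom_module R A B\<^esub> rank_one A B h v"
      if "a \<in> carrier R" for a
      using that v hc[OF h] by (auto simp: rank_one_def B.smult_assoc1 intro!: restrict_ext)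
  qed
qed

text \<open>\<open>\<phi>\<close> and \<open>\<xi>\<close> become inverse isomorphisms, up to a unit, over the total ring of fractions.\<close>

locale ranked_periodic_module = periodic_module +
  fixes r :: nat and s \<phi> \<xi>
  assumes s: "s \<in> nonzerodivisors R"
    and \<phi>: "linmap R M (free_module R {..<r}) \<phi>" and \<xi>: "linmap R (free_module R {..<r}) M \<xi>"
    and \<xi>\<phi>: "\<And>x. x \<in> carrier M \<Longrightarrow> \<xi> (\<phi> x) = s \<odot>\<^bsub>M\<^esub> x"
    and \<phi>\<xi>: "\<And>v. v \<in> carrier (free_module R {..<r}) \<Longrightarrow> \<phi> (\<xi> v) = s \<odot>\<^bsub>free_module R {..<r}\<^esub> v"
begin

abbreviation (input) Y where "Y \<equiv> dual R M"
abbreviation (input) T where "T \<equiv> tensor_module R M (dual R M)"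
abbreviation (input) HH where "HH n \<equiv> hom_module R M (FF n)"

lemma s_closed: "s \<in> carrier R"
  using s by (rule R.nonzerodivisors_closed)

lemma Y_module: "module R Y"
  unfolding dual_def by (rule two_modules.hom_module_module[OF FF_two_modules(5)])

lemma HH_module: "module R (HH n)"
  by (rule two_modules.hom_module_module[OF FF_two_modules(2)])

lemma coord_linmap: "i < n \<Longrightarrow> linmap R (HH n) Y (\<lambda>f. \<lambda>x\<in>carrier M. f x i)"
  unfolding dual_def by (rule linmap_restrict_comp[OF module_axioms R.linmap_coord]) simp

lemma Y_linmap: "h \<in> carrier Y \<Longrightarrow> linmap R M self h"
  by (simp add: dual_def mod_hom_iff)

subsection \<open>Torsion-freeness and lifting\<close>

text \<open>The map p \<otimes> id from F0 \<otimes> M* to M \<otimes> M*, with its source read as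
  Hom(M, F0): f corresponds to the sum of the e_i \<otimes> f_i, where the coordinate f_i is a
  functional on \<open>M\<close>.\<close>

definition tensor_of where
  "tensor_of f = (\<Oplus>\<^bsub>T\<^esub>i\<in>{..<b0}. tens R M Y (p (free_gen R {..<b0} i)) (\<lambda>x\<in>carrier M. f x i))"

lemma tensor_of_linmap: "linmap R (HH b0) T tensor_of"
proof -
  interpret MY: two_modules R M Y by (simp add: two_modules_def module_axioms Y_module)
  interpret HT: two_modules R "HH b0" T
    by (simp add: two_modules_def HH_module MY.tensor_module_module)
  have "linmap R (HH b0) T (\<lambda>f. \<Oplus>\<^bsub>T\<^esub>i\<in>{..<b0}. tens R M Y (p (free_gen R {..<b0} i)) (\<lambda>x\<in>carrier M. f x i))"
    by (rule HT.linmap_finsum_maps)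
      (auto intro!: linmap_comp[OF coord_linmap MY.tens_linmap_right] linmap_closed[OF p] R.free_gen_closed
        simp del: free_module_simps)
  then show ?thesis by (simp add: tensor_of_def[abs_def])
qed

text \<open>The coordinates of the rank-one map are v_i h; the scalars v_i move across the tensor
  sign and reassemble p(v). In particular rank-one maps with values in ker p go to zero.\<close>

lemma tensor_of_rank_one:
  assumes h: "h \<in> carrier Y" and v: "v \<in> carrier (FF b0)"
  shows "tensor_of (rank_one M (FF b0) h v) = tens R M Y (p v) h"
proof -
  interpret MY: two_modules R M Y by (simp add: two_modules_def module_axioms Y_module)
  interpret T: module R T by (rule MY.tensor_module_module)
  interpret MT: two_modules R M T by (simp add: two_modules_def module_axioms T.module_axioms)
  note hl = Y_linmap[OF h]
  have hc: "h x \<in> carrier R" if "x \<in> carrier M" for x using linmap_closed[OF hl that] by simp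
  have pe: "p (free_gen R {..<b0} i) \<in> carrier M" for i
    by (rule linmap_closed[OF p R.free_gen_closed])
  have vi: "v i \<in> carrier R" if "i < b0" for i using R.free_module_closed[OF v] that by simp
  have coord: "(\<lambda>x\<in>carrier M. rank_one M (FF b0) h v x i) = v i \<odot>\<^bsub>Y\<^esub> h" if i: "i < b0" for i
    using i hc vi[OF i] by (auto simp: rank_one_def dual_def R.m_comm intro!: restrict_ext)
  have "tensor_of (rank_one M (FF b0) h v)
    = (\<Oplus>\<^bsub>T\<^esub>i\<in>{..<b0}. tens R M Y (v i \<odot>\<^bsub>M\<^esub> p (free_gen R {..<b0} i)) h)"
    unfolding tensor_of_def using pe vi h
    by (intro T.M.finsum_cong')
      (auto simp: coord MY.tens_smult_right MY.tens_smult_left MY.tens_closed)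
  also have "\<dots> = tens R M Y (\<Oplus>\<^bsub>M\<^esub>i\<in>{..<b0}. v i \<odot>\<^bsub>M\<^esub> p (free_gen R {..<b0} i)) h"
    using pe vi by (intro MT.linmap_finsum[OF MY.tens_linmap_left[OF h], symmetric]) auto
  also have "\<dots> = tens R M Y (p v) h" by (simp only: linmap_free_expand[OF p v])
  finally show ?thesis .
qed

lemma mod_hom_expand:
  assumes f: "f \<in> carrier (HH n)"
  shows "f = (\<Oplus>\<^bsub>HH n\<^esub>i\<in>{..<n}. rank_one M (FF n) (\<lambda>x\<in>carrier M. f x i) (free_gen R {..<n} i))"
proof -
  interpret F: module R "FF n" by (rule FF_module)
  interpret H: module R "HH n" by (rule HH_module)
  interpret M_F: two_modules R M "FF n" by (rule FF_two_modules)
  interpret HF: two_modules R "HH n" "FF n" by (simp add: two_modules_def HH_module FF_module)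
  let ?g = "\<lambda>i. rank_one M (FF n) (\<lambda>x\<in>carrier M. f x i) (free_gen R {..<n} i)"
  have g: "?g \<in> {..<n} \<rightarrow> carrier (HH n)"
    using M_F.rank_one_closed[OF _ R.free_gen_closed] linmap_closed[OF coord_linmap f]
    by (auto simp: dual_def simp del: free_module_simps)
  have id: "linmap R (FF n) (FF n) (\<lambda>v. v)" unfolding linmap_def by simp
  show ?thesis
  proof (rule M_F.mod_hom_eqI)
    show "f \<in> mod_hom R M (FF n)" using f by simp
    show "(\<Oplus>\<^bsub>HH n\<^esub>i\<in>{..<n}. ?g i) \<in> mod_hom R M (FF n)" using H.M.finsum_closed[OF g] by simp
    fix x assume x: "x \<in> carrier M"
    have "f x = (\<Oplus>\<^bsub>FF n\<^esub>i\<in>{..<n}. f x i \<odot>\<^bsub>FF n\<^esub> free_gen R {..<n} i)"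
      using F.linmap_free_expand[OF id] linmap_closed[of R M "FF n" f x] f x by (simp add: mod_hom_iff)
    also have "\<dots> = (\<Oplus>\<^bsub>FF n\<^esub>i\<in>{..<n}. ?g i x)" using x by (simp add: rank_one_def)
    also have "\<dots> = (\<Oplus>\<^bsub>HH n\<^esub>i\<in>{..<n}. ?g i) x"
      by (rule HF.linmap_finsum[OF linmap_eval[OF x] _ g, symmetric]) simp
    finally show "f x = (\<Oplus>\<^bsub>HH n\<^esub>i\<in>{..<n}. ?g i) x" .
  qed
qed

text \<open>Since \<open>s f = \<Sum> \<phi>\<^sub>k f(\<xi>(e\<^sub>k))\<close> and \<open>p\<close> vanishes on the values of \<open>f\<close>.\<close>

lemma tensor_of_torsion:
  assumes f: "f \<in> carrier (HH b0)" and pf: "\<And>x. x \<in> carrier M \<Longrightarrow> p (f x) = \<zero>\<^bsub>M\<^esub>"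
  shows "s \<odot>\<^bsub>T\<^esub> tensor_of f = \<zero>\<^bsub>T\<^esub>"
proof -
  interpret F: module R "FF b0" by (rule FF_module)
  interpret H: module R "HH b0" by (rule HH_module)
  interpret MY: two_modules R M Y by (simp add: two_modules_def module_axioms Y_module)
  interpret T: module R T by (rule MY.tensor_module_module)
  interpret M_F: two_modules R M "FF b0" by (rule FF_two_modules)
  interpret HF: two_modules R "HH b0" "FF b0" by (simp add: two_modules_def HH_module FF_module)
  interpret HT: two_modules R "HH b0" T by (simp add: two_modules_def HH_module T.module_axioms)
  interpret YT: two_modules R M T by (simp add: two_modules_def module_axioms T.module_axioms)
  have fl: "linmap R M (FF b0) f" using f by (simp add: mod_hom_iff)
  let ?e = "free_gen R {..<r}"
  let ?h = "\<lambda>k. \<lambda>x\<in>carrier M. \<phi> x k"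
  let ?g = "\<lambda>k. rank_one M (FF b0) (?h k) (f (\<xi> (?e k)))"
  note [simp del] = free_module_simps(1)
  have ec: "f (\<xi> (?e k)) \<in> carrier (FF b0)" for k
    by (rule linmap_closed[OF fl linmap_closed[OF \<xi> R.free_gen_closed]])
  have h: "?h k \<in> carrier Y" if "k < r" for k
    using linmap_restrict[OF module_axioms linmap_comp[OF \<phi> R.linmap_coord[of k "{..<r}"]]] that
    by (simp add: dual_def)
  have g: "?g \<in> {..<r} \<rightarrow> carrier (HH b0)"
    using M_F.rank_one_closed[OF _ ec] h by (auto simp: dual_def)
  have "s \<odot>\<^bsub>HH b0\<^esub> f = (\<Oplus>\<^bsub>HH b0\<^esub>k\<in>{..<r}. ?g k)"
  proof (rule M_F.mod_hom_eqI)
    show "s \<odot>\<^bsub>HH b0\<^esub> f \<in> mod_hom R M (FF b0)" using H.smult_closed[OF s_closed f] by simp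
    show "(\<Oplus>\<^bsub>HH b0\<^esub>k\<in>{..<r}. ?g k) \<in> mod_hom R M (FF b0)" using H.M.finsum_closed[OF g] by simp
    fix x assume x: "x \<in> carrier M"
    have "(s \<odot>\<^bsub>HH b0\<^esub> f) x = f (\<xi> (\<phi> x))"
      using x by (simp add: \<xi>\<phi> linmap_smult[OF fl s_closed x])
    also have "\<dots> = (\<Oplus>\<^bsub>FF b0\<^esub>k\<in>{..<r}. \<phi> x k \<odot>\<^bsub>FF b0\<^esub> f (\<xi> (?e k)))"
      by (rule F.linmap_free_expand[OF linmap_comp[OF \<xi> fl] linmap_closed[OF \<phi> x]])
    also have "\<dots> = (\<Oplus>\<^bsub>FF b0\<^esub>k\<in>{..<r}. ?g k x)" using x by (simp add: rank_one_def)
    also have "\<dots> = (\<Oplus>\<^bsub>HH b0\<^esub>k\<in>{..<r}. ?g k) x"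
      by (rule HF.linmap_finsum[OF linmap_eval[OF x] _ g, symmetric]) simp
    finally show "(s \<odot>\<^bsub>HH b0\<^esub> f) x = (\<Oplus>\<^bsub>HH b0\<^esub>k\<in>{..<r}. ?g k) x" .
  qed
  then have "s \<odot>\<^bsub>T\<^esub> tensor_of f = tensor_of (\<Oplus>\<^bsub>HH b0\<^esub>k\<in>{..<r}. ?g k)"
    using linmap_smult[OF tensor_of_linmap s_closed f] by simp
  also have "\<dots> = (\<Oplus>\<^bsub>T\<^esub>k\<in>{..<r}. tensor_of (?g k))"
    by (rule HT.linmap_finsum[OF tensor_of_linmap _ g]) simp
  also have "\<dots> = \<zero>\<^bsub>T\<^esub>"
  proof (rule T.M.add.finprod_one_eqI[simplified])
    fix k assume "k \<in> {..<r}"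
    then have k: "k < r" by simp
    have "tensor_of (?g k) = tens R M Y (p (f (\<xi> (?e k)))) (?h k)"
      by (rule tensor_of_rank_one[OF h[OF k] ec])
    also have "p (f (\<xi> (?e k))) = \<zero>\<^bsub>M\<^esub>"
      by (rule pf[OF linmap_closed[OF \<xi> R.free_gen_closed]])
    also have "tens R M Y \<zero>\<^bsub>M\<^esub> (?h k) = \<zero>\<^bsub>T\<^esub>"
      by (rule YT.linmap_zero[OF MY.tens_linmap_left[OF h[OF k]]])
    finally show "tensor_of (?g k) = \<zero>\<^bsub>T\<^esub>" .
  qed
  finally show ?thesis .
qed

text \<open>Exactness of \<open>N \<otimes> M\<^sup>* \<rightarrow> F\<^sub>0 \<otimes> M\<^sup>* \<rightarrow> M \<otimes> M\<^sup>*\<close> for \<open>N\<close> the image of \<open>d\<close>, with \<open>F\<^sub>0 \<otimes> M\<^sup>*\<close>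
  written as a module of homomorphisms.\<close>

lemma tensor_of_eq_zeroD:
  assumes f: "f \<in> carrier (HH b0)" and tf: "tensor_of f = \<zero>\<^bsub>T\<^esub>"
  obtains g where "g \<in> carrier (HH b1)" "\<And>x. x \<in> carrier M \<Longrightarrow> d (g x) = f x"
proof -
  interpret Y: module R Y by (rule Y_module)
  interpret F: module R "FF b0" by (rule FF_module)
  interpret H: module R "HH b0" by (rule HH_module)
  interpret MY: two_modules R M Y by (simp add: two_modules_def module_axioms Y_module)
  interpret M_F: two_modules R M "FF b0" by (rule FF_two_modules)
  interpret M_F1: two_modules R M "FF b1" by (rule FF_two_modules)
  interpret FM: two_modules R "FF b0" M by (rule FF_two_modules)
  interpret H1: module R "HH b1" by (rule HH_module)
  interpret H10: two_modules R "HH b1" "HH b0" by (simp add: two_modules_def HH_module)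
  interpret FH: two_modules R "FF b0" "HH b0" by (simp add: two_modules_def HH_module FF_module)
  interpret YH: two_modules R Y "HH b0" by (simp add: two_modules_def HH_module Y_module)
  note [simp del] = free_module_simps hom_module_simps
  let ?D = "\<lambda>g. \<lambda>x\<in>carrier M. d (g x)"
  let ?K = "?D ` carrier (HH b1)"
  let ?\<theta> = "rank_one M (FF b0)"
  have D: "linmap R (HH b1) (HH b0) ?D" by (rule linmap_restrict_comp[OF module_axioms d])
  have K: "submodule ?K R (HH b0)" by (rule H10.submodule_image[OF D H1.carrier_is_submodule])
  have \<theta>l: "linmap R (FF b0) (HH b0) (?\<theta> h)" if "h \<in> carrier Y" for h
    using M_F.rank_one_linmap(1)[of h] that by (simp add: dual_def hom_module_simps)
  have \<theta>r: "linmap R Y (HH b0) (\<lambda>h. ?\<theta> h v)" if "v \<in> carrier (FF b0)" for v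
    using M_F.rank_one_linmap(2)[OF that] by (simp add: dual_def)
  note \<theta>c = linmap_closed[OF \<theta>l]
  have \<theta>K: "?\<theta> h v \<in> ?K" if h: "h \<in> carrier Y" and v: "v \<in> carrier (FF b0)" "p v = \<zero>\<^bsub>M\<^esub>" for h v
  proof -
    obtain u where u: "u \<in> carrier (FF b1)" "v = d u" using exact_p[OF v(1)] v(2) by auto
    have "rank_one M (FF b1) h u \<in> carrier (HH b1)"
      using M_F1.rank_one_closed[OF _ u(1), of h] h by (simp add: dual_def hom_module_simps)
    moreover have "?\<theta> h v = ?D (rank_one M (FF b1) h u)"
      using linmap_closed[OF Y_linmap[OF h]] u
      by (auto simp: rank_one_def linmap_smult[OF d] intro!: restrict_ext)
    ultimately show ?thesis by blast
  qed
  \<comment> \<open>A set-theoretic section of \<open>p\<close>, in general not linear. Its additive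
    and scalar defects lie in ker p, and rank-one maps with values there lift to F1. So
    \<open>?\<beta>\<close> is bilinear modulo \<open>?K\<close>, and
    \<open>tensor_universal\<close> provides a map from M \<otimes> M* back to Hom(M, F0) modulo
    \<open>?K\<close>.\<close>
  define \<sigma> where "\<sigma> = inv_into (carrier (FF b0)) p"
  have \<sigma>: "\<sigma> x \<in> carrier (FF b0)" "p (\<sigma> x) = x" if "x \<in> carrier M" for x
    unfolding \<sigma>_def using that p_onto by (simp_all add: inv_into_into f_inv_into_f)
  let ?\<beta> = "\<lambda>x h. ?\<theta> h (\<sigma> x)"
  have univ: "free_ext R (HH b0) (carrier M \<times> carrier Y) (\<lambda>(x, h). ?\<beta> x h) t \<in> ?K"
    if t: "t \<in> tensor_ker R M Y" for t
  proof (rule MY.tensor_universal[OF HH_module K _ _ _ _ _ t])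
    fix x h assume x: "x \<in> carrier M" and h: "h \<in> carrier Y"
    show "?\<beta> x h \<in> carrier (HH b0)" by (rule \<theta>c[OF h \<sigma>(1)[OF x]])
    show "?\<beta> (x \<oplus>\<^bsub>M\<^esub> x') h \<ominus>\<^bsub>HH b0\<^esub> (?\<beta> x h \<oplus>\<^bsub>HH b0\<^esub> ?\<beta> x' h) \<in> ?K" if x': "x' \<in> carrier M" for x'
    proof -
      have "?\<beta> (x \<oplus>\<^bsub>M\<^esub> x') h \<ominus>\<^bsub>HH b0\<^esub> (?\<beta> x h \<oplus>\<^bsub>HH b0\<^esub> ?\<beta> x' h)
        = ?\<theta> h (\<sigma> (x \<oplus>\<^bsub>M\<^esub> x') \<ominus>\<^bsub>FF b0\<^esub> (\<sigma> x \<oplus>\<^bsub>FF b0\<^esub> \<sigma> x'))"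
        using x x' \<sigma>(1) by (simp add: FH.linmap_minus[OF \<theta>l[OF h]] linmap_add[OF \<theta>l[OF h]])
      also have "\<dots> \<in> ?K"
        using x x' \<sigma> by (intro \<theta>K h)
          (simp_all add: FM.linmap_minus[OF p] linmap_add[OF p] minus_eq_zero_iff)
      finally show ?thesis .
    qed
    show "?\<beta> (a \<odot>\<^bsub>M\<^esub> x) h \<ominus>\<^bsub>HH b0\<^esub> a \<odot>\<^bsub>HH b0\<^esub> ?\<beta> x h \<in> ?K" if a: "a \<in> carrier R" for a
    proof -
      have "?\<beta> (a \<odot>\<^bsub>M\<^esub> x) h \<ominus>\<^bsub>HH b0\<^esub> a \<odot>\<^bsub>HH b0\<^esub> ?\<beta> x h
        = ?\<theta> h (\<sigma> (a \<odot>\<^bsub>M\<^esub> x) \<ominus>\<^bsub>FF b0\<^esub> a \<odot>\<^bsub>FF b0\<^esub> \<sigma> x)"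
        using x a \<sigma>(1) by (simp add: FH.linmap_minus[OF \<theta>l[OF h]] linmap_smult[OF \<theta>l[OF h]])
      also have "\<dots> \<in> ?K"
        using x a \<sigma> by (intro \<theta>K h)
          (simp_all add: FM.linmap_minus[OF p] linmap_smult[OF p] minus_eq_zero_iff)
      finally show ?thesis .
    qed
    show "?\<beta> x (h \<oplus>\<^bsub>Y\<^esub> h') \<ominus>\<^bsub>HH b0\<^esub> (?\<beta> x h \<oplus>\<^bsub>HH b0\<^esub> ?\<beta> x h') \<in> ?K" if "h' \<in> carrier Y" for h'
      using H.submodule_zero[OF K] x h that \<sigma>(1) linmap_closed[OF \<theta>r]
      by (simp add: linmap_add[OF \<theta>r] a_minus_def H.M.r_neg)
    show "?\<beta> x (a \<odot>\<^bsub>Y\<^esub> h) \<ominus>\<^bsub>HH b0\<^esub> a \<odot>\<^bsub>HH b0\<^esub> ?\<beta> x h \<in> ?K" if "a \<in> carrier R" for a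
      using H.submodule_zero[OF K] x h that \<sigma>(1) linmap_closed[OF \<theta>r]
      by (simp add: linmap_smult[OF \<theta>r] a_minus_def H.M.r_neg)
  qed
  let ?X = "carrier M \<times> carrier Y"
  interpret FX: module R "free_module R ?X" by (rule R.free_module_module)
  interpret FXH: two_modules R "free_module R ?X" "HH b0"
    by (simp add: two_modules_def HH_module FX.module_axioms)
  interpret FXT: two_modules R "free_module R ?X" T
    by (simp add: two_modules_def MY.tensor_module_module FX.module_axioms)
  define f' where "f' i = (\<lambda>x\<in>carrier M. f x i)" for i
  have f': "f' i \<in> carrier Y" if "i < b0" for i
    unfolding f'_def by (rule linmap_closed[OF coord_linmap[OF that] f])
  let ?e = "free_gen R {..<b0}"
  have e: "?e i \<in> carrier (FF b0)" for i by (rule R.free_gen_closed)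
  note pe = linmap_closed[OF p e]
  let ?E = "\<lambda>i. free_gen R ?X (p (?e i), f' i)"
  \<comment> \<open>A formal sum that represents \<open>tensor_of f\<close>. As
    \<open>tensor_of f\<close> vanishes, it lies in \<open>tensor_ker\<close>, so the linear
    extension of \<open>?\<beta>\<close> sends it into \<open>?K\<close>.\<close>
  let ?t = "\<Oplus>\<^bsub>free_module R ?X\<^esub>i\<in>{..<b0}. ?E i"
  have E: "?E \<in> {..<b0} \<rightarrow> carrier (free_module R ?X)" by (rule Pi_I) (rule R.free_gen_closed)
  have tc: "?t \<in> carrier (free_module R ?X)" by (rule FX.M.finsum_closed[OF E])
  have "tensor_ker R M Y +>\<^bsub>free_module R ?X\<^esub> ?t = tensor_of f"
    unfolding tensor_of_def FXT.linmap_finsum[OF MY.tensor_proj_linmap finite_lessThan E]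
    by (simp add: tens_def f'_def)
  then have "?t \<in> tensor_ker R M Y" using MY.tensor_proj_eq_zero_iff[OF tc] tf by simp
  then have tK: "free_ext R (HH b0) ?X (\<lambda>(x, h). ?\<beta> x h) ?t \<in> ?K" by (rule univ)
  have \<beta>c: "(\<lambda>(x, h). ?\<beta> x h) \<in> ?X \<rightarrow> carrier (HH b0)" using \<theta>c \<sigma>(1) by auto
  have "free_ext R (HH b0) ?X (\<lambda>(x, h). ?\<beta> x h) ?t
      = (\<Oplus>\<^bsub>HH b0\<^esub>i\<in>{..<b0}. free_ext R (HH b0) ?X (\<lambda>(x, h). ?\<beta> x h) (?E i))"
    by (rule FXH.linmap_finsum[OF H.free_ext_linmap[OF \<beta>c] finite_lessThan E])
  also have "\<dots> = (\<Oplus>\<^bsub>HH b0\<^esub>i\<in>{..<b0}. ?\<theta> (f' i) (\<sigma> (p (?e i))))"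
    using H.free_ext_gen[OF \<beta>c] pe f' \<theta>c \<sigma>(1) by (intro H.M.finsum_cong') auto
  finally have 1: "(\<Oplus>\<^bsub>HH b0\<^esub>i\<in>{..<b0}. ?\<theta> (f' i) (\<sigma> (p (?e i)))) \<in> ?K" using tK by simp
  \<comment> \<open>The vectors e_i and \<sigma>(p(e_i)) differ by an element of ker p, so replacing
    one by the other changes \<open>f\<close> only by a member of \<open>?K\<close>.\<close>
  have 2: "(\<Oplus>\<^bsub>HH b0\<^esub>i\<in>{..<b0}. ?\<theta> (f' i) (?e i \<ominus>\<^bsub>FF b0\<^esub> \<sigma> (p (?e i)))) \<in> ?K"
    using f' e pe \<sigma>
    by (intro H.submodule_finsum[OF K] \<theta>K) (simp_all add: FM.linmap_minus[OF p] minus_eq_zero_iff)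
  have "f = (\<Oplus>\<^bsub>HH b0\<^esub>i\<in>{..<b0}. ?\<theta> (f' i) (?e i))"
    using mod_hom_expand[OF f] by (simp add: f'_def)
  also have "\<dots> = (\<Oplus>\<^bsub>HH b0\<^esub>i\<in>{..<b0}. ?\<theta> (f' i) (?e i \<ominus>\<^bsub>FF b0\<^esub> \<sigma> (p (?e i))) \<oplus>\<^bsub>HH b0\<^esub> ?\<theta> (f' i) (\<sigma> (p (?e i))))"
  proof (rule H.M.finsum_cong'[OF refl])
    show "(\<lambda>i. ?\<theta> (f' i) (?e i \<ominus>\<^bsub>FF b0\<^esub> \<sigma> (p (?e i))) \<oplus>\<^bsub>HH b0\<^esub> ?\<theta> (f' i) (\<sigma> (p (?e i)))) \<in> {..<b0} \<rightarrow> carrier (HH b0)"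
      using f' e pe \<sigma> \<theta>c by auto
    fix i assume "i \<in> {..<b0}"
    then show "?\<theta> (f' i) (?e i) = ?\<theta> (f' i) (?e i \<ominus>\<^bsub>FF b0\<^esub> \<sigma> (p (?e i))) \<oplus>\<^bsub>HH b0\<^esub> ?\<theta> (f' i) (\<sigma> (p (?e i)))"
      using f'[of i] e pe \<sigma>(1) linmap_add[OF \<theta>l[OF f'[of i]], symmetric]
      by (simp add: a_minus_def F.M.a_assoc F.M.l_neg)
  qed
  also have "\<dots> = (\<Oplus>\<^bsub>HH b0\<^esub>i\<in>{..<b0}. ?\<theta> (f' i) (?e i \<ominus>\<^bsub>FF b0\<^esub> \<sigma> (p (?e i)))) \<oplus>\<^bsub>HH b0\<^esub> (\<Oplus>\<^bsub>HH b0\<^esub>i\<in>{..<b0}. ?\<theta> (f' i) (\<sigma> (p (?e i))))"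
    using f' e pe \<sigma>(1) \<theta>c by (intro H.M.finsum_addf) auto
  also have "\<dots> \<in> ?K" by (rule H.submodule_add[OF K 2 1])
  finally obtain g where g: "g \<in> carrier (HH b1)" "f = ?D g" by auto
  show ?thesis by (rule that[OF g(1)]) (simp add: g(2))
qed

end

context ranked_periodic_module
begin

subsection \<open>Splitting\<close>

text \<open>The homomorphisms that factor through \<open>\<phi>\<close>: those whose composition with \<open>\<xi>\<close> is divisible
  by \<open>s\<close>.\<close>

definition Y' where
  "Y' = {h \<in> carrier Y. (\<lambda>k\<in>{..<r}. h (\<xi> (free_gen R {..<r} k)))
     \<in> (\<lambda>v. s \<odot>\<^bsub>FF r\<^esub> v) ` carrier (FF r)}"

definition HH' where
  "HH' n = {f \<in> carrier (HH n). \<forall>i<n. (\<lambda>x\<in>carrier M. f x i) \<in> Y'}"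

text \<open>If h \<xi> = s v, then s h = h \<xi> \<phi> = s v \<phi>, and s cancels; if h = w
  \<phi>, then h \<xi> = w \<phi> \<xi> = s w. Divisibility exhibits \<open>Y'\<close> as a preimage
  of s R^r, which suits the count of lengths, while the factorization suits composition.\<close>

lemma Y'_iff:
  assumes h: "h \<in> carrier Y"
  shows "h \<in> Y' \<longleftrightarrow> (\<exists>w. linmap R (FF r) self w \<and> (\<forall>x\<in>carrier M. h x = w (\<phi> x)))"
proof
  interpret S: module R self by (rule R.self_module)
  interpret F: module R "FF r" by (rule FF_module)
  note hl = Y_linmap[OF h]
  let ?e = "free_gen R {..<r}"
  note [simp del] = free_module_simps(1)
  note e = R.free_gen_closed[of "{..<r}"]
  {
    assume "h \<in> Y'"
    then obtain v where v: "v \<in> carrier (FF r)"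
      and hv: "(\<lambda>k\<in>{..<r}. h (\<xi> (?e k))) = s \<odot>\<^bsub>FF r\<^esub> v" unfolding Y'_def by blast
    have hvk: "h (\<xi> (?e k)) = s \<otimes> v k" if "k \<in> {..<r}" for k using fun_cong[OF hv, of k] that by simp
    have vc: "v \<in> {..<r} \<rightarrow> carrier self" using R.free_module_closed[OF v] by auto
    let ?w = "free_ext R self {..<r} v"
    have w: "linmap R (FF r) self ?w" by (rule S.free_ext_linmap[OF vc])
    have eq: "h (\<xi> u) = s \<odot>\<^bsub>self\<^esub> ?w u" if "u \<in> carrier (FF r)" for u
      by (rule R.linmap_free_eq[OF R.self_module linmap_comp[OF \<xi> hl]
            linmap_comp[OF w S.linmap_self_smult[OF s_closed]] _ that])
        (simp add: S.free_ext_gen[OF vc] hvk)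
    have "h x = ?w (\<phi> x)" if x: "x \<in> carrier M" for x
    proof -
      have "s \<otimes> h x = h (\<xi> (\<phi> x))" using linmap_smult[OF hl s_closed x] by (simp add: \<xi>\<phi>[OF x])
      also have "\<dots> = s \<otimes> ?w (\<phi> x)" using eq[OF linmap_closed[OF \<phi> x]] by simp
      finally have "s \<otimes> h x = s \<otimes> ?w (\<phi> x)" .
      then show ?thesis
        by (rule R.nonzerodivisors_cancel[OF s, rotated 2])
          (use linmap_closed[OF hl x] linmap_closed[OF w linmap_closed[OF \<phi> x]] in simp_all)
    qed
    then show "\<exists>w. linmap R (FF r) self w \<and> (\<forall>x\<in>carrier M. h x = w (\<phi> x))" using w by blast
  }
  assume "\<exists>w. linmap R (FF r) self w \<and> (\<forall>x\<in>carrier M. h x = w (\<phi> x))"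
  then obtain w where w: "linmap R (FF r) self w" "\<And>x. x \<in> carrier M \<Longrightarrow> h x = w (\<phi> x)" by blast
  have "h (\<xi> (?e k)) = s \<otimes> w (?e k)" for k
    using w(2)[OF linmap_closed[OF \<xi> e]] linmap_smult[OF w(1) s_closed e] by (simp add: \<phi>\<xi>[OF e])
  then have "(\<lambda>k\<in>{..<r}. h (\<xi> (?e k))) = s \<odot>\<^bsub>FF r\<^esub> (\<lambda>k\<in>{..<r}. w (?e k))"
    by (auto intro!: restrict_ext)
  moreover have "(\<lambda>k\<in>{..<r}. w (?e k)) \<in> carrier (FF r)"
    using linmap_closed[OF w(1) e] by (intro R.free_module_restrict) auto
  ultimately show "h \<in> Y'" unfolding Y'_def using h by blast
qed

lemma HH'_iff:
  assumes f: "f \<in> carrier (HH n)"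
  shows "f \<in> HH' n \<longleftrightarrow> (\<exists>w. linmap R (FF r) (FF n) w \<and> (\<forall>x\<in>carrier M. f x = w (\<phi> x)))"
proof
  have fl: "linmap R M (FF n) f" using f by (simp add: mod_hom_iff)
  note [simp del] = free_module_simps(1)
  have fc: "(\<lambda>x\<in>carrier M. f x i) \<in> carrier Y" if "i < n" for i
    by (rule linmap_closed[OF coord_linmap[OF that] f])
  {
    assume "f \<in> HH' n"
    then have "\<forall>i. \<exists>w. i < n \<longrightarrow> linmap R (FF r) self w \<and> (\<forall>x\<in>carrier M. f x i = w (\<phi> x))"
      using Y'_iff[OF fc] unfolding HH'_def by simp
    then obtain w where w: "\<And>i. i < n \<Longrightarrow> linmap R (FF r) self (w i)"
      "\<And>i x. i < n \<Longrightarrow> x \<in> carrier M \<Longrightarrow> f x i = w i (\<phi> x)" by metis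
    have wc: "w i u \<in> carrier R" if "i < n" "u \<in> carrier (FF r)" for i u
      using linmap_closed[OF w(1)] that by simp
    interpret F: module R "FF r" by (rule FF_module)
    have "linmap R (FF r) (FF n) (\<lambda>u. \<lambda>i\<in>{..<n}. w i u)"
      unfolding linmap_def
      using linmap_add[OF w(1)] linmap_smult[OF w(1)]
      by (auto intro!: R.free_module_restrict restrict_ext wc)
    moreover have "f x = (\<lambda>i\<in>{..<n}. w i (\<phi> x))" if x: "x \<in> carrier M" for x
    proof (rule R.free_module_eqI[OF linmap_closed[OF fl x]])
      show "(\<lambda>i\<in>{..<n}. w i (\<phi> x)) \<in> carrier (FF n)"
        using wc linmap_closed[OF \<phi> x] by (intro R.free_module_restrict) auto
    qed (simp add: w(2) x)
    ultimately show "\<exists>w. linmap R (FF r) (FF n) w \<and> (\<forall>x\<in>carrier M. f x = w (\<phi> x))"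
      by (intro exI[of _ "\<lambda>u. \<lambda>i\<in>{..<n}. w i u"]) simp
  }
  assume "\<exists>w. linmap R (FF r) (FF n) w \<and> (\<forall>x\<in>carrier M. f x = w (\<phi> x))"
  then obtain w where w: "linmap R (FF r) (FF n) w" "\<And>x. x \<in> carrier M \<Longrightarrow> f x = w (\<phi> x)" by blast
  have "(\<lambda>x\<in>carrier M. f x i) \<in> Y'" if i: "i < n" for i
    unfolding Y'_iff[OF fc[OF i]]
    by (rule exI[of _ "\<lambda>u. w u i"]) (use linmap_comp[OF w(1) R.linmap_coord] i w(2) in auto)
  then show "f \<in> HH' n" unfolding HH'_def using f by simp
qed

text \<open>Evaluation at the vectors \<xi>(e_k) embeds M*/Y' into R^r/sR^r, because
  \<open>Y'\<close> is the preimage of s R^r. An upper bound is enough: the length of M*/Y' only has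
  to be finite, and zero when s is a unit.\<close>

lemma Y'_submodule: "submodule Y' R Y"
  and Y'_colength: "mlen R Y Y' (carrier Y)
    \<le> of_nat r * mlen R self ((\<lambda>x. s \<otimes> x) ` carrier R) (carrier R)"
proof -
  interpret Y: module R Y by (rule Y_module)
  interpret F: module R "FF r" by (rule FF_module)
  interpret YF: two_modules R Y "FF r" by (simp add: two_modules_def Y_module FF_module)
  interpret FFr: two_modules R "FF r" "FF r" by (rule FF_two_modules)
  note [simp del] = free_module_simps(1)
  let ?\<Theta> = "\<lambda>h. \<lambda>k\<in>{..<r}. h (\<xi> (free_gen R {..<r} k))"
  let ?sF = "(\<lambda>v. s \<odot>\<^bsub>FF r\<^esub> v) ` carrier (FF r)"
  have e: "\<xi> (free_gen R {..<r} k) \<in> carrier M" for k by (rule linmap_closed[OF \<xi> R.free_gen_closed])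
  have \<Theta>: "linmap R Y (FF r) ?\<Theta>"
    unfolding linmap_def using linmap_closed[OF Y_linmap e] e
    by (auto intro!: R.free_module_restrict restrict_ext simp: dual_def)
  have sF: "submodule ?sF R (FF r)"
    by (rule FFr.submodule_image[OF F.linmap_self_smult[OF s_closed] F.carrier_is_submodule])
  show "submodule Y' R Y"
    unfolding Y'_def by (rule YF.submodule_vimage[OF \<Theta> Y.carrier_is_submodule sF])
  have im: "submodule (?\<Theta> ` carrier Y) R (FF r)"
    by (rule YF.submodule_image[OF \<Theta> Y.carrier_is_submodule])
  have "mlen R Y Y' (carrier Y) = mlen R (FF r) ?sF (?\<Theta> ` carrier Y <+>\<^bsub>FF r\<^esub> ?sF)"
    unfolding Y'_def by (rule YF.mlen_vimage[OF \<Theta> Y.carrier_is_submodule sF])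
  also have "\<dots> \<le> mlen R (FF r) ?sF (carrier (FF r))"
    by (rule F.mlen_mono[OF order_refl F.submodule_subset[OF F.submodule_set_add[OF im sF]]])
  finally show "mlen R Y Y' (carrier Y)
    \<le> of_nat r * mlen R self ((\<lambda>x. s \<otimes> x) ` carrier R) (carrier R)"
    unfolding FF_colength[OF s_closed] .
qed

text \<open>In coordinates the quotient is (M*/Y')^n. The rank-one map of h and e_i has i-th
  coordinate h and all others zero, which is the independence that \<open>mlen_coords\<close>
  requires.\<close>

lemma HH'_submodule: "submodule (HH' n) R (HH n)"
  and HH'_colength: "mlen R (HH n) (HH' n) (carrier (HH n)) = of_nat n * mlen R Y Y' (carrier Y)"
proof -
  interpret HY: two_modules R "HH n" Y by (simp add: two_modules_def Y_module HH_module)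
  interpret M_F: two_modules R M "FF n" by (rule FF_two_modules)
  have surj: "\<exists>f\<in>carrier (HH n). (\<lambda>x\<in>carrier M. f x i) = h \<and>
      (\<forall>k<n. k \<noteq> i \<longrightarrow> (\<lambda>x\<in>carrier M. f x k) = \<zero>\<^bsub>Y\<^esub>)"
    if i: "i < n" and h: "h \<in> carrier Y" for i h
  proof (intro bexI[of _ "rank_one M (FF n) h (free_gen R {..<n} i)"] conjI allI impI)
    have hc: "h x \<in> carrier R" if "x \<in> carrier M" for x using linmap_closed[OF Y_linmap[OF h] that] by simp
    have hx: "h \<in> extensional (carrier M)" using h by (simp add: dual_def mod_hom_iff)
    show "rank_one M (FF n) h (free_gen R {..<n} i) \<in> carrier (HH n)"
      using M_F.rank_one_closed[OF _ R.free_gen_closed] h by (simp add: dual_def)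
    have "(\<lambda>x\<in>carrier M. rank_one M (FF n) h (free_gen R {..<n} i) x i) = restrict h (carrier M)"
      using i hc by (auto simp: rank_one_def free_gen_apply intro!: restrict_ext)
    then show "(\<lambda>x\<in>carrier M. rank_one M (FF n) h (free_gen R {..<n} i) x i) = h"
      using hx by (simp add: extensional_restrict)
    show "(\<lambda>x\<in>carrier M. rank_one M (FF n) h (free_gen R {..<n} i) x k) = \<zero>\<^bsub>Y\<^esub>"
      if "k < n" "k \<noteq> i" for k
      using that hc by (auto simp: rank_one_def free_gen_apply dual_def intro!: restrict_ext)
  qed
  show "submodule (HH' n) R (HH n)"
    unfolding HH'_def by (rule HY.mlen_coords(1)[OF coord_linmap Y'_submodule surj])
  show "mlen R (HH n) (HH' n) (carrier (HH n)) = of_nat n * mlen R Y Y' (carrier Y)"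
    unfolding HH'_def by (rule HY.mlen_coords(2)[OF coord_linmap Y'_submodule surj])
qed

text \<open>The image of \<phi> contains s R^r, so d w vanishes after multiplication by s, and s
  cancels in F0. Thus \<open>w\<close> takes values in ker d = j(p(F0)) and lifts along j p because
  R^r is free.\<close>

lemma factor_lift:
  assumes w: "linmap R (FF r) (FF b1) w" and "\<And>x. x \<in> carrier M \<Longrightarrow> d (w (\<phi> x)) = \<zero>\<^bsub>FF b0\<^esub>"
  obtains w' where "linmap R (FF r) (FF b0) w'" "\<And>v. v \<in> carrier (FF r) \<Longrightarrow> j (p (w' v)) = w v"
proof -
  interpret F0: module R "FF b0" by (rule FF_module)
  interpret F01: two_modules R "FF b0" "FF b1" by (rule FF_two_modules)
  note dw = linmap_comp[OF w d]
  have "w v \<in> (\<lambda>u. j (p u)) ` carrier (FF b0)" if v: "v \<in> carrier (FF r)" for v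
  proof -
    have "s \<odot>\<^bsub>FF b0\<^esub> d (w v) = d (w (\<phi> (\<xi> v)))"
      using linmap_smult[OF dw s_closed v] by (simp only: \<phi>\<xi>[OF v])
    also have "\<dots> = s \<odot>\<^bsub>FF b0\<^esub> \<zero>\<^bsub>FF b0\<^esub>"
      unfolding assms(2)[OF linmap_closed[OF \<xi> v]] by (rule F0.smult_r_null[OF s_closed, symmetric])
    finally have "d (w v) = \<zero>\<^bsub>FF b0\<^esub>"
      by (rule R.free_module_smult_cancel[OF s linmap_closed[OF dw v] F0.M.zero_closed])
    then have "w v \<in> j ` carrier M" using exact_d[OF linmap_closed[OF w v]] by simp
    then show ?thesis unfolding p_onto[symmetric] by (simp only: image_image)
  qed
  from F01.free_lift[OF w linmap_comp[OF p j] this] show ?thesis using that by blast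
qed

text \<open>Under the lifting property, \<open>j\<close> is a cycle of the complex of the quotients of \<open>Hom(M, F\<^sub>1)\<close>
  and \<open>Hom(M, F\<^sub>0)\<close>; that it is a boundary means that \<open>p\<close> splits.\<close>

lemma splitting_of_lifting:
  assumes noeth: "noetherian_ring R" and dim: "krull_dim R = 1"
    and lift: "\<And>f. f \<in> carrier (HH b0) \<Longrightarrow> (\<And>x. x \<in> carrier M \<Longrightarrow> p (f x) = \<zero>\<^bsub>M\<^esub>) \<Longrightarrow>
      \<exists>g\<in>carrier (HH b1). \<forall>x\<in>carrier M. d (g x) = f x"
  obtains \<sigma> where "linmap R M (FF b0) \<sigma>" "\<And>x. x \<in> carrier M \<Longrightarrow> p (\<sigma> x) = x"
proof -
  interpret F0: module R "FF b0" by (rule FF_module)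
  interpret F1: module R "FF b1" by (rule FF_module)
  interpret H0: module R "HH b0" by (rule HH_module)
  interpret H1: module R "HH b1" by (rule HH_module)
  interpret HH10: two_modules R "HH b1" "HH b0" by (simp add: two_modules_def HH_module)
  interpret MF0: two_modules R M "FF b0" by (rule FF_two_modules)
  interpret MF1: two_modules R M "FF b1" by (rule FF_two_modules)
  note [simp del] = free_module_simps(1)
  let ?D = "\<lambda>g. \<lambda>x\<in>carrier M. d (g x)" and ?E = "\<lambda>f. \<lambda>x\<in>carrier M. j (p (f x))"
  note jp = linmap_comp[OF p j]
  have D: "linmap R (HH b1) (HH b0) ?D" by (rule linmap_restrict_comp[OF module_axioms d])
  have E: "linmap R (HH b0) (HH b1) ?E" by (rule linmap_restrict_comp[OF module_axioms jp])
  have hl: "linmap R M (FF n) f" if "f \<in> carrier (HH n)" for n f using that by (simp add: mod_hom_iff)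
  have dj: "d (j x) = \<zero>\<^bsub>FF b0\<^esub>" if "x \<in> carrier M" for x
    using exact_d[OF linmap_closed[OF j that]] that by blast
  have pd: "p (d v) = \<zero>\<^bsub>M\<^esub>" if "v \<in> carrier (FF b1)" for v
    using exact_p[OF linmap_closed[OF d that]] that by blast
  have j0: "j \<zero>\<^bsub>M\<^esub> = \<zero>\<^bsub>FF b1\<^esub>" by (rule MF1.linmap_zero[OF j])
  have zero: "(\<lambda>x\<in>carrier M. \<zero>\<^bsub>FF n\<^esub>) \<in> HH' n" for n
    using module.submodule_zero[OF HH_module HH'_submodule] by simp
  let ?c = "mlen R self ((\<lambda>x. s \<otimes> x) ` carrier R) (carrier R)" and ?l = "mlen R Y Y' (carrier Y)"
  have c: "?c \<noteq> \<infinity>" by (rule R.finite_colength[OF noeth dim s])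
  have l: "?l \<noteq> \<infinity>" using Y'_colength c by (cases ?c; cases ?l) (auto simp: of_nat_eq_enat)
  \<comment> \<open>If R/sR has length 0, then so has M*/Y' by \<open>Y'_colength\<close>; otherwise
    the finite non-zero length cancels in \<open>rank_balance\<close>, and the two ranks
    agree.\<close>
  have "of_nat b1 * ?l = of_nat b0 * ?l"
  proof (cases "?c = 0")
    case True
    then show ?thesis using Y'_colength by simp
  next
    case False
    then have "b1 = b0" using rank_balance[OF s] c by (cases ?c) (auto simp: of_nat_eq_enat zero_enat_def)
    then show ?thesis by simp
  qed
  then have len: "mlen R (HH b1) (HH' b1) (carrier (HH b1)) = mlen R (HH b0) (HH' b0) (carrier (HH b0))"
    by (simp only: HH'_colength)
  have fin: "mlen R (HH b1) (HH' b1) (carrier (HH b1)) \<noteq> \<infinity>"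
    unfolding HH'_colength using l by (cases ?l) (auto simp: of_nat_eq_enat)
  define \<iota> where "\<iota> = (\<lambda>x\<in>carrier M. j x)"
  have \<iota>: "\<iota> \<in> carrier (HH b1)" unfolding \<iota>_def using linmap_restrict[OF module_axioms j] by simp
  \<comment> \<open>Hom(M, F1) plays the role of \<open>A\<close>: exactness is needed at Hom(M,
    F0), where it comes from \<open>lift\<close>, and is obtained at Hom(M, F1) for the cycle j,
    which satisfies d j = 0.\<close>
  have "\<iota> \<in> ?E ` carrier (HH b0) <+>\<^bsub>HH b1\<^esub> HH' b1"
  proof (rule HH10.herbrand[OF D E HH'_submodule HH'_submodule _ _ _ _ len fin _ \<iota>])
    show "?D g \<in> HH' b0" if g: "g \<in> HH' b1" for g
    proof -
      have gc: "g \<in> carrier (HH b1)" by (rule H1.submodule_mem[OF HH'_submodule g])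
      obtain w where w: "linmap R (FF r) (FF b1) w" "\<And>x. x \<in> carrier M \<Longrightarrow> g x = w (\<phi> x)"
        using g unfolding HH'_iff[OF gc] by blast
      show ?thesis unfolding HH'_iff[OF linmap_closed[OF D gc]]
        by (rule exI[of _ "\<lambda>v. d (w v)"]) (simp add: linmap_comp[OF w(1) d] w(2))
    qed
    show "?E f \<in> HH' b1" if f: "f \<in> HH' b0" for f
    proof -
      have fc: "f \<in> carrier (HH b0)" by (rule H0.submodule_mem[OF HH'_submodule f])
      obtain w where w: "linmap R (FF r) (FF b0) w" "\<And>x. x \<in> carrier M \<Longrightarrow> f x = w (\<phi> x)"
        using f unfolding HH'_iff[OF fc] by blast
      show ?thesis unfolding HH'_iff[OF linmap_closed[OF E fc]]
        by (rule exI[of _ "\<lambda>v. j (p (w v))"]) (simp add: linmap_comp[OF w(1) jp] w(2))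
    qed
    show "?D (?E f) \<in> HH' b0" if f: "f \<in> carrier (HH b0)" for f
    proof -
      have "?D (?E f) = (\<lambda>x\<in>carrier M. \<zero>\<^bsub>FF b0\<^esub>)"
        using linmap_closed[OF p linmap_closed[OF hl[OF f]]] by (intro restrict_ext) (simp add: dj)
      then show ?thesis using zero by simp
    qed
    show "?E (?D g) \<in> HH' b1" if g: "g \<in> carrier (HH b1)" for g
    proof -
      have "?E (?D g) = (\<lambda>x\<in>carrier M. \<zero>\<^bsub>FF b1\<^esub>)"
        using linmap_closed[OF hl[OF g]] by (intro restrict_ext) (simp add: pd j0)
      then show ?thesis using zero by simp
    qed
    show "?D \<iota> \<in> HH' b0"
    proof -
      have "?D \<iota> = (\<lambda>x\<in>carrier M. \<zero>\<^bsub>FF b0\<^esub>)" by (intro restrict_ext) (simp add: dj \<iota>_def)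
      then show ?thesis using zero by simp
    qed
    \<comment> \<open>By \<open>factor_lift\<close> the equation j p f = w \<phi> becomes j p f = j
      p w' \<phi>. Hence f - w' \<phi> has values in ker p and \<open>lift\<close> applies to it,
      while w' \<phi> belongs to the submodule divided out.\<close>
    show "f \<in> ?D ` carrier (HH b1) <+>\<^bsub>HH b0\<^esub> HH' b0"
      if f: "f \<in> carrier (HH b0)" and Ef: "?E f \<in> HH' b1" for f
    proof -
      note fl = hl[OF f]
      obtain w where w: "linmap R (FF r) (FF b1) w" "\<And>x. x \<in> carrier M \<Longrightarrow> ?E f x = w (\<phi> x)"
        using Ef unfolding HH'_iff[OF linmap_closed[OF E f]] by blast
      have wx: "w (\<phi> x) = j (p (f x))" if "x \<in> carrier M" for x using w(2)[OF that] that by simp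
      have "d (w (\<phi> x)) = \<zero>\<^bsub>FF b0\<^esub>" if "x \<in> carrier M" for x
        using that dj[OF linmap_closed[OF p linmap_closed[OF fl that]]] by (simp add: wx)
      then obtain w' where w': "linmap R (FF r) (FF b0) w'"
        and jw': "\<And>v. v \<in> carrier (FF r) \<Longrightarrow> j (p (w' v)) = w v" using factor_lift[OF w(1)] by blast
      note w'\<phi> = linmap_comp[OF \<phi> w']
      let ?k = "\<lambda>x\<in>carrier M. w' (\<phi> x)"
      have kc: "?k \<in> carrier (HH b0)" using linmap_restrict[OF module_axioms w'\<phi>] by simp
      have k: "?k \<in> HH' b0" unfolding HH'_iff[OF kc] by (rule exI[of _ w']) (simp add: w')
      let ?f0 = "\<lambda>x\<in>carrier M. f x \<ominus>\<^bsub>FF b0\<^esub> w' (\<phi> x)"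
      note f0l = MF0.linmap_diff[OF fl w'\<phi>]
      have f0: "?f0 \<in> carrier (HH b0)" using linmap_restrict[OF module_axioms f0l] by simp
      have "p (?f0 x) = \<zero>\<^bsub>M\<^esub>" if x: "x \<in> carrier M" for x
      proof -
        interpret F0M: two_modules R "FF b0" M by (rule FF_two_modules)
        note cc = linmap_closed[OF fl x] linmap_closed[OF w'\<phi> x]
        have "j (p (f x)) = j (p (w' (\<phi> x)))" using jw'[OF linmap_closed[OF \<phi> x]] wx[OF x] by simp
        then have "p (f x) = p (w' (\<phi> x))"
          using j_inj linmap_closed[OF p cc(1)] linmap_closed[OF p cc(2)] by (simp add: inj_on_def)
        then show ?thesis using x cc linmap_closed[OF p] by (simp add: F0M.linmap_minus[OF p] minus_eq_zero_iff)
      qed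
      then obtain g where g: "g \<in> carrier (HH b1)" "\<And>x. x \<in> carrier M \<Longrightarrow> d (g x) = ?f0 x"
        using lift[OF f0] by blast
      have "f = ?D g \<oplus>\<^bsub>HH b0\<^esub> ?k"
      proof (rule MF0.mod_hom_eqI)
        show "f \<in> mod_hom R M (FF b0)" using f by simp
        show "?D g \<oplus>\<^bsub>HH b0\<^esub> ?k \<in> mod_hom R M (FF b0)"
          using H0.M.a_closed[OF linmap_closed[OF D g(1)] kc] by simp
        fix x assume x: "x \<in> carrier M"
        have "f x = (f x \<ominus>\<^bsub>FF b0\<^esub> w' (\<phi> x)) \<oplus>\<^bsub>FF b0\<^esub> w' (\<phi> x)"
          using linmap_closed[OF fl x] linmap_closed[OF w'\<phi> x] by (simp only: a_minus_def F0.M.a_assoc F0.M.a_inv_closed F0.M.l_neg F0.M.r_zero)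
        also have "\<dots> = d (g x) \<oplus>\<^bsub>FF b0\<^esub> w' (\<phi> x)" using g(2)[OF x] x by simp
        finally show "f x = (?D g \<oplus>\<^bsub>HH b0\<^esub> ?k) x" using x by (simp del: free_module_simps)
      qed
      then show ?thesis unfolding H0.mem_set_add using g(1) k by blast
    qed
  qed
  \<comment> \<open>This reads j = j p f + w \<phi>. Both j and j p f are killed by d, so d w \<phi>
    = 0 and w = j p w' for some w'. Injectivity of j turns j = j p (f + w' \<phi>) into the
    splitting f + w' \<phi>.\<close>
  then obtain f k where f: "f \<in> carrier (HH b0)" and k: "k \<in> HH' b1" and eq: "\<iota> = ?E f \<oplus>\<^bsub>HH b1\<^esub> k"
    unfolding H1.mem_set_add by blast
  note fl = hl[OF f]
  have kc: "k \<in> carrier (HH b1)" by (rule H1.submodule_mem[OF HH'_submodule k])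
  obtain w where w: "linmap R (FF r) (FF b1) w" "\<And>x. x \<in> carrier M \<Longrightarrow> k x = w (\<phi> x)"
    using k unfolding HH'_iff[OF kc] by blast
  have jx: "j x = j (p (f x)) \<oplus>\<^bsub>FF b1\<^esub> w (\<phi> x)" if x: "x \<in> carrier M" for x
    using fun_cong[OF eq, of x] x w(2)[OF x] unfolding \<iota>_def by (simp del: free_module_simps)
  have "d (w (\<phi> x)) = \<zero>\<^bsub>FF b0\<^esub>" if x: "x \<in> carrier M" for x
  proof -
    note cc = linmap_closed[OF p linmap_closed[OF fl x]] linmap_closed[OF w(1) linmap_closed[OF \<phi> x]]
    have "\<zero>\<^bsub>FF b0\<^esub> = d (j (p (f x)) \<oplus>\<^bsub>FF b1\<^esub> w (\<phi> x))" using dj[OF x] unfolding jx[OF x] by simp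
    also have "\<dots> = \<zero>\<^bsub>FF b0\<^esub> \<oplus>\<^bsub>FF b0\<^esub> d (w (\<phi> x))"
      by (simp only: linmap_add[OF d linmap_closed[OF j cc(1)] cc(2)] dj[OF cc(1)])
    also have "\<dots> = d (w (\<phi> x))" by (rule F0.M.l_zero[OF linmap_closed[OF d cc(2)]])
    finally show ?thesis by simp
  qed
  then obtain w' where w': "linmap R (FF r) (FF b0) w'"
    and jw': "\<And>v. v \<in> carrier (FF r) \<Longrightarrow> j (p (w' v)) = w v" using factor_lift[OF w(1)] by blast
  note w'\<phi> = linmap_comp[OF \<phi> w']
  show ?thesis
  proof (rule that[OF MF0.linmap_plus[OF fl w'\<phi>]])
    fix x assume x: "x \<in> carrier M"
    note cc = linmap_closed[OF fl x] linmap_closed[OF w'\<phi> x]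
    note pc = linmap_closed[OF p cc(1)] linmap_closed[OF p cc(2)]
    have "j (p (f x \<oplus>\<^bsub>FF b0\<^esub> w' (\<phi> x))) = j (p (f x)) \<oplus>\<^bsub>FF b1\<^esub> j (p (w' (\<phi> x)))"
      by (simp only: linmap_add[OF p cc] linmap_add[OF j pc])
    also have "\<dots> = j x" unfolding jw'[OF linmap_closed[OF \<phi> x]] by (rule jx[OF x, symmetric])
    finally show "p (f x \<oplus>\<^bsub>FF b0\<^esub> w' (\<phi> x)) = x"
      using inj_onD[OF j_inj] linmap_closed[OF p F0.M.a_closed[OF cc]] x by blast
  qed
qed

end

section \<open>Minimality and the final contradiction\<close>

lemma ideal_smult_coord:
  assumes "cring R" and I: "ideal I R" and v: "v \<in> ideal_smult R (free_module R X) I" and i: "i \<in> X"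
  shows "v i \<in> I"
proof -
  interpret cring R by fact
  interpret F: module R "free_module R X" by (rule free_module_module)
  interpret FS: two_modules R "free_module R X" self
    by (simp add: two_modules_def F.module_axioms self_module)
  interpret I: ideal I R by (rule I)
  note [simp del] = free_module_simps(1)
  let ?H = "{v \<in> carrier (free_module R X). v i \<in> I}"
  have sub: "submodule ?H R (free_module R X)"
    using I by (intro FS.submodule_vimage[OF linmap_coord[OF i] F.carrier_is_submodule])
      (simp add: submodule_self_iff)
  have "a \<odot>\<^bsub>free_module R X\<^esub> v \<in> ?H" if "a \<in> I" "v \<in> carrier (free_module R X)" for a v
    using that F.smult_closed[OF I.a_Hcarr] I.I_r_closed free_module_closed[OF that(2) i] i by simp
  then have "ideal_smult R (free_module R X) I \<subseteq> ?H"
    unfolding ideal_smult_def by (intro submod_span_least[OF sub]) blast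
  then show ?thesis using v by auto
qed

text \<open>If \<open>p\<close> splits then \<open>ker p\<close> is a direct summand of \<open>F\<^sub>0\<close> that lies in \<open>\<mm> F\<^sub>0\<close>, so it
  vanishes by Nakayama's lemma.\<close>

lemma (in periodic_module) split_imp_zero:
  assumes "local_ring R" and noeth: "noetherian_ring R"
    and d_min: "d ` carrier (FF b1) \<subseteq> ideal_smult R (FF b0) (max_ideal R)"
    and j_min: "j ` carrier M \<subseteq> ideal_smult R (FF b1) (max_ideal R)"
    and \<sigma>: "linmap R M (FF b0) \<sigma>" "\<And>x. x \<in> carrier M \<Longrightarrow> p (\<sigma> x) = x"
  shows "carrier M = {\<zero>\<^bsub>M\<^esub>}"
proof -
  interpret L: local_ring R by fact
  interpret F0: module R "FF b0" by (rule FF_module)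
  interpret F1: module R "FF b1" by (rule FF_module)
  interpret F0M: two_modules R "FF b0" M by (rule FF_two_modules)
  interpret MF0: two_modules R M "FF b0" by (rule FF_two_modules)
  interpret F00: two_modules R "FF b0" "FF b0" by (rule FF_two_modules)
  interpret MF1: two_modules R M "FF b1" by (rule FF_two_modules)
  note [simp del] = free_module_simps
  let ?m = "max_ideal R"
  have m: "ideal ?m R" "\<one> \<notin> ?m" "\<And>a. a \<in> ?m \<Longrightarrow> \<one> \<ominus> a \<in> Units R"
  proof -
    obtain a where "a \<in> ?m"
    proof
      have "maximalideal ?m R" unfolding max_ideal_def by (rule theI'[OF L.unique_maximalideal])
      then interpret maximalideal ?m R .
      show "\<zero> \<in> ?m" by simp
    qed
    then show "ideal ?m R" "\<one> \<notin> ?m" by (rule L.one_minus_max_ideal_unit[OF noeth])+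
    show "\<one> \<ominus> a \<in> Units R" if "a \<in> ?m" for a by (rule L.one_minus_max_ideal_unit(1)[OF noeth that])
  qed
  note coord = ideal_smult_coord[OF R.is_cring m(1)]
  \<comment> \<open>The projection of F0 onto ker p along the image of \<sigma>.\<close>
  let ?\<pi> = "\<lambda>v. v \<ominus>\<^bsub>FF b0\<^esub> \<sigma> (p v)"
  have id: "linmap R (FF b0) (FF b0) (\<lambda>v. v)" unfolding linmap_def by simp
  have \<pi>: "linmap R (FF b0) (FF b0) ?\<pi>" by (rule F00.linmap_diff[OF id linmap_comp[OF p \<sigma>(1)]])
  have p\<pi>: "p (?\<pi> v) = \<zero>\<^bsub>M\<^esub>" if v: "v \<in> carrier (FF b0)" for v
    using linmap_closed[OF p v] v linmap_closed[OF \<sigma>(1)]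
    by (simp add: F0M.linmap_minus[OF p] \<sigma>(2) minus_eq_zero_iff)
  have \<pi>_fix: "?\<pi> v = v" if v: "v \<in> carrier (FF b0)" and "p v = \<zero>\<^bsub>M\<^esub>" for v
    using that MF0.linmap_zero[OF \<sigma>(1)] by (simp add: a_minus_def)
  let ?e = "free_gen R {..<b0}"
  note e = R.free_gen_closed[of "{..<b0}"]
  have \<pi>e: "?\<pi> (?e i) \<in> carrier (FF b0)" for i by (rule linmap_closed[OF \<pi> e])
  have "?\<pi> (?e i) = \<zero>\<^bsub>FF b0\<^esub>" if "i < b0" for i
  proof (rule F0.nakayama[OF m(1,3) _ _ that])
    fix i
    show "?\<pi> (?e i) \<in> carrier (FF b0)" by (rule \<pi>e)
    have \<pi>_min: "?\<pi> (?e i) \<in> ideal_smult R (FF b0) ?m"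
      using p\<pi>[OF e] exact_p[OF \<pi>e] d_min by blast
    have "\<forall>k<b0. ?\<pi> (?e i) k \<in> ?m" using coord[OF \<pi>_min] by simp
    \<comment> \<open>As \<pi> is idempotent, \<pi>(e_i) is the combination of the \<pi>(e_k) with
      its own coordinates as coefficients, and these lie in the maximal ideal by minimality.\<close>
    moreover have "?\<pi> (?e i) = (\<Oplus>\<^bsub>FF b0\<^esub>k\<in>{..<b0}. ?\<pi> (?e i) k \<odot>\<^bsub>FF b0\<^esub> ?\<pi> (?e k))"
      using F0.linmap_free_expand[OF \<pi> \<pi>e[of i]] unfolding \<pi>_fix[OF \<pi>e p\<pi>[OF e]] .
    ultimately show "\<exists>c. (\<forall>k<b0. c k \<in> ?m) \<and>
        ?\<pi> (?e i) = (\<Oplus>\<^bsub>FF b0\<^esub>k\<in>{..<b0}. c k \<odot>\<^bsub>FF b0\<^esub> ?\<pi> (?e k))"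
      by (intro exI[of _ "?\<pi> (?e i)"] conjI)
  qed
  then have \<pi>0: "?\<pi> v = \<zero>\<^bsub>FF b0\<^esub>" if "v \<in> carrier (FF b0)" for v
    by (rule_tac R.linmap_free_eq[OF F0.module_axioms \<pi> F00.linmap_0 _ that]) simp
  \<comment> \<open>Now ker p = 0 forces d = 0, so all of F1 is ker d = j(M), whose vectors have
    coordinates in the maximal ideal. A basis vector of F1 would put the coordinate 1 there.\<close>
  have dj: "u \<in> j ` carrier M" if u: "u \<in> carrier (FF b1)" for u
  proof -
    note du = linmap_closed[OF d u]
    have "p (d u) = \<zero>\<^bsub>M\<^esub>" using exact_p[OF du] u by blast
    then have "d u = \<zero>\<^bsub>FF b0\<^esub>" using \<pi>_fix[OF du] \<pi>0[OF du] by simp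
    then show ?thesis using exact_d[OF u] by simp
  qed
  have "b1 = 0"
  proof (rule ccontr)
    assume "b1 \<noteq> 0"
    then have "0 \<in> {..<b1}" by simp
    moreover have "free_gen R {..<b1} 0 \<in> ideal_smult R (FF b1) ?m"
      using dj[OF R.free_gen_closed] j_min by blast
    ultimately have "free_gen R {..<b1} 0 0 \<in> ?m" by (rule coord[rotated])
    then show False using m(2) \<open>0 \<in> {..<b1}\<close> by (simp add: free_gen_apply)
  qed
  then have "j x = j \<zero>\<^bsub>M\<^esub>" if "x \<in> carrier M" for x
    using that by (intro R.free_module_eqI[OF linmap_closed[OF j that] linmap_closed[OF j M.zero_closed]]) simp
  then show ?thesis using j_inj by (auto dest: inj_onD)
qed

text \<open>The second syzygy is the image of \<open>d 1\<close>, which by exactness is the kernel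
  of \<open>d 0\<close>; so the periodicity isomorphism embeds \<open>M\<close> into F1 as ker d.
  Minimality of \<open>d 1\<close> is what bounds the image of \<open>j\<close>.\<close>

lemma two_periodicE:
  assumes "module R M" "two_periodic R M"
  obtains b0 b1 p d j where "periodic_module R M b0 b1 p d j"
    "d ` carrier (free_module R {..<b1}) \<subseteq> ideal_smult R (free_module R {..<b0}) (max_ideal R)"
    "j ` carrier M \<subseteq> ideal_smult R (free_module R {..<b1}) (max_ideal R)"
proof -
  interpret module R M by fact
  let ?F = "\<lambda>n. free_module R {..<n}"
  obtain b d p where res: "min_free_resolution R M b d p"
    and iso: "mod_iso R M ((?F (b 1))\<lparr>carrier := d 1 ` carrier (?F (b 2))\<rparr>)"
    using assms(2) unfolding two_periodic_def is_syzygy_def by (auto simp: numeral_2_eq_2)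
  note [simp del] = free_module_simps
  have p: "p \<in> mod_hom R (?F (b 0)) M" and d: "\<And>i. d i \<in> mod_hom R (?F (b (Suc i))) (?F (b i))"
    and onto: "p ` carrier (?F (b 0)) = carrier M"
    and ex0: "d 0 ` carrier (?F (b 1)) = a_kernel (?F (b 0)) M p"
    and ex1: "\<And>i. d (Suc i) ` carrier (?F (b (Suc (Suc i)))) = a_kernel (?F (b (Suc i))) (?F (b i)) (d i)"
    and min: "\<And>i. d i ` carrier (?F (b (Suc i))) \<subseteq> ideal_smult R (?F (b i)) (max_ideal R)"
    using res unfolding min_free_resolution_def Let_def by auto
  obtain j where j: "j \<in> mod_hom R M ((?F (b 1))\<lparr>carrier := d 1 ` carrier (?F (b 2))\<rparr>)"
    and bij: "bij_betw j (carrier M) (d 1 ` carrier (?F (b 2)))"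
    using iso unfolding mod_iso_def by auto
  have im: "j ` carrier M = d 1 ` carrier (?F (b 2))" using bij by (simp add: bij_betw_def)
  have d1: "d 1 ` carrier (?F (b 2)) = a_kernel (?F (b 1)) (?F (b 0)) (d 0)"
    using ex1[of 0] by (simp add: numeral_2_eq_2)
  have "periodic_module R M (b 0) (b 1) p (d 0) j"
  proof (unfold_locales)
    show "linmap R (?F (b 0)) M p" using p by (simp add: mod_hom_iff)
    show "linmap R (?F (b 1)) (?F (b 0)) (d 0)" using d[of 0] by (simp add: mod_hom_iff)
    have "d 1 ` carrier (?F (b 2)) \<subseteq> carrier (?F (b 1))" unfolding d1 by (auto simp: a_kernel_def')
    then show "linmap R M (?F (b 1)) j"
      using j unfolding mod_hom_iff linmap_def by (auto simp: Pi_iff)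
    show "p ` carrier (?F (b 0)) = carrier M" by (rule onto)
    show "inj_on j (carrier M)" using bij by (simp add: bij_betw_def)
    show "p v = \<zero>\<^bsub>M\<^esub> \<longleftrightarrow> v \<in> d 0 ` carrier (?F (b 1))" if "v \<in> carrier (?F (b 0))" for v
      using that unfolding ex0 by (simp add: a_kernel_def')
    show "d 0 v = \<zero>\<^bsub>?F (b 0)\<^esub> \<longleftrightarrow> v \<in> j ` carrier M" if "v \<in> carrier (?F (b 1))" for v
      using that unfolding im d1 by (simp add: a_kernel_def')
  qed
  then show ?thesis using that min[of 0] min[of 1] im by (simp add: numeral_2_eq_2)
qed

theorem theorem3:
  fixes R :: "('a, 'r) ring_scheme" and M :: "('a, 'b, 'm) module_scheme"
  assumes "local_ring R" and "noetherian_ring R" and "krull_dim R = 1"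
    and "module R M" and "carrier M \<noteq> {\<zero>\<^bsub>M\<^esub>}" and "fin_gen R M"
    and "two_periodic R M" and "has_rank R M"
  shows "torsion R (tensor_module R M (dual R M)) \<noteq> {\<zero>\<^bsub>tensor_module R M (dual R M)\<^esub>}"
proof
  let ?T = "tensor_module R M (dual R M)"
  assume tors: "torsion R ?T = {\<zero>\<^bsub>?T\<^esub>}"
  obtain b0 b1 p d j where per: "periodic_module R M b0 b1 p d j"
    and d_min: "d ` carrier (free_module R {..<b1}) \<subseteq> ideal_smult R (free_module R {..<b0}) (max_ideal R)"
    and j_min: "j ` carrier M \<subseteq> ideal_smult R (free_module R {..<b1}) (max_ideal R)"
    by (rule two_periodicE[OF assms(4,7)])
  interpret P: periodic_module R M b0 b1 p d j by (rule per)
  obtain r :: nat and s \<phi> \<xi> where "s \<in> nonzerodivisors R"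
    "linmap R M (free_module R {..<r}) \<phi>" "linmap R (free_module R {..<r}) M \<xi>"
    "\<And>x. x \<in> carrier M \<Longrightarrow> \<xi> (\<phi> x) = s \<odot>\<^bsub>M\<^esub> x"
    "\<And>v. v \<in> carrier (free_module R {..<r}) \<Longrightarrow> \<phi> (\<xi> v) = s \<odot>\<^bsub>free_module R {..<r}\<^esub> v"
    by (rule has_rankE[OF assms(4,6,8)]) (blast intro: P.torsionless, rule that)
  then interpret ranked_periodic_module R M b0 b1 p d j r s \<phi> \<xi>
    by unfold_locales
  \<comment> \<open>Here the assumed absence of torsion is used: the tensor of a map into ker p is
    annihilated by \<open>s\<close>, hence zero, and \<open>tensor_of_eq_zeroD\<close> supplies the
    lift.\<close>
  have lift: "\<exists>g\<in>carrier (hom_module R M (free_module R {..<b1})). \<forall>x\<in>carrier M. d (g x) = f x"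
    if f: "f \<in> carrier (hom_module R M (free_module R {..<b0}))"
      and pf: "\<And>x. x \<in> carrier M \<Longrightarrow> p (f x) = \<zero>\<^bsub>M\<^esub>" for f
  proof -
    have "tensor_of f \<in> torsion R ?T"
      unfolding torsion_def using linmap_closed[OF tensor_of_linmap f] tensor_of_torsion[OF f pf] s by blast
    then have "tensor_of f = \<zero>\<^bsub>?T\<^esub>" using tors by simp
    then obtain g where g: "g \<in> carrier (hom_module R M (free_module R {..<b1}))"
      "\<And>x. x \<in> carrier M \<Longrightarrow> d (g x) = f x" by (rule tensor_of_eq_zeroD[OF f]) (rule that)
    show ?thesis by (rule bexI[OF _ g(1)]) (simp add: g(2))
  qed
  obtain \<sigma> where "linmap R M (free_module R {..<b0}) \<sigma>" "\<And>x. x \<in> carrier M \<Longrightarrow> p (\<sigma> x) = x"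
    by (rule splitting_of_lifting[OF assms(2,3)]) (rule lift, assumption, blast, rule that)
  from P.split_imp_zero[OF assms(1,2) d_min j_min this] show False using assms(5) by simp
qed

end
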